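(* Fix $\gamma>-1$. Any $f\in L^2_\gamma(\mathbb{D})$ admits a unique $L^2_\gamma(\mathbb{D})$-orthogonal decomposition $$f=d^{-\gamma}\,\partial v+g,$$ for some $v\in H^{1,-\gamma}_0(\mathbb{D})$ and $g\in L^2_\gamma(\mathbb{D})\cap\ker\bar\partial$. Moreover, there is a constant $C$ independent of $f$ such that $$\|v\|_{H^{1,-\gamma}_0(\mathbb{D})}+\|g\|_{L^2_\gamma(\mathbb{D})}\le C\|f\|_{L^2_\gamma(\mathbb{D})}.$$ Likewise, there exists a unique decomposition $f=d^{-\gamma}\,\bar\partial v'+g'$ with $v'\in H^{1,-\gamma}_0(\mathbb{D})$, $g'\in L^2_\gamma(\mathbb{D})$ and $\partial g'=0$, satisfying a similar stability estimate.
   Context: $\mathbb{D}=\{z=x+iy\in\mathbb{C}:|z|\le 1\}$, $d(z)=1-|z|^2$; functions are complex-valued. $\partial=\frac12(\partial_x-i\partial_y)$, $\bar\partial=\frac12(\partial_x+i\partial_y)$. $L^2_\gamma(\mathbb{D})=L^2(\mathbb{D},d^\gamma\,\mathrm{d}x\,\mathrm{d}y)$, and $L^2_\gamma(\mathbb{D})\cap\ker\bar\partial$, $L^2_\gamma(\mathbb{D})\cap\ker\partial$ are the closed subspaces of $L^2_\gamma$-integrable analytic, resp. antianalytic, functions on $\mathbb{D}^\circ$. $H^{1,-\gamma}_0(\mathbb{D})$ is the completion of $C_c^\infty(\mathbb{D}^\circ)$ for the norm $\|u\|^2=\|u\|^2_{L^2_{-\gamma}(\mathbb{D})}+\|\nabla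 u\|^2_{L^2_{-\gamma}(\mathbb{D})}$. *)

theory Defs
  imports "HOL-Complex_Analysis.Complex_Analysis"
begin

definition disk_defect :: "complex \<Rightarrow> real" where
  "disk_defect z = 1 - (cmod z)\<^sup>2"

definition disk_measure :: "real \<Rightarrow> complex measure" where
  "disk_measure s =
     density (lebesgue_on (cball 0 1)) (\<lambda>z. ennreal (disk_defect z powr s))"

text \<open>
  Elements of \<open>L\<^sup>2\<close> are represented by functions; equality in \<open>L\<^sup>2\<close> is equality almost everywhere
  on the disk. The values of a representative outside the closed disk are irrelevant.
\<close>

definition L2 :: "real \<Rightarrow> (complex \<Rightarrow> complex) set" where
  "L2 s = {f. f \<in> borel_measurable (disk_measure s) \<and>
              integrable (disk_measure s) (\<lambda>z. (cmod (f z))\<^sup>2)}"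

definition L2_norm :: "real \<Rightarrow> (complex \<Rightarrow> complex) \<Rightarrow> real" where
  "L2_norm s f = sqrt (\<integral>z. (cmod (f z))\<^sup>2 \<partial>disk_measure s)"

definition L2_inner :: "real \<Rightarrow> (complex \<Rightarrow> complex) \<Rightarrow> (complex \<Rightarrow> complex) \<Rightarrow> complex" where
  "L2_inner s f g = (\<integral>z. f z * cnj (g z) \<partial>disk_measure s)"

definition ae_eq :: "(complex \<Rightarrow> complex) \<Rightarrow> (complex \<Rightarrow> complex) \<Rightarrow> bool" where
  "ae_eq f g \<longleftrightarrow> (AE z in lebesgue_on (cball 0 1). f z = g z)"

definition analytic_L2 :: "real \<Rightarrow> (complex \<Rightarrow> complex) set" where
  "analytic_L2 s = {g \<in> L2 s. g holomorphic_on ball 0 1}"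

definition antianalytic_L2 :: "real \<Rightarrow> (complex \<Rightarrow> complex) set" where
  "antianalytic_L2 s = {g \<in> L2 s. (\<lambda>z. cnj (g z)) holomorphic_on ball 0 1}"

text \<open>Real partial derivatives in \<open>x\<close> and \<open>y\<close>, where \<open>z = x + iy\<close>.\<close>

definition pdx :: "(complex \<Rightarrow> complex) \<Rightarrow> complex \<Rightarrow> complex" where
  "pdx f z = frechet_derivative f (at z) 1"

definition pdy :: "(complex \<Rightarrow> complex) \<Rightarrow> complex \<Rightarrow> complex" where
  "pdy f z = frechet_derivative f (at z) \<i>"

text \<open>Here \<open>differentiable\<close> is real (Frechet) differentiability, not holomorphy.\<close>

primrec C_k :: "nat \<Rightarrow> (complex \<Rightarrow> complex) \<Rightarrow> bool" where
  "C_k 0 f \<longleftrightarrow> continuous_on UNIV f"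
| "C_k (Suc k) f \<longleftrightarrow> (\<forall>z. f differentiable (at z)) \<and> C_k k (pdx f) \<and> C_k k (pdy f)"

text \<open>
  \<open>C\<^sub>c\<^sup>\<infinity>\<close> of the open disk, its elements being extended by zero to the whole plane. The support is
  a closed bounded set, hence compact.
\<close>

definition test_functions :: "(complex \<Rightarrow> complex) set" where
  "test_functions = {\<phi>. (\<forall>k. C_k k \<phi>) \<and> closure {z. \<phi> z \<noteq> 0} \<subseteq> ball 0 1}"

text \<open>
  The completion of the test functions for the norm
  \<open>\<parallel>u\<parallel>\<^sup>2 + \<parallel>\<nabla>u\<parallel>\<^sup>2\<close> (norms in \<open>L2 s\<close>) is realised isometrically as the closure of
  \<open>{(\<phi>, pdx \<phi>, pdy \<phi>) | \<phi> test function}\<close> in \<open>L2 s \<times> L2 s \<times> L2 s\<close>.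
  Thus \<open>H10 s v vx vy\<close> says that \<open>v\<close> belongs to the completion and has gradient \<open>(vx, vy)\<close>;
  \<open>vx\<close> and \<open>vy\<close> are the values at \<open>v\<close> of the continuous extensions of \<open>pdx\<close> and \<open>pdy\<close>, and they
  coincide with the distributional derivatives of \<open>v\<close> in the open disk. Two elements
  are equal in the completion iff the three components agree almost everywhere.
\<close>

definition H10 ::
    "real \<Rightarrow> (complex \<Rightarrow> complex) \<Rightarrow> (complex \<Rightarrow> complex) \<Rightarrow> (complex \<Rightarrow> complex) \<Rightarrow> bool" where
  "H10 s v vx vy \<longleftrightarrow>
     v \<in> L2 s \<and> vx \<in> L2 s \<and> vy \<in> L2 s \<and>
     (\<exists>\<phi> :: nat \<Rightarrow> complex \<Rightarrow> complex.
        (\<forall>n. \<phi> n \<in> test_functions) \<and>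
        (\<lambda>n. L2_norm s (\<lambda>z. \<phi> n z - v z)) \<longlonglongrightarrow> 0 \<and>
        (\<lambda>n. L2_norm s (\<lambda>z. pdx (\<phi> n) z - vx z)) \<longlonglongrightarrow> 0 \<and>
        (\<lambda>n. L2_norm s (\<lambda>z. pdy (\<phi> n) z - vy z)) \<longlonglongrightarrow> 0)"

definition H10_norm ::
    "real \<Rightarrow> (complex \<Rightarrow> complex) \<Rightarrow> (complex \<Rightarrow> complex) \<Rightarrow> (complex \<Rightarrow> complex) \<Rightarrow> real" where
  "H10_norm s v vx vy = sqrt ((L2_norm s v)\<^sup>2 + ((L2_norm s vx)\<^sup>2 + (L2_norm s vy)\<^sup>2))"

text \<open>The Wirtinger derivatives of a function with gradient \<open>(vx, vy)\<close>.\<close>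

definition wirtinger ::
    "(complex \<Rightarrow> complex) \<Rightarrow> (complex \<Rightarrow> complex) \<Rightarrow> complex \<Rightarrow> complex" where
  "wirtinger vx vy z = (vx z - \<i> * vy z) / 2"

definition wirtinger_bar ::
    "(complex \<Rightarrow> complex) \<Rightarrow> (complex \<Rightarrow> complex) \<Rightarrow> complex \<Rightarrow> complex" where
  "wirtinger_bar vx vy z = (vx z + \<i> * vy z) / 2"

definition weighted :: "real \<Rightarrow> (complex \<Rightarrow> complex) \<Rightarrow> complex \<Rightarrow> complex" where
  "weighted s u z = of_real (disk_defect z powr s) * u z"

definition decomposition ::
    "real \<Rightarrow> (complex \<Rightarrow> complex) \<Rightarrow>
     (complex \<Rightarrow> complex) \<Rightarrow> (complex \<Rightarrow> complex) \<Rightarrow> (complex \<Rightarrow> complex) \<Rightarrow>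
     (complex \<Rightarrow> complex) \<Rightarrow> bool" where
  "decomposition \<gamma> f v vx vy g \<longleftrightarrow>
     H10 (- \<gamma>) v vx vy \<and> g \<in> analytic_L2 \<gamma> \<and>
     ae_eq f (\<lambda>z. weighted (- \<gamma>) (wirtinger vx vy) z + g z)"

definition decomposition_bar ::
    "real \<Rightarrow> (complex \<Rightarrow> complex) \<Rightarrow>
     (complex \<Rightarrow> complex) \<Rightarrow> (complex \<Rightarrow> complex) \<Rightarrow> (complex \<Rightarrow> complex) \<Rightarrow>
     (complex \<Rightarrow> complex) \<Rightarrow> bool" where
  "decomposition_bar \<gamma> f v vx vy g \<longleftrightarrow>
     H10 (- \<gamma>) v vx vy \<and> g \<in> antianalytic_L2 \<gamma> \<and>
     ae_eq f (\<lambda>z. weighted (- \<gamma>) (wirtinger_bar vx vy) z + g z)"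

end

theory Submission
  imports Defs
begin

text \<open>
  Put \<open>s = - \<gamma> < 1\<close>, \<open>d = 1 - |z|^2\<close> and \<open>w = d powr s\<close>, and let \<open>\<partial>\<close> and \<open>\<partial>bar\<close> be the Wirtinger
  operators. Multiplication by \<open>d powr s\<close> is an isometry from \<open>L2 s\<close> onto \<open>L2 \<gamma>\<close>, so the candidates
  for the first summand of \<open>f\<close> are the functions \<open>w \<partial>v\<close>, and the decomposition is orthogonal projection
  in \<open>L2 \<gamma>\<close> onto the closure \<open>M\<close> of the set of all \<open>w \<partial>\<phi>\<close> with \<open>\<phi>\<close> a test function. Two analytic facts
  identify \<open>M\<close> and its orthogonal complement.

  \<^item> \<open>M\<close> is exactly \<open>{w \<partial>v | v in H10}\<close>, and \<open>\<partial>v\<close> determines \<open>v\<close>. This is the a priori estimate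
    \<open>\<parallel>\<phi>\<parallel>_{H10} \<le> C \<parallel>\<partial>\<phi>\<parallel>_{L2 s}\<close> (\<open>test_function_estimate\<close>): a sequence of test functions whose
    \<open>\<partial>\<phi>\<close> converges in \<open>L2 s\<close> is then a Cauchy sequence in \<open>H10\<close>.
  \<^item> The orthogonal complement of \<open>M\<close> consists of the analytic functions in \<open>L2 \<gamma>\<close>. The weight cancels in
    the inner product of \<open>h\<close> and \<open>w \<partial>\<phi>\<close>, which is the plain integral of \<open>h\<close> times \<open>\<partial>bar (cnj \<phi>)\<close>;
    so orthogonality to \<open>M\<close> says that \<open>\<partial>bar h = 0\<close> weakly, and Weyl's lemma applies
    (\<open>AE_eq_representative\<close>).

  Existence then follows from the projection theorem, and Pythagoras' theorem with the a priori estimate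
  gives uniqueness and stability. Complex conjugation exchanges \<open>\<partial>\<close> and \<open>\<partial>bar\<close> and gives the second
  decomposition.

  The a priori estimate rests on two integrations by parts. With
  \<open>E = \<integral>w|\<partial>\<phi>|^2\<close>, \<open>F = \<integral>w|\<partial>bar \<phi>|^2\<close>, \<open>D = \<integral>d powr (s-1) |\<phi>|^2\<close>, \<open>R = \<integral>|z|^2 d powr (s-2) |\<phi>|^2\<close>,
  \<open>B = Re \<integral>d powr (s-1) z \<partial>\<phi> cnj \<phi>\<close> and \<open>B' = Re \<integral>d powr (s-1) cnj z \<partial>bar \<phi> cnj \<phi>\<close> they read
  \<open>B + B' = - D - (1 - s) R\<close> and \<open>E - F = s (B - B')\<close>. For \<open>0 \<le> s < 1\<close>, eliminating \<open>B'\<close> and using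
  \<open>- 2 B \<le> E / (1 - s) + (1 - s) R\<close> gives \<open>F \<le> E / (1 - s)\<close>. For \<open>s < 0\<close>, the nonnegative quantity
  \<open>\<integral>w|\<partial>bar \<phi> - s (z/d) \<phi>|^2\<close> equals \<open>E + s (R + D)\<close>, so that \<open>R\<close> and \<open>D\<close> are bounded by \<open>E\<close>, and then so
  is \<open>F\<close>. Finally \<open>D + (1 - s) R = - B - B'\<close> yields a Poincare inequality. The hypothesis \<open>\<gamma> > - 1\<close>
  enters only through \<open>1 - s > 0\<close>.

  For Weyl's lemma, \<open>h\<close> is integrated against the rescaled bumps \<open>u \<beta>(u |z - \<zeta>|^2)\<close>. Their derivative in
  the scale \<open>u\<close> is \<open>\<partial>bar\<close> of a test function, so the regularization of \<open>h\<close> does not depend on \<open>u\<close>; the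
  same argument for the derivative in \<open>z\<close> shows that it is analytic. Since regularizations tend to a
  constant multiple of \<open>h\<close> as \<open>u\<close> tends to infinity, its normalization is a version of \<open>h\<close>.
\<close>

section \<open>Directional derivatives on the complex plane\<close>

text \<open>
  The derivative in direction \<open>b\<close>. Treating the two partial derivatives as the values at \<open>1\<close> and
  \<open>\<i>\<close> of one function proves every rule only once.
\<close>

definition dd :: "complex \<Rightarrow> (complex \<Rightarrow> complex) \<Rightarrow> complex \<Rightarrow> complex" where
  "dd b f z = frechet_derivative f (at z) b"

lemma pdx_eq_dd: "pdx = dd 1" and pdy_eq_dd: "pdy = dd \<i>"
  by (auto simp: fun_eq_iff pdx_def pdy_def dd_def)

lemma dd_eqI: "(f has_derivative f') (at z) \<Longrightarrow> dd b f z = f' b"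
  unfolding dd_def by (metis frechet_derivative_at)

lemma has_derivative_dd: "f differentiable (at z) \<Longrightarrow> (f has_derivative (\<lambda>b. dd b f z)) (at z)"
  unfolding dd_def by (simp add: frechet_derivative_works)

lemma dd_expand:
  assumes "f differentiable (at z)"
  shows "dd b f z = of_real (Re b) * dd 1 f z + of_real (Im b) * dd \<i> f z"
proof -
  interpret linear "\<lambda>b. dd b f z"
    using has_derivative_dd[OF assms] by (rule has_derivative_linear)
  have "dd b f z = dd (Re b *\<^sub>R 1 + Im b *\<^sub>R \<i>) f z"
    by (rule arg_cong[where f = "\<lambda>b. dd b f z"]) (simp add: complex_eq_iff)
  also have "\<dots> = Re b *\<^sub>R dd 1 f z + Im b *\<^sub>R dd \<i> f z"
    unfolding add scale ..
  finally show ?thesis by (simp add: scaleR_conv_of_real)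
qed

lemma dd_mult:
  assumes "f differentiable (at z)" "g differentiable (at z)"
  shows "dd b (\<lambda>z. f z * g z) z = f z * dd b g z + dd b f z * g z"
  by (rule dd_eqI) (rule has_derivative_mult[OF assms[THEN has_derivative_dd]])

lemma dd_add:
  assumes "f differentiable (at z)" "g differentiable (at z)"
  shows "dd b (\<lambda>z. f z + g z) z = dd b f z + dd b g z"
  by (rule dd_eqI) (rule has_derivative_add[OF assms[THEN has_derivative_dd]])

lemma dd_cmult:
  assumes "f differentiable (at z)"
  shows "dd b (\<lambda>z. c * f z) z = c * dd b f z"
  by (rule dd_eqI) (intro has_derivative_mult_right has_derivative_dd assms)

lemma dd_cnj:
  assumes "f differentiable (at z)"
  shows "dd b (\<lambda>z. cnj (f z)) z = cnj (dd b f z)"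
  by (rule dd_eqI) (intro has_derivative_cnj has_derivative_dd assms)

lemma differentiable_cnj:
  fixes f :: "complex \<Rightarrow> complex"
  shows "f differentiable (at z) \<Longrightarrow> (\<lambda>z. cnj (f z)) differentiable (at z)"
  unfolding differentiable_def by (blast intro: has_derivative_cnj)

lemma dd_line_derivative:
  assumes "F differentiable (at (z + s *\<^sub>R b))"
  shows "((\<lambda>s. F (z + s *\<^sub>R b)) has_vector_derivative dd b F (z + s *\<^sub>R b)) (at s within T)"
proof -
  have "((\<lambda>s. z + s *\<^sub>R b) has_derivative (\<lambda>h. h *\<^sub>R b)) (at s)"
    by (auto intro!: derivative_eq_intros)
  from has_derivative_compose[OF this has_derivative_dd[OF assms]]
  have "((\<lambda>s. F (z + s *\<^sub>R b)) has_derivative (\<lambda>h. dd (h *\<^sub>R b) F (z + s *\<^sub>R b))) (at s)" .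
  hence "((\<lambda>s. F (z + s *\<^sub>R b)) has_vector_derivative dd b F (z + s *\<^sub>R b)) (at s)"
    by (simp add: has_vector_derivative_def linear_scale[OF has_derivative_linear[OF has_derivative_dd[OF assms]]])
  thus ?thesis by (rule has_vector_derivative_at_within)
qed

text \<open>
  Symmetry of second derivatives. The increment of \<open>\<phi>\<close> in direction \<open>b\<close> is the integral of
  \<open>dd b \<phi>\<close>; differentiating it under the integral sign in direction \<open>c\<close>, and then differentiating the
  result with respect to the length of the increment, produces both orders.
\<close>

lemma dd_symmetric:
  assumes diff: "\<And>z. \<phi> differentiable (at z)" "\<And>z. dd b \<phi> differentiable (at z)" "\<And>z. dd c \<phi> differentiable (at z)"
    and cont: "continuous_on UNIV (dd c (dd b \<phi>))"
  shows "dd b (dd c \<phi>) z = dd c (dd b \<phi>) z"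
proof -
  have cont_b: "continuous_on UNIV (dd b \<phi>)"
    using diff(2) differentiable_imp_continuous_within by (intro continuous_at_imp_continuous_on ballI) blast
  have ftc: "integral {0..h} (\<lambda>t. dd b \<phi> (z + k *\<^sub>R c + t *\<^sub>R b)) = \<phi> (z + k *\<^sub>R c + h *\<^sub>R b) - \<phi> (z + k *\<^sub>R c)"
    if "0 \<le> h" for h k
  proof -
    have "((\<lambda>t. dd b \<phi> (z + k *\<^sub>R c + t *\<^sub>R b)) has_integral
        (\<phi> (z + k *\<^sub>R c + h *\<^sub>R b) - \<phi> (z + k *\<^sub>R c + 0 *\<^sub>R b))) {0..h}"
      by (rule fundamental_theorem_of_calculus[OF that]) (rule dd_line_derivative[OF diff(1)])
    thus ?thesis by (simp add: integral_unique)
  qed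
  have *: "dd c \<phi> (z + h *\<^sub>R b) - dd c \<phi> z = integral {0..h} (\<lambda>t. dd c (dd b \<phi>) (z + t *\<^sub>R b))"
    if h: "0 \<le> h" for h
  proof -
    have "((\<lambda>k. integral (cbox 0 h) (\<lambda>t. dd b \<phi> (z + k *\<^sub>R c + t *\<^sub>R b))) has_vector_derivative
          integral (cbox 0 h) (\<lambda>t. dd c (dd b \<phi>) (z + 0 *\<^sub>R c + t *\<^sub>R b))) (at 0 within UNIV)"
    proof (rule leibniz_rule_vector_derivative)
      fix k t :: real
      have "((\<lambda>k. dd b \<phi> ((z + t *\<^sub>R b) + k *\<^sub>R c)) has_vector_derivative
          dd c (dd b \<phi>) ((z + t *\<^sub>R b) + k *\<^sub>R c)) (at k within UNIV)"
        by (rule dd_line_derivative[OF diff(2)])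
      thus "((\<lambda>k. dd b \<phi> (z + k *\<^sub>R c + t *\<^sub>R b)) has_vector_derivative
          dd c (dd b \<phi>) (z + k *\<^sub>R c + t *\<^sub>R b)) (at k within UNIV)"
        by (simp add: add_ac)
      show "(\<lambda>t. dd b \<phi> (z + k *\<^sub>R c + t *\<^sub>R b)) integrable_on cbox 0 h"
        by (intro integrable_continuous continuous_on_compose2[OF cont_b] continuous_intros) auto
    next
      show "continuous_on (UNIV \<times> cbox 0 h) (\<lambda>(k, t). dd c (dd b \<phi>) (z + k *\<^sub>R c + t *\<^sub>R b))"
        unfolding split_beta
        by (intro continuous_on_compose2[OF cont] continuous_intros) auto
    qed auto
    moreover have "((\<lambda>k. \<phi> ((z + h *\<^sub>R b) + k *\<^sub>R c) - \<phi> (z + k *\<^sub>R c)) has_vector_derivative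
        (dd c \<phi> ((z + h *\<^sub>R b) + 0 *\<^sub>R c) - dd c \<phi> (z + 0 *\<^sub>R c))) (at 0 within UNIV)"
      by (intro has_vector_derivative_diff dd_line_derivative diff)
    moreover have "(\<lambda>k. integral (cbox 0 h) (\<lambda>t. dd b \<phi> (z + k *\<^sub>R c + t *\<^sub>R b)))
       = (\<lambda>k. \<phi> ((z + h *\<^sub>R b) + k *\<^sub>R c) - \<phi> (z + k *\<^sub>R c))"
      using ftc[OF h] by (simp add: add_ac)
    ultimately show ?thesis
      using vector_derivative_unique_at by (fastforce simp: fun_eq_iff)
  qed
  have "((\<lambda>h. integral {0..h} (\<lambda>t. dd c (dd b \<phi>) (z + t *\<^sub>R b))) has_vector_derivative
      dd c (dd b \<phi>) (z + 0 *\<^sub>R b)) (at 0 within {0..1})"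
    by (intro integral_has_vector_derivative continuous_on_compose2[OF cont] continuous_intros) auto
  hence "((\<lambda>h. dd c \<phi> (z + h *\<^sub>R b) - dd c \<phi> z) has_vector_derivative
      dd c (dd b \<phi>) (z + 0 *\<^sub>R b)) (at 0 within {0..1})"
    by (rule has_vector_derivative_transform[rotated 2]) (use * in auto)
  moreover have "((\<lambda>h. dd c \<phi> (z + h *\<^sub>R b) - dd c \<phi> z) has_vector_derivative
      dd b (dd c \<phi>) (z + 0 *\<^sub>R b) - 0) (at 0 within {0..1})"
    by (intro has_vector_derivative_diff dd_line_derivative diff has_vector_derivative_const)
  ultimately show ?thesis
    using vector_derivative_unique_within[of 0 "{0..1}" "\<lambda>h. dd c \<phi> (z + h *\<^sub>R b) - dd c \<phi> z"]
    by (simp add: at_within_Icc_at_right trivial_limit_at_right_real)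
qed

section \<open>Integration by parts for compactly supported functions\<close>

lemma integrable_lebesgue_compact_support:
  fixes f :: "complex \<Rightarrow> 'b::{banach, second_countable_topology}"
  assumes "continuous_on UNIV f" "\<And>z. r < cmod z \<Longrightarrow> f z = 0"
  shows "integrable lebesgue f" "integrable lborel f" "f \<in> borel_measurable borel"
proof -
  have "integrable lborel (\<lambda>z. indicator (cball 0 r) z *\<^sub>R f z)"
    using assms(1) by (intro borel_integrable_compact) (auto intro: continuous_on_subset)
  also have "(\<lambda>z. indicator (cball 0 r) z *\<^sub>R f z) = f"
    using assms(2) by (auto simp: fun_eq_iff indicator_def)
  finally show i: "integrable lborel f" .
  show m: "f \<in> borel_measurable borel"
    using assms(1) by (rule borel_measurable_continuous_onI)
  show "integrable lebesgue f"
    using i m by (subst integrable_completion) auto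
qed

lemma lebesgue_integral_translate:
  fixes f :: "complex \<Rightarrow> complex"
  assumes [measurable]: "f \<in> borel_measurable borel"
  shows "(\<integral>z. f (c + z) \<partial>lborel) = (\<integral>z. f z \<partial>lborel)"
proof -
  have "(\<integral>z. f z \<partial>lborel) = (\<integral>z. f z \<partial>distr lborel borel ((+) c))"
    by (simp add: lborel_distr_plus)
  also have "\<dots> = (\<integral>z. f (c + z) \<partial>lborel)"
    by (subst integral_distr) auto
  finally show ?thesis ..
qed

lemma dd_zero_outside:
  assumes "\<And>z. r < cmod z \<Longrightarrow> f z = 0" "r < cmod z"
  shows "dd b f z = 0"
proof -
  have "\<forall>\<^sub>F w in nhds z. w \<in> - cball 0 r"
    by (rule eventually_nhds_in_open) (use assms(2) in auto)
  hence "\<forall>\<^sub>F w in at z. 0 = f w"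
    unfolding eventually_at_filter by eventually_elim (use assms(1) in auto)
  with assms have "(f has_derivative (\<lambda>_. 0)) (at z)"
    by (intro has_derivative_transform_eventually[OF has_derivative_const[of 0]]) auto
  thus ?thesis by (rule dd_eqI)
qed

text \<open>
  Integrals over the plane are translation invariant, so every difference quotient of \<open>F\<close> has
  integral \<open>0\<close>; by the mean value theorem the quotients are dominated, and dominated convergence passes
  to the derivative.
\<close>

lemma integral_dd_eq_0:
  fixes F :: "complex \<Rightarrow> complex"
  assumes diff: "\<And>z. F differentiable (at z)"
    and cont: "continuous_on UNIV (dd b F)"
    and supp: "\<And>z. r < cmod z \<Longrightarrow> F z = 0"
  shows "(\<integral>z. dd b F z \<partial>lebesgue) = 0"
proof -
  have F_cont: "continuous_on UNIV F"
    using diff by (simp add: continuous_at_imp_continuous_on differentiable_imp_continuous_within)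
  note int_F = integrable_lebesgue_compact_support[OF F_cont supp]
  note int_dF = integrable_lebesgue_compact_support[OF cont dd_zero_outside[OF supp]]
  have [measurable]: "F \<in> borel_measurable borel" "dd b F \<in> borel_measurable borel"
    by (rule int_F(3) int_dF(3); assumption)+
  have "compact (dd b F ` cball 0 r)"
    using cont by (intro compact_continuous_image) (auto intro: continuous_on_subset)
  then obtain M where M: "\<And>w. w \<in> cball 0 r \<Longrightarrow> cmod (dd b F w) \<le> M"
    by (meson bounded_iff compact_imp_bounded imageI)
  have M': "cmod (dd b F w) \<le> max M 0" for w
  proof (cases "cmod w \<le> r")
    case True
    with M[of w] show ?thesis by (simp add: max.coboundedI1)
  next
    case False
    hence "dd b F w = 0" using dd_zero_outside[of r F w b, OF supp] by simp
    thus ?thesis by simp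
  qed
  have line_derivative:
    "((\<lambda>s. F (z + s *\<^sub>R b)) has_derivative (\<lambda>h. h *\<^sub>R dd b F (z + s *\<^sub>R b))) (at s)" for z s
    using dd_line_derivative[OF diff] unfolding has_vector_derivative_def .
  have mv: "cmod (F (z + t *\<^sub>R b) - F z) \<le> max M 0 * \<bar>t\<bar>" for z t
  proof -
    have "norm ((\<lambda>s. F (z + s *\<^sub>R b)) t - (\<lambda>s. F (z + s *\<^sub>R b)) 0) \<le> max M 0 * norm (t - 0)"
    proof (rule differentiable_bound[where S = UNIV and f' = "\<lambda>s h. h *\<^sub>R dd b F (z + s *\<^sub>R b)"])
      show "onorm (\<lambda>h. h *\<^sub>R dd b F (z + s *\<^sub>R b)) \<le> max M 0" for s :: real
        using M'[of "z + s *\<^sub>R b"] by (intro onorm_le) (simp add: mult.commute[of "max M 0"] mult_left_mono)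
    qed (use line_derivative in auto)
    thus ?thesis by simp
  qed
  define q where "q = (\<lambda>n z. (F ((1 / real (Suc n)) *\<^sub>R b + z) - F z) * of_nat (Suc n))"
  have int_tr: "integrable lborel (\<lambda>z. F (c + z))" for c
    using integrable_distr[of "(+) c" lborel borel F] int_F(2) by (simp add: lborel_distr_plus)
  have q0: "(\<integral>z. q n z \<partial>lborel) = 0" for n
    unfolding q_def using int_tr int_F(2)
    by (simp add: lebesgue_integral_translate Bochner_Integration.integral_diff)
  have "(\<lambda>n. \<integral>z. q n z \<partial>lborel) \<longlonglongrightarrow> (\<integral>z. dd b F z \<partial>lborel)"
  proof (rule integral_dominated_convergence[where w = "\<lambda>z. indicator (cball 0 (r + cmod b)) z * max M 0"])
    show "integrable lborel (\<lambda>z::complex. indicator (cball 0 (r + cmod b)) z * max M 0 :: real)"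
      using emeasure_lborel_cball_finite[of "0 :: complex" "r + cmod b"]
      by (intro integrable_mult_left) (simp add: integrable_indicator_iff less_top[symmetric])
    show "AE z in lborel. (\<lambda>n. q n z) \<longlonglongrightarrow> dd b F z"
    proof (rule AE_I2)
      fix z
      have "((\<lambda>s. F (z + s *\<^sub>R b)) has_vector_derivative dd b F z) (at 0)"
        unfolding has_vector_derivative_def
        using line_derivative[of z 0] by simp
      hence "((\<lambda>s. norm (F (z + s *\<^sub>R b) - F z - s *\<^sub>R dd b F z) / norm s) \<longlongrightarrow> 0) (at 0)"
        by (simp add: has_vector_derivative_def has_derivative_at)
      moreover have "\<forall>\<^sub>F s in at 0. norm (F (z + s *\<^sub>R b) - F z - s *\<^sub>R dd b F z) / norm s
          = norm ((1 / s) *\<^sub>R (F (z + s *\<^sub>R b) - F z) - dd b F z)"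
        unfolding eventually_at_filter
      proof (intro always_eventually allI impI)
        fix s :: real assume "s \<noteq> 0"
        hence "(1 / s) *\<^sub>R (F (z + s *\<^sub>R b) - F z) - dd b F z
          = (1 / s) *\<^sub>R (F (z + s *\<^sub>R b) - F z - s *\<^sub>R dd b F z)"
          by (simp add: scaleR_diff_right)
        thus "norm (F (z + s *\<^sub>R b) - F z - s *\<^sub>R dd b F z) / norm s
          = norm ((1 / s) *\<^sub>R (F (z + s *\<^sub>R b) - F z) - dd b F z)"
          by simp
      qed
      ultimately have "((\<lambda>s. norm ((1 / s) *\<^sub>R (F (z + s *\<^sub>R b) - F z) - dd b F z)) \<longlongrightarrow> 0) (at 0)"
        by (rule Lim_transform_eventually)
      hence lim: "((\<lambda>s. (1 / s) *\<^sub>R (F (z + s *\<^sub>R b) - F z)) \<longlongrightarrow> dd b F z) (at 0)"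
        by (rule Lim_null[THEN iffD2, OF tendsto_norm_zero_cancel])
      have "filterlim (\<lambda>n. 1 / real (Suc n)) (at 0) sequentially"
        using LIMSEQ_inverse_real_of_nat by (auto simp: filterlim_at inverse_eq_divide)
      from filterlim_compose[OF lim this] show "(\<lambda>n. q n z) \<longlonglongrightarrow> dd b F z"
        by (simp add: q_def scaleR_conv_of_real mult.commute add.commute)
    qed
    show "AE z in lborel. norm (q n z) \<le> indicator (cball 0 (r + cmod b)) z * max M 0" for n
    proof (rule AE_I2)
      fix z
      define t where "t = 1 / real (Suc n)"
      have t: "0 < t" "t \<le> 1" by (auto simp: t_def field_simps)
      have nq: "norm (q n z) = cmod (F (z + t *\<^sub>R b) - F z) / t"
        by (simp add: q_def t_def norm_mult add.commute del: of_nat_Suc)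
      show "norm (q n z) \<le> indicator (cball 0 (r + cmod b)) z * max M 0"
      proof (cases "cmod z \<le> r + cmod b")
        case True
        have "norm (q n z) \<le> max M 0"
          unfolding nq using mv[of z t] t by (simp add: divide_le_eq)
        with True show ?thesis by simp
      next
        case False
        have "norm (t *\<^sub>R b) \<le> cmod b" using t by (simp add: mult_left_le_one_le)
        with False have "r < cmod (z + t *\<^sub>R b)" "r < cmod z"
          using norm_diff_ineq[of z "t *\<^sub>R b"] norm_ge_zero[of b] by linarith+
        with False show ?thesis unfolding nq by (simp add: supp)
      qed
    qed
  qed (auto simp: q_def)
  hence "(\<integral>z. dd b F z \<partial>lborel) = 0"
    by (simp add: q0 LIMSEQ_const_iff)
  thus ?thesis by (subst integral_completion) auto
qed

lemma continuous_on_UNIV_disk: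
  fixes f :: "complex \<Rightarrow> 'b::{topological_space, zero}"
  assumes "continuous_on (ball 0 1) f" "\<And>z. r < cmod z \<Longrightarrow> f z = 0" "r < 1"
  shows "continuous_on UNIV f"
proof -
  have "continuous_on (ball 0 1 \<union> - cball 0 r) f"
  proof (rule continuous_on_open_Un)
    have "continuous_on (- cball 0 r) (\<lambda>z. 0 :: 'b)" by simp
    thus "continuous_on (- cball 0 r) f"
      by (rule continuous_on_eq) (use assms(2) in auto)
  qed (use assms in auto)
  moreover have "ball 0 1 \<union> - cball 0 r = (UNIV :: complex set)" using assms by auto
  ultimately show ?thesis by simp
qed

lemma integrable_disk_compact_support:
  fixes f :: "complex \<Rightarrow> 'b::{banach, second_countable_topology}"
  assumes "continuous_on (ball 0 1) f" "\<And>z. r < cmod z \<Longrightarrow> f z = 0" "r < 1"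
  shows "integrable lebesgue f"
  by (rule integrable_lebesgue_compact_support(1)[OF continuous_on_UNIV_disk[OF assms] assms(2)])

text \<open>
  Continuously differentiable functions with compact support in the open disk. A bound \<open>r < 1\<close> on
  the support is easier to use than the closure of the set where the function does not vanish.
\<close>

definition disk_C1 :: "(complex \<Rightarrow> complex) \<Rightarrow> bool" where
  "disk_C1 \<phi> \<longleftrightarrow> (\<forall>z. \<phi> differentiable (at z)) \<and> continuous_on UNIV (dd 1 \<phi>) \<and>
     continuous_on UNIV (dd \<i> \<phi>) \<and> (\<exists>r<1. \<forall>z. r < cmod z \<longrightarrow> \<phi> z = 0)"

lemma disk_C1_continuous_dd:
  assumes "disk_C1 \<phi>" shows "continuous_on UNIV (dd b \<phi>)"
proof -
  have "dd b \<phi> = (\<lambda>z. of_real (Re b) * dd 1 \<phi> z + of_real (Im b) * dd \<i> \<phi> z)"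
    using assms by (intro ext dd_expand) (auto simp: disk_C1_def)
  moreover have "continuous_on UNIV (dd 1 \<phi>)" "continuous_on UNIV (dd \<i> \<phi>)"
    using assms by (auto simp: disk_C1_def)
  ultimately show ?thesis by (auto intro!: continuous_intros)
qed

lemma disk_C1_continuous:
  assumes "disk_C1 \<phi>" shows "continuous_on UNIV \<phi>"
  using assms by (simp add: disk_C1_def continuous_at_imp_continuous_on differentiable_imp_continuous_within)

definition disk_C0 :: "(complex \<Rightarrow> complex) \<Rightarrow> bool" where
  "disk_C0 \<psi> \<longleftrightarrow> continuous_on UNIV \<psi> \<and> (\<exists>r<1. \<forall>z. r < cmod z \<longrightarrow> \<psi> z = 0)"

lemma disk_C1_imp_C0: "disk_C1 \<phi> \<Longrightarrow> disk_C0 \<phi>"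
  unfolding disk_C0_def by (simp add: disk_C1_continuous) (simp add: disk_C1_def)

lemma disk_C1_dd_C0:
  assumes "disk_C1 \<phi>" shows "disk_C0 (dd b \<phi>)"
proof -
  obtain r where r: "r < 1" "\<And>z. r < cmod z \<Longrightarrow> \<phi> z = 0"
    using assms by (auto simp: disk_C1_def)
  have "\<forall>z. r < cmod z \<longrightarrow> dd b \<phi> z = 0"
    using dd_zero_outside[of r \<phi> _ b, OF r(2)] by blast
  with r(1) disk_C1_continuous_dd[OF assms] show ?thesis
    unfolding disk_C0_def by blast
qed

lemma disk_C0_mult:
  assumes "disk_C0 \<psi>" "continuous_on (ball 0 1) A"
  shows "disk_C0 (\<lambda>z. A z * \<psi> z)"
proof -
  obtain r where r: "r < 1" "\<And>z. r < cmod z \<Longrightarrow> \<psi> z = 0"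
    using assms(1) by (auto simp: disk_C0_def)
  have "continuous_on (ball 0 1) (\<lambda>z. A z * \<psi> z)"
    using assms by (intro continuous_on_mult) (auto simp: disk_C0_def intro: continuous_on_subset)
  hence "continuous_on UNIV (\<lambda>z. A z * \<psi> z)"
    by (rule continuous_on_UNIV_disk[where r = r]) (use r in auto)
  thus ?thesis using r by (auto simp: disk_C0_def)
qed

lemma disk_C0_integrable:
  assumes "disk_C0 \<psi>"
  shows "integrable lebesgue \<psi>"
  using assms integrable_lebesgue_compact_support(1) unfolding disk_C0_def by blast

text \<open>
  The factor \<open>A\<close> may be singular on the circle, as powers of \<open>disk_defect\<close> are: its values and
  derivatives outside the disk are always multiplied by \<open>0\<close>.
\<close>

lemma disk_C1_mult:
  assumes "disk_C1 \<phi>"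
    and A: "\<And>z. z \<in> ball 0 1 \<Longrightarrow> A differentiable (at z)"
      "\<And>b. continuous_on (ball 0 1) (dd b A)"
  shows "disk_C1 (\<lambda>z. A z * \<phi> z)" "dd b (\<lambda>z. A z * \<phi> z) z = A z * dd b \<phi> z + dd b A z * \<phi> z"
proof -
  obtain r where r: "r < 1" "\<And>z. r < cmod z \<Longrightarrow> \<phi> z = 0"
    using assms(1) by (auto simp: disk_C1_def)
  have diff: "\<phi> differentiable (at z)" for z using assms(1) by (auto simp: disk_C1_def)
  have r': "r < cmod z \<Longrightarrow> A z * \<phi> z = 0" for z using r by auto
  have A_cont: "continuous_on (ball 0 1) A"
    using A(1) differentiable_imp_continuous_within by (intro continuous_at_imp_continuous_on ballI) blast
  have eq: "dd b (\<lambda>z. A z * \<phi> z) z = A z * dd b \<phi> z + dd b A z * \<phi> z" for b z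
  proof (cases "z \<in> ball 0 1")
    case True
    show ?thesis by (rule dd_mult[OF A(1)[OF True] diff])
  next
    case False
    hence "r < cmod z" using r by auto
    hence "\<phi> z = 0" "dd b \<phi> z = 0" "dd b (\<lambda>z. A z * \<phi> z) z = 0"
      using r(2) r' by (blast intro: dd_zero_outside)+
    thus ?thesis by simp
  qed
  show "dd b (\<lambda>z. A z * \<phi> z) z = A z * dd b \<phi> z + dd b A z * \<phi> z" by (rule eq)
  have "continuous_on UNIV (dd b (\<lambda>z. A z * \<phi> z))" for b
  proof -
    have "dd b (\<lambda>z. A z * \<phi> z) = (\<lambda>z. A z * dd b \<phi> z + dd b A z * \<phi> z)" using eq by auto
    moreover have "continuous_on UNIV (\<lambda>z. A z * dd b \<phi> z)"
      using disk_C0_mult[OF disk_C1_dd_C0[OF assms(1), of b] A_cont] unfolding disk_C0_def by (rule conjunct1)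
    moreover have "continuous_on UNIV (\<lambda>z. dd b A z * \<phi> z)"
      using disk_C0_mult[OF disk_C1_imp_C0[OF assms(1)] A(2)[of b]] unfolding disk_C0_def by (rule conjunct1)
    ultimately show ?thesis by (simp only: continuous_on_add)
  qed
  moreover have "(\<lambda>z. A z * \<phi> z) differentiable (at z)" for z
  proof (cases "z \<in> ball 0 1")
    case True
    show ?thesis by (rule differentiable_mult[OF A(1)[OF True] diff])
  next
    case False
    hence z: "r < cmod z" using r by auto
    have "\<forall>\<^sub>F w in nhds z. w \<in> - cball 0 r"
      by (rule eventually_nhds_in_open) (use z in auto)
    hence "\<forall>\<^sub>F w in at z. 0 = A w * \<phi> w"
      unfolding eventually_at_filter by eventually_elim (use r in auto)
    moreover have "0 = A z * \<phi> z" using z r by simp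
    ultimately have "((\<lambda>z. A z * \<phi> z) has_derivative (\<lambda>_. 0)) (at z)"
      by (rule has_derivative_transform_eventually[OF has_derivative_const[of 0]]) simp
    thus ?thesis by (rule differentiableI)
  qed
  ultimately show "disk_C1 (\<lambda>z. A z * \<phi> z)"
    unfolding disk_C1_def using r' r(1) by blast
qed

lemma integral_by_parts_disk:
  assumes "disk_C1 \<phi>"
    and "\<And>z. z \<in> ball 0 1 \<Longrightarrow> A differentiable (at z)"
    and "\<And>b. continuous_on (ball 0 1) (dd b A)"
  shows "(\<integral>z. A z * dd b \<phi> z + dd b A z * \<phi> z \<partial>lebesgue) = 0"
proof -
  note C1 = disk_C1_mult[OF assms]
  obtain r where "\<And>z. r < cmod z \<Longrightarrow> A z * \<phi> z = 0" using C1(1) by (auto simp: disk_C1_def)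
  hence "(\<integral>z. dd b (\<lambda>z. A z * \<phi> z) z \<partial>lebesgue) = 0"
    using C1(1) by (intro integral_dd_eq_0[where r = r] disk_C1_continuous_dd) (simp_all add: disk_C1_def)
  moreover have "dd b (\<lambda>z. A z * \<phi> z) = (\<lambda>z. A z * dd b \<phi> z + dd b A z * \<phi> z)"
    by (rule ext) (rule C1(2))
  ultimately show ?thesis by simp
qed

lemma disk_C1_differentiable: "disk_C1 \<phi> \<Longrightarrow> \<phi> differentiable (at z)"
  by (simp add: disk_C1_def)

text \<open>
  What the estimates use of a test function: it and its first derivatives are continuously
  differentiable with support in a disk of radius less than \<open>1\<close>.
\<close>

lemma test_function_imp_C1:
  assumes "\<phi> \<in> test_functions"
  shows "disk_C1 \<phi>" "disk_C1 (dd b \<phi>)"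
proof -
  from assms have C: "C_k k \<phi>" for k by (auto simp: test_functions_def)
  have supp: "closure {z. \<phi> z \<noteq> 0} \<subseteq> ball 0 1"
    using assms by (auto simp: test_functions_def)
  have "compact (closure {z. \<phi> z \<noteq> 0})"
    using supp bounded_subset[OF bounded_ball] by (auto simp: compact_eq_bounded_closed)
  have "\<exists>r<1. \<forall>z. r < cmod z \<longrightarrow> \<phi> z = 0"
  proof (cases "closure {z. \<phi> z \<noteq> 0} = {}")
    case True
    hence "\<phi> z = 0" for z by auto
    thus ?thesis by (intro exI[of _ 0]) auto
  next
    case False
    have "continuous_on (closure {z. \<phi> z \<noteq> 0}) cmod" by (intro continuous_intros)
    from continuous_attains_sup[OF \<open>compact _\<close> False this]
    obtain w where w: "w \<in> closure {z. \<phi> z \<noteq> 0}"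
      and sup: "\<And>z. z \<in> closure {z. \<phi> z \<noteq> 0} \<Longrightarrow> cmod z \<le> cmod w" by blast
    have "cmod w < 1" using w supp by auto
    moreover have "\<phi> z = 0" if "cmod w < cmod z" for z
      using that sup[of z] closure_subset[of "{z. \<phi> z \<noteq> 0}"] by fastforce
    ultimately show ?thesis by blast
  qed
  then obtain r where r: "r < 1" "\<And>z. r < cmod z \<Longrightarrow> \<phi> z = 0" by auto
  have *: "\<forall>z. \<phi> differentiable (at z)" "continuous_on UNIV (dd 1 \<phi>)" "continuous_on UNIV (dd \<i> \<phi>)"
    using C[of "Suc 0"] by (simp_all add: pdx_eq_dd pdy_eq_dd)
  show C1: "disk_C1 \<phi>"
    unfolding disk_C1_def using * r by blast
  have "\<forall>z. dd 1 \<phi> differentiable (at z)" "continuous_on UNIV (dd 1 (dd 1 \<phi>))"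
    "continuous_on UNIV (dd \<i> (dd 1 \<phi>))"
    "\<forall>z. dd \<i> \<phi> differentiable (at z)" "continuous_on UNIV (dd 1 (dd \<i> \<phi>))"
    "continuous_on UNIV (dd \<i> (dd \<i> \<phi>))"
    using C[of "Suc (Suc 0)"] by (simp_all add: pdx_eq_dd pdy_eq_dd)
  note * = *(1) this
  have b: "dd b \<phi> = (\<lambda>z. of_real (Re b) * dd 1 \<phi> z + of_real (Im b) * dd \<i> \<phi> z)"
    using *(1) by (intro ext dd_expand) auto
  have diff: "(\<lambda>z. of_real (Re b) * dd 1 \<phi> z) differentiable (at z)"
     "(\<lambda>z. of_real (Im b) * dd \<i> \<phi> z) differentiable (at z)" for z
    using * by (intro differentiable_mult differentiable_const; simp)+
  have b': "dd c (dd b \<phi>) = (\<lambda>z. of_real (Re b) * dd c (dd 1 \<phi>) z + of_real (Im b) * dd c (dd \<i> \<phi>) z)" for c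
  proof
    fix z
    have "dd c (dd b \<phi>) z = dd c (\<lambda>z. of_real (Re b) * dd 1 \<phi> z) z + dd c (\<lambda>z. of_real (Im b) * dd \<i> \<phi> z) z"
      unfolding b by (rule dd_add[OF diff])
    also have "\<dots> = of_real (Re b) * dd c (dd 1 \<phi>) z + of_real (Im b) * dd c (dd \<i> \<phi>) z"
      using * by (simp add: dd_cmult)
    finally show "dd c (dd b \<phi>) z = of_real (Re b) * dd c (dd 1 \<phi>) z + of_real (Im b) * dd c (dd \<i> \<phi>) z" .
  qed
  have "dd b \<phi> differentiable (at z)" for z
    unfolding b by (rule differentiable_add[OF diff])
  moreover have "continuous_on UNIV (dd c (dd b \<phi>))" if "c = 1 \<or> c = \<i>" for c
    unfolding b' using * that by (intro continuous_on_add continuous_on_mult continuous_on_const) auto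
  moreover have "\<forall>z. r < cmod z \<longrightarrow> dd b \<phi> z = 0"
    using dd_zero_outside[of r \<phi> _ b, OF r(2)] by blast
  ultimately show "disk_C1 (dd b \<phi>)"
    unfolding disk_C1_def using r(1) by blast
qed

lemma disk_defect_pos: "z \<in> ball 0 1 \<Longrightarrow> 0 < disk_defect z"
  by (simp add: disk_defect_def abs_square_less_1)

lemma continuous_on_disk_defect_powr [continuous_intros]:
  "continuous_on (ball 0 1) (\<lambda>z. disk_defect z powr a)"
  using disk_defect_pos unfolding disk_defect_def
  by (intro continuous_intros) (metis less_irrefl)

lemma disk_defect_powr_has_derivative:
  assumes "z \<in> ball 0 1"
  shows "((\<lambda>z. complex_of_real (disk_defect z powr a)) has_derivative
    (\<lambda>h. of_real (a * disk_defect z powr (a - 1) * (- 2 * (z \<bullet> h))))) (at z)"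
proof -
  have "(disk_defect has_derivative (\<lambda>h. - (2 * (z \<bullet> h)))) (at z)"
    unfolding disk_defect_def dot_square_norm[symmetric]
    by (auto intro!: derivative_eq_intros simp: inner_commute)
  from has_derivative_compose[OF this has_real_derivative_powr[OF disk_defect_pos[OF assms], of a, unfolded has_field_derivative_def]]
  have "((\<lambda>z. disk_defect z powr a) has_derivative
      (\<lambda>h. a * disk_defect z powr (a - 1) * - (2 * (z \<bullet> h)))) (at z)" .
  from has_derivative_of_real[OF this] show ?thesis
    by simp
qed

lemmas dd_disk_defect_powr = dd_eqI[OF disk_defect_powr_has_derivative]

lemma disk_defect_powr_differentiable:
  "z \<in> ball 0 1 \<Longrightarrow> (\<lambda>z. complex_of_real (disk_defect z powr a)) differentiable (at z)"
  using disk_defect_powr_has_derivative by (rule differentiableI)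

lemma continuous_on_dd_disk_defect_powr:
  "continuous_on (ball 0 1) (dd b (\<lambda>z. complex_of_real (disk_defect z powr a)))"
proof -
  have "continuous_on (ball 0 1) (\<lambda>z. complex_of_real (a * disk_defect z powr (a - 1) * (- 2 * (z \<bullet> b))))"
    by (intro continuous_intros)
  thus ?thesis
    by (rule continuous_on_eq) (simp add: dd_disk_defect_powr)
qed

lemma dd_weight_mult:
  assumes z: "z \<in> ball 0 1" and L: "(L has_derivative L') (at z)"
  shows "dd b (\<lambda>z. of_real (disk_defect z powr a) * L z) z
    = of_real (disk_defect z powr a) * L' b - 2 * of_real (a * (z \<bullet> b) * disk_defect z powr (a - 1)) * L z"
    and "(\<lambda>z. of_real (disk_defect z powr a) * L z) differentiable (at z)"
proof -
  have "L differentiable (at z)" using L by (rule differentiableI)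
  note diff = disk_defect_powr_differentiable[OF z] this
  show "(\<lambda>z. of_real (disk_defect z powr a) * L z) differentiable (at z)"
    by (rule differentiable_mult[OF diff])
  show "dd b (\<lambda>z. of_real (disk_defect z powr a) * L z) z
    = of_real (disk_defect z powr a) * L' b - 2 * of_real (a * (z \<bullet> b) * disk_defect z powr (a - 1)) * L z"
    unfolding dd_mult[OF diff] dd_disk_defect_powr[OF z] dd_eqI[OF L] by (simp add: mult_ac)
qed

text \<open>
  The weight is differentiated by
  \<open>dd b (d powr a) = - 2 a (z \<bullet> b) d powr (a - 1)\<close>; in the applications \<open>L\<close> is a coordinate or \<open>1\<close>.
  Both the integrability and the value of the integral are recorded, so that such identities can be
  added.
\<close>

lemma weighted_integral_by_parts:
  assumes \<phi>: "disk_C1 \<phi>"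
    and L: "\<And>z. (L has_derivative L' z) (at z)" "\<And>b. continuous_on UNIV (\<lambda>z. L' z b)"
  shows "has_bochner_integral lebesgue
    (\<lambda>z. of_real (disk_defect z powr a) * (L z * dd b \<phi> z + L' z b * \<phi> z)
       - 2 * of_real (a * (z \<bullet> b) * disk_defect z powr (a - 1)) * L z * \<phi> z) 0"
    (is "has_bochner_integral _ ?f 0")
proof -
  obtain r where r: "r < 1" "\<And>z. r < cmod z \<Longrightarrow> \<phi> z = 0"
    using \<phi> by (auto simp: disk_C1_def)
  have r': "dd b \<phi> z = 0" if "r < cmod z" for z
    using dd_zero_outside[of r \<phi> z b, OF r(2) that] .
  define A where "A = (\<lambda>z. complex_of_real (disk_defect z powr a) * L z)"
  have L_cont: "continuous_on S L" for S
    using has_derivative_continuous[OF L(1)] by (simp add: continuous_at_imp_continuous_on)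
  have L'_cont: "continuous_on S (\<lambda>z. L' z b)" for S b
    using L(2) by (rule continuous_on_subset) simp
  have \<phi>_cont: "continuous_on S \<phi>" "continuous_on S (dd b \<phi>)" for S b
    using disk_C1_continuous[OF \<phi>] disk_C1_continuous_dd[OF \<phi>]
    by (auto intro: continuous_on_subset)
  have "continuous_on (ball 0 1) (dd b A)" for b
  proof -
    have "continuous_on (ball 0 1) (\<lambda>z. complex_of_real (disk_defect z powr a) * L' z b
       - 2 * of_real (a * (z \<bullet> b) * disk_defect z powr (a - 1)) * L z)"
      by (intro continuous_intros L_cont L'_cont)
    thus ?thesis
      by (rule continuous_on_eq) (simp add: A_def dd_weight_mult[OF _ L(1)])
  qed
  hence "(\<integral>z. A z * dd b \<phi> z + dd b A z * \<phi> z \<partial>lebesgue) = 0"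
  proof (intro integral_by_parts_disk \<phi>)
    show "A differentiable (at z)" if "z \<in> ball 0 1" for z
      unfolding A_def by (rule dd_weight_mult(2)[OF that L(1)])
  qed
  moreover have "A z * dd b \<phi> z + dd b A z * \<phi> z = ?f z" for z
  proof (cases "cmod z < 1")
    case True
    hence dA: "dd b A z = of_real (disk_defect z powr a) * L' z b
        - 2 * of_real (a * (z \<bullet> b) * disk_defect z powr (a - 1)) * L z"
      unfolding A_def by (intro dd_weight_mult(1)[OF _ L(1)]) simp
    show ?thesis unfolding dA by (simp add: A_def algebra_simps)
  next
    case False
    thus ?thesis using r r' by simp
  qed
  ultimately have "integral\<^sup>L lebesgue ?f = 0" by simp
  moreover have "integrable lebesgue ?f"
    by (rule integrable_disk_compact_support[OF _ _ r(1)])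
       (auto intro!: continuous_intros L_cont L'_cont \<phi>_cont simp: r r')
  ultimately show ?thesis by (simp add: has_bochner_integral_iff)
qed

lemma disk_C1_cnj: "disk_C1 \<phi> \<Longrightarrow> disk_C1 (\<lambda>z. cnj (\<phi> z))"
proof -
  assume \<phi>: "disk_C1 \<phi>"
  hence "dd b (\<lambda>z. cnj (\<phi> z)) = (\<lambda>z. cnj (dd b \<phi> z))" for b
    by (intro ext dd_cnj disk_C1_differentiable)
  with \<phi> show ?thesis
    by (auto simp: disk_C1_def differentiable_cnj continuous_on_cnj)
qed

lemma disk_C1_times:
  assumes "disk_C1 \<phi>" "disk_C1 \<psi>"
  shows "disk_C1 (\<lambda>z. \<phi> z * \<psi> z)" "dd b (\<lambda>z. \<phi> z * \<psi> z) z = \<phi> z * dd b \<psi> z + dd b \<phi> z * \<psi> z"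
  using assms(2)
  by (rule disk_C1_mult;
      use assms(1) disk_C1_continuous_dd[OF assms(1)] in \<open>auto intro: disk_C1_differentiable continuous_on_subset\<close>)+

section \<open>Weighted square-integrable functions\<close>

abbreviation disk where "disk \<equiv> lebesgue_on (cball (0 :: complex) 1)"

lemma measurable_disk_defect_powr [measurable]:
  "(\<lambda>z. disk_defect z powr s) \<in> borel_measurable (lebesgue_on S)"
proof -
  have "(\<lambda>z. disk_defect z powr s) \<in> borel_measurable borel"
    unfolding disk_defect_def by measurable
  thus ?thesis by (intro measurable_restrict_space1 measurable_completion) simp
qed

lemma borel_measurable_cnj [measurable (raw)]:
  "f \<in> borel_measurable M \<Longrightarrow> (\<lambda>x. cnj (f x)) \<in> borel_measurable M"
  by (rule borel_measurable_continuous_on[of cnj]) (auto intro: continuous_intros)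

lemma sets_disk_measure [simp, measurable_cong]: "sets (disk_measure s) = sets disk"
  by (simp add: disk_measure_def)

lemma space_disk_measure [simp]: "space (disk_measure s) = cball 0 1"
  by (simp add: disk_measure_def)

lemma measurable_disk_measure [simp]: "borel_measurable (disk_measure s) = borel_measurable disk"
  by (intro measurable_cong_sets) auto

lemma AE_disk_interior: "AE z in disk. z \<in> ball 0 1"
proof -
  have "sphere 0 1 \<in> null_sets (disk :: complex measure)"
    using negligible_sphere[of "0 :: complex" 1]
    by (simp add: null_sets_restrict_space negligible_iff_null_sets) 
  hence "AE z in disk. z \<notin> sphere 0 (1::real)" by (rule AE_not_in)
  moreover have "AE z in disk. z \<in> cball 0 (1::real)"
    by (auto intro!: AE_I2)
  ultimately show ?thesis by eventually_elim auto
qed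

lemma AE_disk_measure_iff: "(AE z in disk_measure s. P z) \<longleftrightarrow> (AE z in disk. P z)"
proof -
  have "(AE z in disk_measure s. P z) \<longleftrightarrow> (AE z in disk. 0 < ennreal (disk_defect z powr s) \<longrightarrow> P z)"
    unfolding disk_measure_def by (rule AE_density) measurable
  also have "\<dots> \<longleftrightarrow> (AE z in disk. P z)"
  proof (intro iffI)
    assume "AE z in disk. 0 < ennreal (disk_defect z powr s) \<longrightarrow> P z"
    thus "AE z in disk. P z"
      using AE_disk_interior by eventually_elim (auto simp: disk_defect_def abs_square_eq_1)
  qed auto
  finally show ?thesis .
qed

lemma integrable_disk_measure:
  fixes f :: "complex \<Rightarrow> 'b::{banach, second_countable_topology}"
  assumes "f \<in> borel_measurable disk"
  shows "integrable (disk_measure s) f \<longleftrightarrow> integrable disk (\<lambda>z. (disk_defect z powr s) *\<^sub>R f z)"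
  unfolding disk_measure_def by (rule integrable_density) (use assms in auto)

lemma integral_disk_measure:
  fixes f :: "complex \<Rightarrow> 'b::{banach, second_countable_topology}"
  assumes "f \<in> borel_measurable disk"
  shows "integral\<^sup>L (disk_measure s) f = (\<integral>z. (disk_defect z powr s) *\<^sub>R f z \<partial>disk)"
  unfolding disk_measure_def by (rule integral_density) (use assms in auto)

text \<open>
  The squared norm, for which the parallelogram law and limits need no square roots.
\<close>

definition sqnorm :: "real \<Rightarrow> (complex \<Rightarrow> complex) \<Rightarrow> real" where
  "sqnorm s f = (\<integral>z. (cmod (f z))^2 \<partial>disk_measure s)"

lemma sqnorm_nonneg [simp]: "0 \<le> sqnorm s f"
  unfolding sqnorm_def by (intro integral_nonneg_AE) auto

lemma L2_norm_eq: "L2_norm s f = sqrt (sqnorm s f)"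
  by (simp add: L2_norm_def sqnorm_def)

lemma L2_norm_power2 [simp]: "(L2_norm s f)^2 = sqnorm s f"
  by (simp add: L2_norm_eq)

lemma H10_norm_power2: "(H10_norm s v vx vy)^2 = sqnorm s v + (sqnorm s vx + sqnorm s vy)"
  by (simp add: H10_norm_def add_nonneg_nonneg)

lemma L2_D:
  assumes "f \<in> L2 s"
  shows "f \<in> borel_measurable disk" "integrable (disk_measure s) (\<lambda>z. (cmod (f z))^2)"
  using assms by (auto simp: L2_def)

lemma L2_I:
  "f \<in> borel_measurable disk \<Longrightarrow> integrable (disk_measure s) (\<lambda>z. (cmod (f z))^2) \<Longrightarrow> f \<in> L2 s"
  by (auto simp: L2_def)

lemma norm_add_square_le: "(norm (x + y :: complex))^2 \<le> 2 * (norm x)^2 + 2 * (norm y)^2"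
proof -
  have "(norm (x + y))^2 \<le> (norm x + norm y)^2"
    by (intro power_mono norm_triangle_ineq) auto
  also have "\<dots> \<le> 2 * (norm x)^2 + 2 * (norm y)^2"
    using sum_squares_bound[of "norm x" "norm y"] by (simp add: power2_sum)
  finally show ?thesis .
qed

lemma L2_cmult [intro]:
  assumes "f \<in> L2 s" shows "(\<lambda>z. c * f z) \<in> L2 s"
  using L2_D[OF assms] by (intro L2_I) (auto simp: norm_mult power_mult_distrib)

lemma L2_add [intro]:
  assumes "f \<in> L2 s" "g \<in> L2 s" shows "(\<lambda>z. f z + g z) \<in> L2 s"
proof (rule L2_I)
  note [measurable] = L2_D(1)[OF assms(1)] L2_D(1)[OF assms(2)]
  show "(\<lambda>z. f z + g z) \<in> borel_measurable disk" by measurable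
  show "integrable (disk_measure s) (\<lambda>z. (cmod (f z + g z))^2)"
  proof (rule Bochner_Integration.integrable_bound)
    show "integrable (disk_measure s) (\<lambda>z. 2 * (cmod (f z))^2 + 2 * (cmod (g z))^2)"
      using L2_D[OF assms(1)] L2_D[OF assms(2)] by auto
  qed (use norm_add_square_le in \<open>auto intro!: AE_I2\<close>)
qed

lemma L2_diff [intro]:
  assumes "f \<in> L2 s" "g \<in> L2 s" shows "(\<lambda>z. f z - g z) \<in> L2 s"
  using L2_add[OF assms(1) L2_cmult[OF assms(2), of "-1"]] by simp

lemma L2_inner_integrable:
  assumes "f \<in> L2 s" "g \<in> L2 s" shows "integrable (disk_measure s) (\<lambda>z. f z * cnj (g z))"
proof (rule Bochner_Integration.integrable_bound)
  note [measurable] = L2_D(1)[OF assms(1)] L2_D(1)[OF assms(2)]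
  show "integrable (disk_measure s) (\<lambda>z. (cmod (f z))^2 + (cmod (g z))^2)"
    using L2_D[OF assms(1)] L2_D[OF assms(2)] by auto
  show "(\<lambda>z. f z * cnj (g z)) \<in> borel_measurable (disk_measure s)"
    by measurable
  have "x * y \<le> x^2 + y^2" if "0 \<le> x" "0 \<le> y" for x y :: real
    using sum_squares_bound[of x y] mult_nonneg_nonneg[OF that] by simp
  thus "AE z in disk_measure s. cmod (f z * cnj (g z)) \<le> norm ((cmod (f z))^2 + (cmod (g z))^2)"
    by (intro AE_I2) (simp add: norm_mult)
qed

lemma L2_inner_cmult_right: "L2_inner s f (\<lambda>z. c * h z) = cnj c * L2_inner s f h"
  unfolding L2_inner_def complex_cnj_mult mult.left_commute[of _ "cnj c"] by (rule integral_mult_right_zero)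

lemma L2_inner_diff_left:
  "f \<in> L2 s \<Longrightarrow> g \<in> L2 s \<Longrightarrow> h \<in> L2 s \<Longrightarrow>
    L2_inner s (\<lambda>z. f z - g z) h = L2_inner s f h - L2_inner s g h"
  unfolding L2_inner_def left_diff_distrib
  by (intro Bochner_Integration.integral_diff L2_inner_integrable)

lemma sqnorm_add:
  assumes "f \<in> L2 s" "g \<in> L2 s"
  shows "sqnorm s (\<lambda>z. f z + g z) = sqnorm s f + 2 * Re (L2_inner s f g) + sqnorm s g"
proof -
  have "(cmod (x + y))^2 = (cmod x)^2 + 2 * Re (x * cnj y) + (cmod y)^2" for x y
    unfolding cmod_power2 by (simp add: power2_eq_square algebra_simps)
  hence "sqnorm s (\<lambda>z. f z + g z)
      = (\<integral>z. (cmod (f z))^2 + 2 * Re (f z * cnj (g z)) + (cmod (g z))^2 \<partial>disk_measure s)"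
    by (simp only: sqnorm_def)
  thus ?thesis
    using L2_D[OF assms(1)] L2_D[OF assms(2)] L2_inner_integrable[OF assms]
    by (simp add: sqnorm_def L2_inner_def del: times_complex.sel)
qed

lemma sqnorm_cmult: "sqnorm s (\<lambda>z. c * f z) = (cmod c)^2 * sqnorm s f"
  by (simp add: sqnorm_def norm_mult power_mult_distrib)

lemma sqnorm_diff_commute: "sqnorm s (\<lambda>z. f z - g z) = sqnorm s (\<lambda>z. g z - f z)"
  by (simp add: sqnorm_def norm_minus_commute)

lemma sqnorm_diff:
  assumes "f \<in> L2 s" "g \<in> L2 s"
  shows "sqnorm s (\<lambda>z. f z - g z) = sqnorm s f - 2 * Re (L2_inner s f g) + sqnorm s g"
  using sqnorm_add[OF assms(1) L2_cmult[OF assms(2), of "-1"]]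
    sqnorm_cmult[of s "-1" g] L2_inner_cmult_right[of s f "-1" g] by simp

lemma sqnorm_add_le:
  assumes "f \<in> L2 s" "g \<in> L2 s"
  shows "sqnorm s (\<lambda>z. f z + g z) \<le> 2 * sqnorm s f + 2 * sqnorm s g"
  using sqnorm_add[OF assms] sqnorm_diff[OF assms] sqnorm_nonneg[of s "\<lambda>z. f z - g z"] by linarith

lemma sqnorm_triangle_le:
  assumes "f \<in> L2 s" "g \<in> L2 s" "h \<in> L2 s"
  shows "sqnorm s (\<lambda>z. f z - h z) \<le> 2 * sqnorm s (\<lambda>z. f z - g z) + 2 * sqnorm s (\<lambda>z. g z - h z)"
  using sqnorm_add_le[OF L2_diff[OF assms(1,2)] L2_diff[OF assms(2,3)]] by simp

text \<open>
  From \<open>0 \<le> \<parallel>f - t \<langle>f, g\<rangle> g\<parallel>^2\<close> with the minimizing real \<open>t = 1 / \<parallel>g\<parallel>^2\<close>, or with \<open>t\<close> large if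
  \<open>\<parallel>g\<parallel> = 0\<close>.
\<close>

lemma L2_Cauchy_Schwarz:
  assumes "f \<in> L2 s" "g \<in> L2 s"
  shows "(cmod (L2_inner s f g))^2 \<le> sqnorm s f * sqnorm s g"
proof -
  define c where "c = L2_inner s f g"
  have *: "0 \<le> sqnorm s f - 2 * t * (cmod c)^2 + t^2 * ((cmod c)^2 * sqnorm s g)" for t :: real
  proof -
    have "sqnorm s (\<lambda>z. f z - (of_real t * c) * g z)
       = sqnorm s f - 2 * Re (cnj (of_real t * c) * c) + (cmod (of_real t * c))^2 * sqnorm s g"
      using sqnorm_diff[OF assms(1) L2_cmult[OF assms(2)], of "of_real t * c"]
      by (simp add: L2_inner_cmult_right sqnorm_cmult c_def)
    also have "Re (cnj (of_real t * c) * c) = t * (cmod c)^2"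
      unfolding cmod_power2 by (simp add: power2_eq_square algebra_simps)
    also have "sqnorm s f - 2 * (t * (cmod c)^2) + (cmod (of_real t * c))^2 * sqnorm s g
      = sqnorm s f - 2 * t * (cmod c)^2 + t^2 * ((cmod c)^2 * sqnorm s g)"
      by (simp add: norm_mult power_mult_distrib)
    finally show ?thesis by (metis sqnorm_nonneg)
  qed
  show ?thesis
  proof (cases "sqnorm s g = 0")
    case True
    have "(cmod c)^2 = 0"
    proof (rule ccontr)
      assume "(cmod c)^2 \<noteq> 0"
      with *[of "(sqnorm s f + 1) / (2 * (cmod c)^2)"] True show False by simp
    qed
    thus ?thesis by (simp add: c_def)
  next
    case False
    with sqnorm_nonneg[of s g] have "0 < sqnorm s g" by linarith
    with *[of "1 / sqnorm s g"] show ?thesis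
      by (simp add: c_def field_simps power2_eq_square)
  qed
qed

lemma sqnorm_eq_0_iff:
  assumes "f \<in> L2 s" shows "sqnorm s f = 0 \<longleftrightarrow> (AE z in disk. f z = 0)"
  using integral_nonneg_eq_0_iff_AE[OF L2_D(2)[OF assms]]
  by (simp add: sqnorm_def AE_disk_measure_iff)

abbreviation L2_lim :: "real \<Rightarrow> (nat \<Rightarrow> complex \<Rightarrow> complex) \<Rightarrow> (complex \<Rightarrow> complex) \<Rightarrow> bool" where
  "L2_lim s u f \<equiv> (\<lambda>n. sqnorm s (\<lambda>z. u n z - f z)) \<longlonglongrightarrow> 0"

lemma L2_inner_tendsto:
  assumes "\<And>n. u n \<in> L2 s" "f \<in> L2 s" "g \<in> L2 s" "L2_lim s u f"
  shows "(\<lambda>n. L2_inner s (u n) g) \<longlonglongrightarrow> L2_inner s f g"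
proof -
  have "(\<lambda>n. sqrt (sqnorm s (\<lambda>z. u n z - f z) * sqnorm s g)) \<longlonglongrightarrow> sqrt (0 * sqnorm s g)"
    by (intro tendsto_intros assms)
  hence "(\<lambda>n. sqrt (sqnorm s (\<lambda>z. u n z - f z) * sqnorm s g)) \<longlonglongrightarrow> 0" by simp
  moreover have "cmod (L2_inner s (u n) g - L2_inner s f g) \<le> sqrt (sqnorm s (\<lambda>z. u n z - f z) * sqnorm s g)" for n
    using L2_Cauchy_Schwarz[OF L2_diff[OF assms(1)[of n] assms(2)] assms(3)]
    by (simp add: L2_inner_diff_left assms real_le_rsqrt)
  ultimately have "(\<lambda>n. L2_inner s (u n) g - L2_inner s f g) \<longlonglongrightarrow> 0"
    by (intro Lim_null_comparison[OF always_eventually, of "\<lambda>n. L2_inner s (u n) g - L2_inner s f g"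
          "\<lambda>n. sqrt (sqnorm s (\<lambda>z. u n z - f z) * sqnorm s g)"] allI)
  thus ?thesis by (rule Lim_null[THEN iffD2])
qed

definition L2_Cauchy :: "real \<Rightarrow> (nat \<Rightarrow> complex \<Rightarrow> complex) \<Rightarrow> bool" where
  "L2_Cauchy s u \<longleftrightarrow> (\<forall>e>0. \<exists>N. \<forall>m\<ge>N. \<forall>n\<ge>N. sqnorm s (\<lambda>z. u m z - u n z) < e)"

text \<open>
  For \<open>s \<le> - 1\<close> the measure of the disk is infinite and constants are not square integrable; a
  positive power of \<open>disk_defect\<close> is, and it is strictly positive in the open disk.
\<close>

lemma weight_in_L2: "(\<lambda>z. of_real (disk_defect z powr \<bar>s\<bar>)) \<in> L2 s"
proof (rule L2_I)
  show "(\<lambda>z. complex_of_real (disk_defect z powr \<bar>s\<bar>)) \<in> borel_measurable disk" by measurable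
  have bound: "disk_defect z powr s * (disk_defect z powr \<bar>s\<bar>)^2 \<le> 1" if "cmod z \<le> 1" for z
  proof (cases "disk_defect z = 0")
    case False
    have "0 \<le> disk_defect z" "disk_defect z \<le> 1"
      using that by (auto simp: disk_defect_def abs_square_le_1)
    with False have "0 < disk_defect z" "disk_defect z \<le> 1" by auto
    moreover have "disk_defect z powr s * (disk_defect z powr \<bar>s\<bar>)^2 = disk_defect z powr (s + 2 * \<bar>s\<bar>)"
      by (simp add: power2_eq_square powr_add[symmetric])
    ultimately show ?thesis by (simp add: powr_le1)
  qed simp
  have "integrable disk (\<lambda>z. disk_defect z powr s * (disk_defect z powr \<bar>s\<bar>)^2)"
  proof (rule Bochner_Integration.integrable_bound)
    show "integrable disk (\<lambda>_. 1 :: real)"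
      by (intro finite_measure.integrable_const finite_measure_lebesgue_on) simp
    show "(\<lambda>z. disk_defect z powr s * (disk_defect z powr \<bar>s\<bar>)^2) \<in> borel_measurable disk" by measurable
    show "AE z in disk. norm (disk_defect z powr s * (disk_defect z powr \<bar>s\<bar>)^2) \<le> norm (1 :: real)"
      using bound by (intro AE_I2) auto
  qed
  thus "integrable (disk_measure s) (\<lambda>z. (cmod (complex_of_real (disk_defect z powr \<bar>s\<bar>)))^2)"
    by (subst integrable_disk_measure) auto
qed

text \<open>
  The Riesz-Fischer argument. Multiplication by the weight of \<open>weight_in_L2\<close> turns a Cauchy sequence
  of \<open>L2\<close> into one of \<open>L1\<close>, which has a subsequence that converges almost everywhere; Fatou's lemma
  shows that its limit is the limit in \<open>L2\<close>.
\<close>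

lemma L2_complete:
  assumes u: "\<And>n. u n \<in> L2 s" and cauchy: "L2_Cauchy s u"
  obtains f where "f \<in> L2 s" "L2_lim s u f"
proof -
  note [measurable] = L2_D(1)[OF u]
  \<comment> \<open>By the Cauchy-Schwarz inequality, multiplication by \<open>p\<close> maps \<open>L2\<close> continuously to \<open>L1\<close>.\<close>
  define p where "p = (\<lambda>z. complex_of_real (disk_defect z powr \<bar>s\<bar>))"
  have p: "p \<in> L2 s" unfolding p_def by (rule weight_in_L2)
  have [measurable]: "p \<in> borel_measurable disk" using L2_D(1)[OF p] .
  have cnj_p: "cnj (p z) = p z" for z by (simp add: p_def)
  have int: "integrable (disk_measure s) (\<lambda>z. u n z * p z)" for n
    using L2_inner_integrable[OF u p] by (simp add: cnj_p)
  have "\<exists>N. \<forall>i\<ge>N. \<forall>j\<ge>N. (\<integral>z. norm (u i z * p z - u j z * p z) \<partial>disk_measure s) < e" if "e > 0" for e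
  proof -
    have "0 < e^2 / (sqnorm s p + 1)"
      using that sqnorm_nonneg[of s p] by (intro divide_pos_pos) (simp, linarith)
    then obtain N where N: "\<And>m n. m \<ge> N \<Longrightarrow> n \<ge> N \<Longrightarrow> sqnorm s (\<lambda>z. u m z - u n z) < e^2 / (sqnorm s p + 1)"
      using cauchy unfolding L2_Cauchy_def by meson
    have "(\<integral>z. norm (u i z * p z - u j z * p z) \<partial>disk_measure s) < e" if ij: "i \<ge> N" "j \<ge> N" for i j
    proof -
      define a where "a = (\<lambda>z. complex_of_real (cmod (u i z - u j z)))"
      have a: "a \<in> L2 s"
        using L2_D[OF L2_diff[OF u[of i] u[of j]]] by (intro L2_I) (auto simp: a_def)
      have "sqnorm s a = sqnorm s (\<lambda>z. u i z - u j z)" by (simp add: sqnorm_def a_def)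
      hence "sqnorm s a * (sqnorm s p + 1) < e^2"
        using N[OF ij] sqnorm_nonneg[of s p] by (simp add: pos_less_divide_eq)
      moreover have "sqnorm s a * sqnorm s p \<le> sqnorm s a * (sqnorm s p + 1)"
        by (intro mult_left_mono) auto
      ultimately have "(cmod (L2_inner s a p))^2 < e^2"
        using L2_Cauchy_Schwarz[OF a p] by linarith
      hence "cmod (L2_inner s a p) < e"
        using \<open>e > 0\<close> by (simp add: power_less_imp_less_base)
      moreover have "L2_inner s a p = of_real (\<integral>z. norm (u i z * p z - u j z * p z) \<partial>disk_measure s)"
        unfolding L2_inner_def integral_complex_of_real[symmetric]
        by (intro Bochner_Integration.integral_cong)
           (auto simp: a_def p_def norm_mult left_diff_distrib[symmetric])
      ultimately show ?thesis by simp
    qed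
    thus ?thesis by blast
  qed
  \<comment> \<open>Convergence of \<open>u (r i) * p\<close> is convergence of \<open>u (r i)\<close>, since \<open>p\<close> does not vanish inside.\<close>
  from cauchy_L1_AE_cauchy_subseq[OF int this]
  obtain r where r: "strict_mono r" "AE z in disk_measure s. Cauchy (\<lambda>i. u (r i) z * p z)" by blast
  define f where "f = (\<lambda>z. lim (\<lambda>i. u (r i) z))"
  have f_meas [measurable]: "f \<in> borel_measurable disk"
    unfolding f_def by (rule borel_measurable_lim_metric) measurable
  have "AE z in disk. Cauchy (\<lambda>i. u (r i) z * p z)" using r(2) by (simp add: AE_disk_measure_iff)
  hence "AE z in disk. (\<lambda>i. u (r i) z) \<longlonglongrightarrow> f z"
    using AE_disk_interior
  proof eventually_elim
    case (elim z)
    have "p z \<noteq> 0" using elim(2) by (auto simp: p_def disk_defect_def abs_square_eq_1)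
    obtain l where "(\<lambda>i. u (r i) z * p z) \<longlonglongrightarrow> l"
      using elim(1) by (auto simp: Cauchy_convergent_iff convergent_def)
    from tendsto_divide[OF this tendsto_const \<open>p z \<noteq> 0\<close>]
    have "(\<lambda>i. u (r i) z) \<longlonglongrightarrow> l / p z" using \<open>p z \<noteq> 0\<close> by simp
    thus ?case unfolding f_def by (auto simp: limI)
  qed
  hence lim: "AE z in disk_measure s. (\<lambda>i. u (r i) z) \<longlonglongrightarrow> f z"
    by (simp add: AE_disk_measure_iff)
  have nn_eq: "(\<integral>\<^sup>+z. ennreal ((cmod (g z))^2) \<partial>disk_measure s) = ennreal (sqnorm s g)" if "g \<in> L2 s" for g
    unfolding sqnorm_def using L2_D(2)[OF that] by (rule nn_integral_eq_integral) auto
  have fatou: "(\<integral>\<^sup>+z. ennreal ((cmod (u n z - f z))^2) \<partial>disk_measure s) \<le> ennreal e"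
    if N: "\<And>m. m \<ge> N \<Longrightarrow> sqnorm s (\<lambda>z. u n z - u m z) \<le> e" for n N e
  proof -
    have "(\<integral>\<^sup>+z. ennreal ((cmod (u n z - f z))^2) \<partial>disk_measure s)
       = (\<integral>\<^sup>+z. liminf (\<lambda>i. ennreal ((cmod (u n z - u (r i) z))^2)) \<partial>disk_measure s)"
    proof (rule nn_integral_cong_AE, use lim in eventually_elim)
      case (elim z)
      have "(\<lambda>i. ennreal ((cmod (u n z - u (r i) z))^2)) \<longlonglongrightarrow> ennreal ((cmod (u n z - f z))^2)"
        by (intro tendsto_intros elim)
      thus ?case by (rule lim_imp_Liminf[OF sequentially_bot, symmetric])
    qed
    also have "\<dots> \<le> liminf (\<lambda>i. \<integral>\<^sup>+z. ennreal ((cmod (u n z - u (r i) z))^2) \<partial>disk_measure s)"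
      by (rule nn_integral_liminf) measurable
    also have "\<dots> \<le> liminf (\<lambda>i. ennreal e)"
    proof (rule Liminf_mono)
      show "\<forall>\<^sub>F i in sequentially. (\<integral>\<^sup>+z. ennreal ((cmod (u n z - u (r i) z))^2) \<partial>disk_measure s) \<le> ennreal e"
        using eventually_ge_at_top[of N]
      proof eventually_elim
        case (elim i)
        hence "r i \<ge> N" using seq_suble[OF r(1), of i] by linarith
        thus ?case using N[of "r i"] nn_eq[OF L2_diff[OF u[of n] u[of "r i"]]]
          by (simp add: ennreal_leI)
      qed
    qed
    also have "\<dots> = ennreal e" by (simp add: Liminf_const)
    finally show ?thesis .
  qed
  have diff_L2: "(\<lambda>z. u n z - f z) \<in> L2 s \<and> sqnorm s (\<lambda>z. u n z - f z) \<le> e"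
    if "0 \<le> e" and N: "\<And>m. m \<ge> N \<Longrightarrow> sqnorm s (\<lambda>z. u n z - u m z) \<le> e" for n N e
  proof -
    have fatou_e: "(\<integral>\<^sup>+z. ennreal ((cmod (u n z - f z))^2) \<partial>disk_measure s) \<le> ennreal e"
      using N by (rule fatou)
    have "integrable (disk_measure s) (\<lambda>z. (cmod (u n z - f z))^2)"
    proof (rule integrableI_bounded)
      show "(\<integral>\<^sup>+ z. ennreal (norm ((cmod (u n z - f z))^2)) \<partial>disk_measure s) < \<infinity>"
        using order_le_less_trans[OF fatou_e ennreal_less_top] by simp
    qed measurable
    hence L: "(\<lambda>z. u n z - f z) \<in> L2 s" by (intro L2_I) measurable
    thus ?thesis using fatou_e \<open>0 \<le> e\<close> by (simp add: nn_eq[OF L])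
  qed
  obtain N where "\<And>m n. m \<ge> N \<Longrightarrow> n \<ge> N \<Longrightarrow> sqnorm s (\<lambda>z. u m z - u n z) < 1"
    using cauchy unfolding L2_Cauchy_def by (meson zero_less_one)
  hence "(\<lambda>z. u N z - f z) \<in> L2 s" using diff_L2[of 1 N N] by (simp add: less_imp_le)
  from L2_diff[OF u[of N] this] have "f \<in> L2 s" by simp
  moreover have "L2_lim s u f"
  proof (rule LIMSEQ_I)
    fix e :: real assume "0 < e"
    then obtain N where N: "\<And>m n. m \<ge> N \<Longrightarrow> n \<ge> N \<Longrightarrow> sqnorm s (\<lambda>z. u m z - u n z) < e / 2"
      using cauchy unfolding L2_Cauchy_def by (meson half_gt_zero)
    have "norm (sqnorm s (\<lambda>z. u n z - f z) - 0) < e" if "n \<ge> N" for n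
      using diff_L2[of "e / 2" N n] N[OF that] \<open>0 < e\<close> by (simp add: less_imp_le)
    thus "\<exists>no. \<forall>n\<ge>no. norm (sqnorm s (\<lambda>z. u n z - f z) - 0) < e" by blast
  qed
  ultimately show thesis by (rule that)
qed

lemma L2_convergent_imp_Cauchy:
  assumes "\<And>n. u n \<in> L2 s" "f \<in> L2 s" "L2_lim s u f"
  shows "L2_Cauchy s u"
  unfolding L2_Cauchy_def
proof (intro allI impI)
  fix e :: real assume "e > 0"
  hence "\<forall>\<^sub>F n in sequentially. sqnorm s (\<lambda>z. u n z - f z) < e / 4"
    by (intro order_tendstoD(2)[OF assms(3)]) simp
  then obtain N where N: "\<And>n. n \<ge> N \<Longrightarrow> sqnorm s (\<lambda>z. u n z - f z) < e / 4"
    by (auto simp: eventually_sequentially)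
  have "sqnorm s (\<lambda>z. u m z - u n z) < e" if "m \<ge> N" "n \<ge> N" for m n
    using sqnorm_triangle_le[OF assms(1)[of m] assms(2) assms(1)[of n]]
      N[OF that(1)] N[OF that(2)] sqnorm_diff_commute[of s f "u n"] by linarith
  thus "\<exists>N. \<forall>m\<ge>N. \<forall>n\<ge>N. sqnorm s (\<lambda>z. u m z - u n z) < e" by blast
qed

lemma L2_Cauchy_mono:
  assumes "L2_Cauchy s u" "0 \<le> C"
    "\<And>m n. sqnorm t (\<lambda>z. w m z - w n z) \<le> C * sqnorm s (\<lambda>z. u m z - u n z)"
  shows "L2_Cauchy t w"
  unfolding L2_Cauchy_def
proof (intro allI impI)
  fix e :: real assume "e > 0"
  hence "0 < e / (C + 1)" using assms(2) by simp
  then obtain N where N: "\<And>m n. m \<ge> N \<Longrightarrow> n \<ge> N \<Longrightarrow> sqnorm s (\<lambda>z. u m z - u n z) < e / (C + 1)"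
    using assms(1) unfolding L2_Cauchy_def by meson
  have "sqnorm t (\<lambda>z. w m z - w n z) < e" if "m \<ge> N" "n \<ge> N" for m n
  proof -
    have "(C + 1) * sqnorm s (\<lambda>z. u m z - u n z) < e"
      using N[OF that] assms(2) by (simp add: field_simps)
    moreover have "C * sqnorm s (\<lambda>z. u m z - u n z) \<le> (C + 1) * sqnorm s (\<lambda>z. u m z - u n z)"
      by (intro mult_right_mono) auto
    ultimately show ?thesis using assms(3)[of m n] by linarith
  qed
  thus "\<exists>N. \<forall>m\<ge>N. \<forall>n\<ge>N. sqnorm t (\<lambda>z. w m z - w n z) < e" by blast
qed

text \<open>
  Orthogonal projection onto the closure of a subspace, given by a minimizing sequence. The
  parallelogram law makes the sequence Cauchy, and the first variation of the distance at its limit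
  gives orthogonality.
\<close>

lemma L2_projection:
  assumes S: "S \<subseteq> L2 s" "S \<noteq> {}"
    and add: "\<And>u v. u \<in> S \<Longrightarrow> v \<in> S \<Longrightarrow> (\<lambda>z. u z + v z) \<in> S"
    and cmult: "\<And>c u. u \<in> S \<Longrightarrow> (\<lambda>z. c * u z) \<in> S"
    and f: "f \<in> L2 s"
  obtains u m where "\<And>n. u n \<in> S" "m \<in> L2 s" "L2_lim s u m"
    "\<And>v. v \<in> S \<Longrightarrow> L2_inner s (\<lambda>z. f z - m z) v = 0"
proof -
  define D where "D = (\<lambda>u. sqnorm s (\<lambda>z. f z - u z))"
  define \<delta> where "\<delta> = Inf (D ` S)"
  have bdd: "bdd_below (D ` S)" by (rule bdd_belowI[of _ 0]) (auto simp: D_def)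
  have \<delta>: "\<delta> \<le> D u" if "u \<in> S" for u
    unfolding \<delta>_def using that bdd by (intro cInf_lower) auto
  have "\<exists>u\<in>S. D u < \<delta> + inverse (real (Suc n))" for n
    using cInf_lessD[of "D ` S" "\<delta> + inverse (real (Suc n))"] S(2) by (auto simp: \<delta>_def)
  then obtain u where u: "\<And>n. u n \<in> S" "\<And>n. D (u n) < \<delta> + inverse (real (Suc n))" by metis
  have u_L2: "u n \<in> L2 s" for n using u(1) S(1) by blast
  have parallelogram: "sqnorm s (\<lambda>z. v z - w z) \<le> 2 * (D v - \<delta>) + 2 * (D w - \<delta>)" if vw: "v \<in> S" "w \<in> S" for v w
  proof -
    have L: "(\<lambda>z. f z - v z) \<in> L2 s" "(\<lambda>z. f z - w z) \<in> L2 s" using vw S(1) f by auto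
    \<comment> \<open>The midpoint of \<open>v\<close> and \<open>w\<close> is no closer to \<open>f\<close> than \<open>\<delta>\<close>.\<close>
    have mid: "(\<lambda>z. 1 / 2 * (v z + w z)) \<in> S" using vw by (intro cmult add)
    have "sqnorm s (\<lambda>z. (f z - v z) + (f z - w z)) + sqnorm s (\<lambda>z. (f z - v z) - (f z - w z))
      = 2 * D v + 2 * D w"
      unfolding sqnorm_add[OF L] sqnorm_diff[OF L] D_def by simp
    moreover have "sqnorm s (\<lambda>z. (f z - v z) + (f z - w z)) = 4 * D (\<lambda>z. 1 / 2 * (v z + w z))"
    proof -
      have "(\<lambda>z. (f z - v z) + (f z - w z)) = (\<lambda>z. 2 * (f z - 1 / 2 * (v z + w z)))"
        by (auto simp: algebra_simps)
      thus ?thesis by (simp only: D_def sqnorm_cmult) simp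
    qed
    moreover have "sqnorm s (\<lambda>z. (f z - v z) - (f z - w z)) = sqnorm s (\<lambda>z. v z - w z)"
      by (subst sqnorm_diff_commute[of s v w]) simp
    ultimately show ?thesis using \<delta>[OF mid] by simp
  qed
  have "L2_Cauchy s u"
    unfolding L2_Cauchy_def
  proof (intro allI impI)
    fix e :: real assume "e > 0"
    then obtain N where N: "inverse (real (Suc N)) < e / 4"
      using reals_Archimedean[of "e / 4"] by auto
    have small: "D (u n) - \<delta> < e / 4" if "n \<ge> N" for n
    proof -
      have "inverse (real (Suc n)) \<le> inverse (real (Suc N))" using that by (simp add: field_simps)
      thus ?thesis using u(2)[of n] N by linarith
    qed
    have "sqnorm s (\<lambda>z. u m z - u n z) < e" if "m \<ge> N" "n \<ge> N" for m n
    proof -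
      have "sqnorm s (\<lambda>z. u m z - u n z) \<le> 2 * (D (u m) - \<delta>) + 2 * (D (u n) - \<delta>)"
        by (rule parallelogram[OF u(1) u(1)])
      also have "\<dots> < 2 * (e / 4) + 2 * (e / 4)"
        using small[OF that(1)] small[OF that(2)] by (intro add_strict_mono mult_strict_left_mono) auto
      finally show ?thesis by simp
    qed
    thus "\<exists>N. \<forall>m\<ge>N. \<forall>n\<ge>N. sqnorm s (\<lambda>z. u m z - u n z) < e" by blast
  qed
  from L2_complete[OF u_L2 this]
  obtain m where m: "m \<in> L2 s" "L2_lim s u m" by blast
  have "L2_inner s (\<lambda>z. f z - m z) v = 0" if v: "v \<in> S" for v
  proof -
    have v_L2: "v \<in> L2 s" using v S(1) by blast
    define c where "c = L2_inner s (\<lambda>z. f z - m z) v"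
    define c' where "c' = (\<lambda>n. L2_inner s (\<lambda>z. f z - u n z) v)"
    have c': "c' \<longlonglongrightarrow> c"
      unfolding c'_def c_def
    proof (rule L2_inner_tendsto)
      show "(\<lambda>n. sqnorm s (\<lambda>z. f z - u n z - (f z - m z))) \<longlonglongrightarrow> 0"
        using m(2) by (simp add: sqnorm_diff_commute[of s _ m] algebra_simps)
    qed (use f m(1) u_L2 v_L2 in auto)
    have ineq: "2 * Re (cnj t * c' n) \<le> inverse (real (Suc n)) + (cmod t)^2 * sqnorm s v" for t n
    proof -
      have S': "(\<lambda>z. u n z + t * v z) \<in> S" by (intro add cmult u v)
      have "D (\<lambda>z. u n z + t * v z) = sqnorm s (\<lambda>z. (f z - u n z) - t * v z)"
        by (simp add: D_def algebra_simps)
      also have "\<dots> = D (u n) - 2 * Re (cnj t * c' n) + (cmod t)^2 * sqnorm s v"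
        by (subst sqnorm_diff)
           (auto simp: D_def c'_def sqnorm_cmult L2_inner_cmult_right f u_L2 v_L2)
      finally show ?thesis using \<delta>[OF S'] u(2)[of n] by linarith
    qed
    have lim_ineq: "2 * Re (cnj t * c) \<le> (cmod t)^2 * sqnorm s v" for t
    proof (rule LIMSEQ_le)
      show "(\<lambda>n. 2 * Re (cnj t * c' n)) \<longlonglongrightarrow> 2 * Re (cnj t * c)"
        by (intro tendsto_intros c')
      have "(\<lambda>n. inverse (real (Suc n)) + (cmod t)^2 * sqnorm s v) \<longlonglongrightarrow> 0 + (cmod t)^2 * sqnorm s v"
        by (intro tendsto_intros LIMSEQ_inverse_real_of_nat)
      thus "(\<lambda>n. inverse (real (Suc n)) + (cmod t)^2 * sqnorm s v) \<longlonglongrightarrow> (cmod t)^2 * sqnorm s v" by simp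
    qed (use ineq in auto)
    have "c = 0"
    proof (rule ccontr)
      assume "c \<noteq> 0"
      \<comment> \<open>For a small step \<open>\<epsilon> c v\<close> the linear gain \<open>2 \<epsilon> |c|^2\<close> would exceed the quadratic loss.\<close>
      define \<epsilon> where "\<epsilon> = 1 / (sqnorm s v + 1)"
      have \<epsilon>: "0 < \<epsilon>" "\<epsilon> * sqnorm s v < 2"
      proof -
        have "0 < 1 / (x + 1)" "1 / (x + 1) * x < 2" if "0 \<le> x" for x :: real
          using that by (simp_all add: divide_less_eq)
        thus "0 < \<epsilon>" "\<epsilon> * sqnorm s v < 2"
          unfolding \<epsilon>_def by (simp_all only: sqnorm_nonneg)
      qed
      have "2 * (\<epsilon> * (cmod c)^2) \<le> (\<epsilon> * sqnorm s v) * (\<epsilon> * (cmod c)^2)"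
      proof -
        have "Re (cnj (of_real \<epsilon> * c) * c) = \<epsilon> * (cmod c)^2"
          unfolding cmod_power2 by (simp add: power2_eq_square algebra_simps)
        thus ?thesis using lim_ineq[of "of_real \<epsilon> * c"] \<epsilon>(1)
          by (simp add: norm_mult power_mult_distrib power2_eq_square mult_ac)
      qed
      moreover have "0 < \<epsilon> * (cmod c)^2" using \<epsilon>(1) \<open>c \<noteq> 0\<close> by simp
      ultimately show False
        using order.strict_trans1[OF _ mult_strict_right_mono[OF \<epsilon>(2)]] by blast
    qed
    thus ?thesis by (simp add: c_def)
  qed
  with u(1) m show thesis by (rule that)
qed

section \<open>The a priori estimate for test functions\<close>

lemma disk_C0_L2:
  assumes "disk_C0 \<psi>"
  shows "\<psi> \<in> L2 s" "sqnorm s \<psi> = (\<integral>z. disk_defect z powr s * (cmod (\<psi> z))^2 \<partial>lebesgue)"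
proof -
  obtain r where cont: "continuous_on UNIV \<psi>" and r: "r < 1" "\<And>z. r < cmod z \<Longrightarrow> \<psi> z = 0"
    using assms by (auto simp: disk_C0_def)
  have meas: "\<psi> \<in> borel_measurable disk"
    using borel_measurable_continuous_onI[OF cont]
    by (intro measurable_restrict_space1 measurable_completion) simp
  hence meas2: "(\<lambda>z. (cmod (\<psi> z))^2) \<in> borel_measurable disk" by measurable
  have int: "integrable lebesgue (\<lambda>z. disk_defect z powr s * (cmod (\<psi> z))^2)"
    using continuous_on_subset[OF cont] r
    by (intro integrable_disk_compact_support[OF _ _ r(1)] continuous_intros) auto
  have ind: "indicator (cball 0 1) z *\<^sub>R (disk_defect z powr s *\<^sub>R (cmod (\<psi> z))^2)
      = disk_defect z powr s * (cmod (\<psi> z))^2" for z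
    using r by (auto simp: indicator_def)
  have "integrable (disk_measure s) (\<lambda>z. (cmod (\<psi> z))^2)"
    unfolding integrable_disk_measure[OF meas2]
    by (subst integrable_restrict_space, simp, unfold ind, rule int)
  with meas show "\<psi> \<in> L2 s" by (intro L2_I)
  show "sqnorm s \<psi> = (\<integral>z. disk_defect z powr s * (cmod (\<psi> z))^2 \<partial>lebesgue)"
    unfolding sqnorm_def integral_disk_measure[OF meas2]
    by (subst integral_restrict_space, simp, unfold ind, rule refl)
qed

lemma disk_C0_lincomb:
  assumes "disk_C0 f" "disk_C0 g"
  shows "disk_C0 (\<lambda>z. a * f z + b * g z)"
proof -
  obtain r q where "r < 1" "q < 1" "\<And>z. r < cmod z \<Longrightarrow> f z = 0" "\<And>z. q < cmod z \<Longrightarrow> g z = 0"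
    using assms by (auto simp: disk_C0_def)
  hence "\<exists>r<1. \<forall>z. r < cmod z \<longrightarrow> a * f z + b * g z = 0"
    by (intro exI[of _ "max r q"]) auto
  thus ?thesis using assms unfolding disk_C0_def by (auto intro!: continuous_intros)
qed

abbreviation del :: "(complex \<Rightarrow> complex) \<Rightarrow> complex \<Rightarrow> complex" where
  "del \<phi> \<equiv> wirtinger (pdx \<phi>) (pdy \<phi>)"

abbreviation delbar :: "(complex \<Rightarrow> complex) \<Rightarrow> complex \<Rightarrow> complex" where
  "delbar \<phi> \<equiv> wirtinger_bar (pdx \<phi>) (pdy \<phi>)"

lemma test_function_C0:
  assumes "\<phi> \<in> test_functions"
  shows "disk_C0 \<phi>" "disk_C0 (pdx \<phi>)" "disk_C0 (pdy \<phi>)" "disk_C0 (del \<phi>)" "disk_C0 (delbar \<phi>)"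
proof -
  note C1 = test_function_imp_C1(1)[OF assms]
  show "disk_C0 \<phi>" "disk_C0 (pdx \<phi>)" "disk_C0 (pdy \<phi>)"
    by (simp_all add: disk_C1_imp_C0 C1 disk_C1_dd_C0 pdx_eq_dd pdy_eq_dd)
  note L = disk_C0_lincomb[OF this(2,3)]
  have "del \<phi> = (\<lambda>z. (1 / 2) * pdx \<phi> z + (- \<i> / 2) * pdy \<phi> z)"
    "delbar \<phi> = (\<lambda>z. (1 / 2) * pdx \<phi> z + (\<i> / 2) * pdy \<phi> z)"
    by (auto simp: wirtinger_def wirtinger_bar_def fun_eq_iff field_simps)
  thus "disk_C0 (del \<phi>)" "disk_C0 (delbar \<phi>)" by (simp_all only: L)
qed

lemmas test_function_L2 = test_function_C0[THEN disk_C0_L2(1)]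

text \<open>
  The identity \<open>B + B' + D + (1 - s) R = 0\<close> of the introduction. Since
  \<open>z \<partial> + cnj z \<partial>bar = x \<partial>_x + y \<partial>_y\<close>, it is the divergence theorem for the radial field
  \<open>d powr (s - 1) |\<phi>|^2 (x, y)\<close>.
\<close>

lemma radial_identity:
  assumes "\<phi> \<in> test_functions"
  shows "(\<integral>z. disk_defect z powr (s - 1) * Re ((z * del \<phi> z
        + cnj z * delbar \<phi> z) * cnj (\<phi> z))
      + disk_defect z powr (s - 1) * (cmod (\<phi> z))^2
      + (1 - s) * (disk_defect z powr (s - 2) * ((cmod z)^2 * (cmod (\<phi> z))^2)) \<partial>lebesgue) = 0"
proof -
  note C1 = test_function_imp_C1(1)[OF assms]
  define \<Phi> where "\<Phi> = (\<lambda>z. cnj (\<phi> z) * \<phi> z)"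
  have \<Phi>: "disk_C1 \<Phi>" "dd b \<Phi> z = cnj (\<phi> z) * dd b \<phi> z + cnj (dd b \<phi> z) * \<phi> z" for b z
    unfolding \<Phi>_def using disk_C1_times[OF disk_C1_cnj[OF C1] C1] by (auto simp: dd_cnj disk_C1_differentiable[OF C1])
  have "((\<lambda>z. complex_of_real (Re z)) has_derivative (\<lambda>h. of_real (Re h))) (at z)"
    "((\<lambda>z. complex_of_real (Im z)) has_derivative (\<lambda>h. of_real (Im h))) (at z)" for z
    by (intro has_derivative_of_real bounded_linear_imp_has_derivative bounded_linear_Re bounded_linear_Im)+
  note x = weighted_integral_by_parts[OF \<Phi>(1) this(1) continuous_on_const, of "s - 1" 1]
    and y = weighted_integral_by_parts[OF \<Phi>(1) this(2) continuous_on_const, of "s - 1" \<i>]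
  from has_bochner_integral_bounded_linear[OF bounded_linear_Re has_bochner_integral_add[OF x y]]
  have "has_bochner_integral lebesgue (\<lambda>z. Re (
      (of_real (disk_defect z powr (s - 1)) * (of_real (Re z) * dd 1 \<Phi> z + of_real (Re 1) * \<Phi> z)
     - 2 * of_real ((s - 1) * (z \<bullet> 1) * disk_defect z powr (s - 1 - 1)) * of_real (Re z) * \<Phi> z)
     + (of_real (disk_defect z powr (s - 1)) * (of_real (Im z) * dd \<i> \<Phi> z + of_real (Im \<i>) * \<Phi> z)
     - 2 * of_real ((s - 1) * (z \<bullet> \<i>) * disk_defect z powr (s - 1 - 1)) * of_real (Im z) * \<Phi> z))) (Re (0 + 0))"
    (is "has_bochner_integral _ (\<lambda>z. Re (?f z)) _") .
  hence "(\<integral>z. Re (?f z) / 2 \<partial>lebesgue) = 0" by (simp add: has_bochner_integral_iff)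
  moreover have "Re (?f z) / 2 = disk_defect z powr (s - 1) * Re ((z * del \<phi> z
        + cnj z * delbar \<phi> z) * cnj (\<phi> z))
      + disk_defect z powr (s - 1) * (cmod (\<phi> z))^2
      + (1 - s) * (disk_defect z powr (s - 2) * ((cmod z)^2 * (cmod (\<phi> z))^2))" for z
  proof -
    define p q where "p = dd 1 \<phi> z" and "q = dd \<i> \<phi> z"
    have \<section>: "s - 1 - 1 = s - 2" by simp
    show ?thesis
      unfolding \<Phi>(2) wirtinger_def wirtinger_bar_def pdx_eq_dd pdy_eq_dd unfolding \<Phi>_def p_def[symmetric] q_def[symmetric] \<section>
      unfolding cmod_power2 inner_complex_def
      by (simp add: field_simps power2_eq_square)
  qed
  ultimately show ?thesis by (simp only:)
qed

text \<open>
  The identity \<open>E - F = s (B - B')\<close> of the introduction. The difference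
  \<open>|\<partial>\<phi>|^2 - |\<partial>bar \<phi>|^2 = (\<i>/2) (\<phi>_x cnj \<phi>_y - \<phi>_y cnj \<phi>_x)\<close> is a Jacobian, hence a divergence, because
  mixed second derivatives agree; only the derivative of the weight survives integration by parts.
\<close>

lemma jacobian_identity:
  assumes "\<phi> \<in> test_functions"
  shows "(\<integral>z. disk_defect z powr s * ((cmod (del \<phi> z))^2
        - (cmod (delbar \<phi> z))^2)
      - s * (disk_defect z powr (s - 1) * Re ((z * del \<phi> z
        - cnj z * delbar \<phi> z) * cnj (\<phi> z))) \<partial>lebesgue) = 0"
proof -
  note C1 = test_function_imp_C1[OF assms]
  define \<Phi> where "\<Phi> = (\<lambda>b z. cnj (dd b \<phi> z) * \<phi> z)"
  have \<Phi>: "disk_C1 (\<Phi> b)" "dd c (\<Phi> b) z = cnj (dd b \<phi> z) * dd c \<phi> z + cnj (dd c (dd b \<phi>) z) * \<phi> z" for b c z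
    unfolding \<Phi>_def using disk_C1_times[OF disk_C1_cnj[OF C1(2)] C1(1)] by (auto simp: dd_cnj disk_C1_differentiable[OF C1(2)])
  have sym: "dd 1 (dd \<i> \<phi>) z = dd \<i> (dd 1 \<phi>) z" for z
    by (intro dd_symmetric disk_C1_differentiable C1 disk_C1_continuous_dd)
  note x = weighted_integral_by_parts[OF \<Phi>(1)[of \<i>] has_derivative_const[of 1] continuous_on_const, of s 1]
    and y = weighted_integral_by_parts[OF \<Phi>(1)[of 1] has_derivative_const[of 1] continuous_on_const, of s \<i>]
  from has_bochner_integral_bounded_linear[OF bounded_linear_Re
      has_bochner_integral_bounded_linear[OF bounded_linear_mult_right has_bochner_integral_diff[OF x y], of "\<i> / 2"]]
  have "has_bochner_integral lebesgue (\<lambda>z. Re (\<i> / 2 * (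
      (of_real (disk_defect z powr s) * (1 * dd 1 (\<Phi> \<i>) z + 0 * \<Phi> \<i> z)
     - 2 * of_real (s * (z \<bullet> 1) * disk_defect z powr (s - 1)) * 1 * \<Phi> \<i> z)
     - (of_real (disk_defect z powr s) * (1 * dd \<i> (\<Phi> 1) z + 0 * \<Phi> 1 z)
     - 2 * of_real (s * (z \<bullet> \<i>) * disk_defect z powr (s - 1)) * 1 * \<Phi> 1 z)))) (Re (\<i> / 2 * (0 - 0)))"
    (is "has_bochner_integral _ (\<lambda>z. Re (\<i> / 2 * ?f z)) _") by simp
  hence "(\<integral>z. Re (\<i> / 2 * ?f z) \<partial>lebesgue) = 0" by (simp add: has_bochner_integral_iff)
  moreover have "Re (\<i> / 2 * ?f z) = disk_defect z powr s * ((cmod (del \<phi> z))^2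
        - (cmod (delbar \<phi> z))^2)
      - s * (disk_defect z powr (s - 1) * Re ((z * del \<phi> z
        - cnj z * delbar \<phi> z) * cnj (\<phi> z)))" for z
  proof -
    define p q m where "p = dd 1 \<phi> z" and "q = dd \<i> \<phi> z" and "m = dd \<i> (dd 1 \<phi>) z"
    show ?thesis
      unfolding \<Phi>(2) wirtinger_def wirtinger_bar_def pdx_eq_dd pdy_eq_dd unfolding \<Phi>_def sym p_def[symmetric] q_def[symmetric] m_def[symmetric]
      unfolding cmod_power2 inner_complex_def
      by (simp add: field_simps power2_eq_square)
  qed
  ultimately show ?thesis by (simp only:)
qed

text \<open>
  The two identities and three completed squares suffice: expanding
  \<open>w |\<partial>\<phi> + t (cnj z/d) \<phi>|^2 \<ge> 0\<close> and \<open>w |\<partial>bar \<phi> + t (z/d) \<phi>|^2 \<ge> 0\<close> for suitable constants \<open>t\<close> gives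
  Cauchy-Schwarz inequalities for \<open>B\<close> and \<open>B'\<close> with all constants visible.
\<close>

lemma test_function_estimate:
  assumes "s < 1"
  shows "\<exists>C\<ge>0. \<forall>\<phi>\<in>test_functions. (H10_norm s \<phi> (pdx \<phi>) (pdy \<phi>))^2 \<le> C * sqnorm s (del \<phi>)"
proof -
  \<comment> \<open>An upper bound for both constants \<open>1 / (1 - s)\<close> and \<open>3 + 2 |s|\<close> that occur for \<open>0 \<le> s\<close> and \<open>s < 0\<close>.\<close>
  define C1 where "C1 = 1 / (1 - s) + 3 + 2 * \<bar>s\<bar>"
  define C2 where "C2 = (1 + C1) / (2 * (1 - s))"
  have C: "0 \<le> C1" "0 \<le> C2" using assms by (auto simp: C1_def C2_def)
  { fix \<phi> assume \<phi>: "\<phi> \<in> test_functions"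
    let ?I = "\<lambda>f :: complex \<Rightarrow> real. \<integral>z. f z \<partial>lebesgue"
    define p q where "p = del \<phi>" and "q = delbar \<phi>"
    \<comment> \<open>The integrands of \<open>E\<close>, \<open>F\<close>, of the squared norm of \<open>\<phi>\<close>, and of \<open>D\<close>, \<open>R\<close>, \<open>B\<close>, \<open>B'\<close>.\<close>
    define e where "e = (\<lambda>z. disk_defect z powr s * (cmod (p z))^2)"
    define f where "f = (\<lambda>z. disk_defect z powr s * (cmod (q z))^2)"
    define n where "n = (\<lambda>z. disk_defect z powr s * (cmod (\<phi> z))^2)"
    define g where "g = (\<lambda>z. disk_defect z powr (s - 1) * (cmod (\<phi> z))^2)"
    define r where "r = (\<lambda>z. disk_defect z powr (s - 2) * ((cmod z)^2 * (cmod (\<phi> z))^2))"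
    define b where "b = (\<lambda>z. disk_defect z powr (s - 1) * Re (z * p z * cnj (\<phi> z)))"
    define c where "c = (\<lambda>z. disk_defect z powr (s - 1) * Re (cnj z * q z * cnj (\<phi> z)))"
    note defs = e_def f_def n_def g_def r_def b_def c_def
    note C0 = test_function_C0[OF \<phi>]
    note C1 = test_function_imp_C1(1)[OF \<phi>]
    obtain \<rho> where \<rho>: "\<rho> < 1" "\<And>z. \<rho> < cmod z \<Longrightarrow> \<phi> z = 0" using C1 by (auto simp: disk_C1_def)
    have cont: "continuous_on (ball 0 1) \<phi>" "continuous_on (ball 0 1) p" "continuous_on (ball 0 1) q"
      using C0(1,4,5) by (auto simp: disk_C0_def p_def q_def intro: continuous_on_subset)
    have zero: "p z = 0" "q z = 0" if "\<rho> < cmod z" for z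
      using dd_zero_outside[of \<rho> \<phi> z, OF \<rho>(2) that]
      by (simp_all add: p_def q_def wirtinger_def wirtinger_bar_def pdx_eq_dd pdy_eq_dd)
    have int: "integrable lebesgue e" "integrable lebesgue f" "integrable lebesgue n"
      "integrable lebesgue g" "integrable lebesgue r" "integrable lebesgue b" "integrable lebesgue c"
      unfolding defs
      by ((rule integrable_disk_compact_support[OF _ _ \<rho>(1)], (intro continuous_intros cont), simp add: zero \<rho>(2))+)
    have pos: "0 \<le> ?I e" "0 \<le> ?I f" "0 \<le> ?I g" "0 \<le> ?I r"
      by (auto intro!: integral_nonneg_AE simp: defs)
    have radial: "?I b + ?I c + ?I g + (1 - s) * ?I r = 0"
    proof -
      have "?I (\<lambda>z. b z + c z + g z + (1 - s) * r z) = 0"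
        using radial_identity[OF \<phi>, of s]
        by (simp add: defs p_def[symmetric] q_def[symmetric] algebra_simps)
      thus ?thesis using int by simp
    qed
    have jacobian: "?I e - ?I f - s * (?I b - ?I c) = 0"
    proof -
      have "?I (\<lambda>z. e z - f z - s * (b z - c z)) = 0"
        using jacobian_identity[OF \<phi>, of s]
        by (simp add: defs p_def[symmetric] q_def[symmetric] algebra_simps)
      thus ?thesis using int by simp
    qed
    have square: "0 \<le> w * (cmod (x + of_real t * y))^2" if "0 \<le> w" for w t x y
      using that by simp
    have weights: "disk_defect z powr (s - 1) = disk_defect z powr s / disk_defect z"
       "disk_defect z powr (s - 2) = disk_defect z powr s / (disk_defect z)^2" if "z \<in> ball 0 1" for z
      using disk_defect_pos[OF that] by (simp_all add: powr_diff powr_numeral)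
    have complete_square_b: "disk_defect z powr s * (cmod (p z + of_real (t / disk_defect z) * (cnj z * \<phi> z)))^2
       = e z + 2 * t * b z + t^2 * r z" for t z
    proof (cases "z \<in> ball 0 1")
      case True
      with disk_defect_pos[OF this] show ?thesis
        unfolding defs weights[OF True] norm_mult cmod_power2
        by (simp add: field_simps power2_eq_square)
    qed (use zero \<rho> in \<open>simp add: defs\<close>)
    have complete_square_c: "disk_defect z powr s * (cmod (q z + of_real (t / disk_defect z) * (z * \<phi> z)))^2
       = f z + 2 * t * c z + t^2 * r z" for t z
    proof (cases "z \<in> ball 0 1")
      case True
      with disk_defect_pos[OF this] show ?thesis
        unfolding defs weights[OF True] norm_mult cmod_power2
        by (simp add: field_simps power2_eq_square)
    qed (use zero \<rho> in \<open>simp add: defs\<close>)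
    have cauchy_schwarz_b: "0 \<le> ?I e + 2 * t * ?I b + t^2 * ?I r" for t
    proof -
      have "0 \<le> ?I (\<lambda>z. e z + 2 * t * b z + t^2 * r z)"
        unfolding complete_square_b[symmetric] by (intro integral_nonneg_AE) auto
      thus ?thesis using int by simp
    qed
    have cauchy_schwarz_c: "0 \<le> ?I f + 2 * t * ?I c + t^2 * ?I r" for t
    proof -
      have "0 \<le> ?I (\<lambda>z. f z + 2 * t * c z + t^2 * r z)"
        unfolding complete_square_c[symmetric] by (intro integral_nonneg_AE) auto
      thus ?thesis using int by simp
    qed
    have F: "?I f \<le> C1 * ?I e"
    \<comment> \<open>For \<open>0 \<le> s\<close> the terms \<open>D\<close> and \<open>R\<close> have a favourable sign; for \<open>s < 0\<close> they must be bounded by \<open>E\<close> first.\<close>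
    proof (cases "0 \<le> s")
      case True
      have "?I f = ?I e - s * (2 * ?I b + ?I g + (1 - s) * ?I r)"
        using radial jacobian by algebra
      moreover have "0 \<le> ?I e / (1 - s) + 2 * ?I b + (1 - s) * ?I r"
        using cauchy_schwarz_b[of "1 - s"] assms
        by (simp add: field_simps power2_eq_square)
      hence "0 \<le> s * (?I e / (1 - s) + 2 * ?I b + (1 - s) * ?I r) + s * ?I g"
        using True pos by simp
      ultimately have "?I f \<le> ?I e + s * (?I e / (1 - s))"
        by (simp add: algebra_simps)
      also have "\<dots> = 1 / (1 - s) * ?I e"
        using assms by (simp add: field_simps)
      also have "\<dots> \<le> C1 * ?I e"
        using True pos(1) by (intro mult_right_mono) (auto simp: C1_def)
      finally show ?thesis .
    next
      case False
      \<comment> \<open>The square with \<open>t = \<sigma>\<close> is \<open>E - \<sigma> (R + D)\<close> after eliminating \<open>B'\<close> and \<open>F\<close>.\<close>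
      define \<sigma> where "\<sigma> = - s"
      have \<sigma>: "0 < \<sigma>" "s = - \<sigma>" using False by (auto simp: \<sigma>_def)
      have "\<sigma> * (?I r + ?I g) \<le> ?I e"
      proof -
        have "?I f + 2 * \<sigma> * ?I c + \<sigma>^2 * ?I r = ?I e - \<sigma> * (?I r + ?I g)"
          using radial jacobian unfolding \<sigma>(2) by algebra
        with cauchy_schwarz_c[of \<sigma>] show ?thesis by simp
      qed
      moreover have "2 * ?I b \<le> ?I e + ?I r" using cauchy_schwarz_b[of "-1"] by simp
      hence "\<sigma> * (2 * ?I b) \<le> \<sigma> * (?I e + ?I r)" using \<sigma> by simp
      moreover have "?I f = ?I e + \<sigma> * (2 * ?I b) + \<sigma> * ?I g + (1 + \<sigma>) * (\<sigma> * ?I r)"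
        using radial jacobian unfolding \<sigma>(2) by algebra
      moreover have "(1 + \<sigma>) * (\<sigma> * ?I r) \<le> (1 + \<sigma>) * ?I e"
      proof -
        have "\<sigma> * ?I r \<le> \<sigma> * (?I r + ?I g)" using \<sigma> pos by simp
        also note \<open>\<sigma> * (?I r + ?I g) \<le> ?I e\<close>
        finally show ?thesis using \<sigma> by simp
      qed
      ultimately have "?I f \<le> (3 + 2 * \<sigma>) * ?I e"
        by (simp add: algebra_simps)
      also have "\<dots> \<le> C1 * ?I e"
        using pos(1) \<sigma> assms by (intro mult_right_mono) (auto simp: C1_def)
      finally show ?thesis .
    qed
    have "?I n \<le> ?I g"
    proof (rule integral_mono)
      fix z
      show "n z \<le> g z"
      proof (cases "z \<in> ball 0 1")
        case True
        have "disk_defect z \<le> 1" by (simp add: disk_defect_def)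
        with disk_defect_pos[OF True] have "disk_defect z powr s \<le> disk_defect z powr s / disk_defect z"
          by (simp add: field_simps mult_left_le)
        thus ?thesis unfolding n_def g_def weights[OF True] by (rule mult_right_mono) simp
      qed (use \<rho> in \<open>simp add: n_def g_def\<close>)
    qed (use int in auto)
    also have "?I g \<le> (?I e + ?I f) / (2 * (1 - s))"
    proof -
      have "2 * (1 - s) * ?I g \<le> ?I e + ?I f"
      proof -
        have "0 \<le> ?I e + ?I f + 2 * (1 - s) * (?I b + ?I c + (1 - s) * ?I r)"
          using cauchy_schwarz_b[of "1 - s"] cauchy_schwarz_c[of "1 - s"] by (simp add: algebra_simps power2_eq_square)
        also have "?I b + ?I c + (1 - s) * ?I r = - ?I g" using radial by simp
        finally show ?thesis by simp
      qed
      thus ?thesis using assms by (simp add: field_simps)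
    qed
    also have "\<dots> \<le> (?I e + C1 * ?I e) / (2 * (1 - s))"
      using F assms by (intro divide_right_mono) auto
    also have "\<dots> = C2 * ?I e"
      by (simp add: C2_def distrib_right)
    finally have "?I n \<le> C2 * ?I e" .
    moreover have "?I e = sqnorm s (del \<phi>)" "?I f = sqnorm s (delbar \<phi>)" "?I n = sqnorm s \<phi>"
      using disk_C0_L2(2)[OF C0(1)] disk_C0_L2(2)[OF C0(4)] disk_C0_L2(2)[OF C0(5)]
      by (simp_all add: e_def f_def n_def p_def q_def)
    ultimately have "sqnorm s \<phi> \<le> C2 * sqnorm s (del \<phi>)" "sqnorm s (delbar \<phi>) \<le> C1 * sqnorm s (del \<phi>)"
      using F by simp_all
  } note est = this
  show ?thesis
  proof (intro exI[of _ "4 * (1 + C1) + C2"] conjI ballI)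
    fix \<phi> assume \<phi>: "\<phi> \<in> test_functions"
    note L = test_function_L2(4,5)[OF \<phi>, of s]
    let ?e = "sqnorm s (del \<phi>)" and ?f = "sqnorm s (delbar \<phi>)"
    have "pdx \<phi> = (\<lambda>z. del \<phi> z + delbar \<phi> z)"
      by (auto simp: wirtinger_def wirtinger_bar_def fun_eq_iff field_simps)
    hence "sqnorm s (pdx \<phi>) \<le> 2 * ?e + 2 * ?f"
      using sqnorm_add_le[OF L] by simp
    moreover have "pdy \<phi> = (\<lambda>z. \<i> * del \<phi> z + (- \<i>) * delbar \<phi> z)"
      by (auto simp: wirtinger_def wirtinger_bar_def fun_eq_iff field_simps)
    hence "sqnorm s (pdy \<phi>) \<le> 2 * ?e + 2 * ?f"
      using sqnorm_add_le[OF L[THEN L2_cmult], of "\<i>" "- \<i>"] sqnorm_cmult[of s \<i> "del \<phi>"]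
        sqnorm_cmult[of s "- \<i>" "delbar \<phi>"] by simp
    ultimately have "(H10_norm s \<phi> (pdx \<phi>) (pdy \<phi>))^2 \<le> C2 * ?e + (4 * ?e + 4 * (C1 * ?e))"
      unfolding H10_norm_power2 using est[OF \<phi>] by linarith
    thus "(H10_norm s \<phi> (pdx \<phi>) (pdy \<phi>))^2 \<le> (4 * (1 + C1) + C2) * ?e"
      by (simp add: algebra_simps)
  qed (use C in simp)
qed

section \<open>Smooth bump functions\<close>

text \<open>
  The derivatives of \<open>exp (- 1 / x)\<close>, extended by \<open>0\<close> to \<open>x \<le> 0\<close>, are linear combinations of
  these functions, whose span is closed under differentiation.
\<close>

definition flat_exp :: "nat \<Rightarrow> real \<Rightarrow> real" where
  "flat_exp n x = (if 0 < x then exp (- 1 / x) / x ^ n else 0)"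

lemma flat_exp_nonneg [simp]: "0 \<le> flat_exp n x"
  by (simp add: flat_exp_def)

lemma flat_exp_nonpos_eq_0: "x \<le> 0 \<Longrightarrow> flat_exp n x = 0"
  by (simp add: flat_exp_def)

lemma flat_exp_pos: "0 < x \<Longrightarrow> 0 < flat_exp n x"
  by (simp add: flat_exp_def)

text \<open>
  One term of the exponential series of \<open>1 / x\<close> bounds \<open>exp (- 1 / x)\<close> by any power of \<open>x\<close>. The
  case \<open>k = 0\<close> gives boundedness, the case \<open>k = 2\<close> the derivative \<open>0\<close> at the origin.
\<close>

lemma flat_exp_le:
  assumes "0 \<le> x"
  shows "flat_exp n x \<le> fact (n + k) * x ^ k"
proof (cases "x = 0")
  case False
  hence x: "0 < x" using assms by simp
  have "(1 / x) ^ (n + k) / fact (n + k) \<le> exp (1 / x)"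
  proof -
    have "sum (\<lambda>i. (1 / x) ^ i / fact i) {n + k} \<le> (\<Sum>i. (1 / x) ^ i / fact i)"
      using summable_exp[of "1 / x"] x
      by (intro sum_le_suminf) (auto simp: divide_inverse mult.commute)
    also have "\<dots> = exp (1 / x)"
      by (simp add: exp_def scaleR_conv_of_real divide_inverse mult.commute)
    finally show ?thesis by simp
  qed
  hence "exp (- (1 / x)) \<le> fact (n + k) * x ^ (n + k)"
    using x by (simp add: exp_minus field_simps power_divide)
  thus ?thesis using x by (simp add: flat_exp_def power_add field_simps)
qed (simp add: flat_exp_def)

lemma flat_exp_bounded: "flat_exp n x \<le> fact n"
  using flat_exp_le[of x n 0] flat_exp_nonpos_eq_0[of x n] by (cases "0 \<le> x") auto

lemma flat_exp_has_derivative: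
  "(flat_exp n has_real_derivative (- real n * flat_exp (n + 1) x + flat_exp (n + 2) x)) (at x)"
proof (cases "x = 0")
  case True
  have "((\<lambda>h. flat_exp n h / h) \<longlongrightarrow> 0) (at 0)"
  proof (rule Lim_null_comparison)
    show "\<forall>\<^sub>F h in at 0. norm (flat_exp n h / h) \<le> fact (n + 2) * \<bar>h\<bar>"
      unfolding eventually_at_filter
    proof (intro always_eventually allI impI)
      fix h :: real assume "h \<noteq> 0"
      thus "norm (flat_exp n h / h) \<le> fact (n + 2) * \<bar>h\<bar>"
      proof (cases "0 < h")
        case True
        thus ?thesis using flat_exp_le[of h n 2] by (simp add: field_simps power2_eq_square)
      next
        case False
        hence "flat_exp n h = 0" by (simp add: flat_exp_nonpos_eq_0)
        moreover have "0 \<le> fact (n + 2) * \<bar>h\<bar>" by (intro mult_nonneg_nonneg) auto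
        ultimately show ?thesis by (simp only: div_0 norm_zero)
      qed
    qed
    have "((\<lambda>h::real. fact (n + 2) * \<bar>h\<bar>) \<longlongrightarrow> fact (n + 2) * \<bar>0\<bar>) (at 0)"
      by (intro tendsto_intros)
    thus "((\<lambda>h::real. fact (n + 2) * \<bar>h\<bar>) \<longlongrightarrow> 0) (at 0)" by simp
  qed
  thus ?thesis using True by (simp add: DERIV_def flat_exp_nonpos_eq_0)
next
  case False
  show ?thesis
  proof (cases "0 < x")
    case True
    have "((\<lambda>x. exp (- 1 / x) / x ^ n) has_real_derivative (- real n * flat_exp (n + 1) x + flat_exp (n + 2) x)) (at x)"
    proof -
      have "((\<lambda>x. exp (- 1 / x) / x ^ n) has_real_derivative
        (exp (- 1 / x) * (1 / x^2) * x ^ n - exp (- 1 / x) * (real n * x ^ (n - 1))) / (x ^ n * x ^ n)) (at x)"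
        using True by (auto intro!: derivative_eq_intros simp: power2_eq_square)
      moreover have "(exp (- 1 / x) * (1 / x^2) * x ^ n - exp (- 1 / x) * (real n * x ^ (n - 1))) / (x ^ n * x ^ n)
        = - real n * flat_exp (n + 1) x + flat_exp (n + 2) x"
        using True by (cases n) (auto simp: flat_exp_def field_simps power2_eq_square)
      ultimately show ?thesis by simp
    qed
    thus ?thesis
      by (rule has_field_derivative_transform_within_open[where S = "{0<..}"]) (use True in \<open>auto simp: flat_exp_def\<close>)
  next
    case neg: False
    have "((\<lambda>_. 0) has_real_derivative (- real n * flat_exp (n + 1) x + flat_exp (n + 2) x)) (at x)"
      using neg by (simp add: flat_exp_nonpos_eq_0)
    thus ?thesis
      by (rule has_field_derivative_transform_within_open[where S = "{..<0}"])
         (use False neg in \<open>auto simp: flat_exp_nonpos_eq_0\<close>)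
  qed
qed

lemma flat_exp_0_has_derivative: "(flat_exp 0 has_real_derivative flat_exp 2 x) (at x)"
  using flat_exp_has_derivative[of 0 x] by (simp add: numeral_2_eq_2)

lemma real_mean_value_bound:
  fixes f f' :: "real \<Rightarrow> real"
  assumes "\<And>x. (f has_real_derivative f' x) (at x)" "\<And>t. min x y \<le> t \<Longrightarrow> t \<le> max x y \<Longrightarrow> \<bar>f' t\<bar> \<le> B"
  shows "\<bar>f y - f x\<bar> \<le> B * \<bar>y - x\<bar>"
  using field_differentiable_bound[of "{min x y..max x y}" f f' B y x] assms
  by (auto intro: has_field_derivative_at_within)

lemma flat_exp_0_lipschitz: "\<bar>flat_exp 0 y - flat_exp 0 x\<bar> \<le> 2 * \<bar>y - x\<bar>"
  using flat_exp_bounded[of 2] by (intro real_mean_value_bound[OF flat_exp_0_has_derivative]) (simp add: fact_numeral)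

lemma flat_exp_2_lipschitz: "\<bar>flat_exp 2 y - flat_exp 2 x\<bar> \<le> 36 * \<bar>y - x\<bar>"
proof (rule real_mean_value_bound[OF flat_exp_has_derivative])
  fix t
  have "\<bar>- real 2 * flat_exp (2 + 1) t + flat_exp (2 + 2) t\<bar> \<le> 2 * flat_exp 3 t + flat_exp 4 t"
    using flat_exp_nonneg[of 3 t] flat_exp_nonneg[of 4 t] by (simp add: abs_le_iff)
  also have "\<dots> \<le> 2 * 6 + 24"
    using flat_exp_bounded[of 3 t] flat_exp_bounded[of 4 t]
    by (intro add_mono mult_left_mono) (simp_all add: fact_numeral)
  finally show "\<bar>- real 2 * flat_exp (2 + 1) t + flat_exp (2 + 2) t\<bar> \<le> 36" by simp
qed

lemma flat_exp_0_Taylor: "\<bar>flat_exp 0 (x + \<delta>) - flat_exp 0 x - flat_exp 2 x * \<delta>\<bar> \<le> 36 * \<delta>^2"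
proof -
  have "\<bar>(flat_exp 0 (x + \<delta>) - flat_exp 2 x * (x + \<delta>)) - (flat_exp 0 x - flat_exp 2 x * x)\<bar> \<le> 36 * \<bar>\<delta>\<bar> * \<bar>(x + \<delta>) - x\<bar>"
  proof (rule real_mean_value_bound)
    show "((\<lambda>t. flat_exp 0 t - flat_exp 2 x * t) has_real_derivative flat_exp 2 t - flat_exp 2 x) (at t)" for t
      by (auto intro!: derivative_eq_intros flat_exp_0_has_derivative)
    fix t assume "min x (x + \<delta>) \<le> t" "t \<le> max x (x + \<delta>)"
    hence "\<bar>t - x\<bar> \<le> \<bar>\<delta>\<bar>" by (auto simp: min_def max_def split: if_splits)
    hence "36 * \<bar>t - x\<bar> \<le> 36 * \<bar>\<delta>\<bar>" by simp
    with flat_exp_2_lipschitz[of t x] show "\<bar>flat_exp 2 t - flat_exp 2 x\<bar> \<le> 36 * \<bar>\<delta>\<bar>" by (rule order_trans)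
  qed
  thus ?thesis by (simp add: algebra_simps power2_eq_square abs_mult_self_eq)
qed

lemma C_k_0_I: "(\<And>z. f differentiable (at z)) \<Longrightarrow> C_k 0 f"
  using differentiable_imp_continuous_within by (auto intro!: continuous_at_imp_continuous_on)

lemma C_k_Suc_dd: "C_k (Suc k) f \<longleftrightarrow> (\<forall>z. f differentiable (at z)) \<and> C_k k (dd 1 f) \<and> C_k k (dd \<i> f)"
  by (simp add: pdx_eq_dd pdy_eq_dd)

declare C_k.simps(2) [simp del]

text \<open>
  A function in \<open>C_k (Suc k)\<close> is continuous because it is differentiable; the other levels follow by
  induction.
\<close>

lemma C_k_mono: "C_k (Suc k) f \<Longrightarrow> C_k k f"
proof (induction k arbitrary: f)
  case 0
  thus ?case by (metis C_k_0_I C_k_Suc_dd)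
next
  case (Suc k)
  show ?case unfolding C_k_Suc_dd[of k]
    using Suc.prems Suc.IH unfolding C_k_Suc_dd[of "Suc k"] by blast
qed

lemma C_k_const: "C_k k (\<lambda>_. c)"
proof (induction k arbitrary: c)
  case (Suc k)
  have "dd b (\<lambda>_. c) = (\<lambda>_. 0)" for b by (intro ext dd_eqI has_derivative_const)
  thus ?case using Suc by (auto simp: C_k_Suc_dd)
qed simp

lemma C_k_add: "C_k k f \<Longrightarrow> C_k k g \<Longrightarrow> C_k k (\<lambda>z. f z + g z)"
proof (induction k arbitrary: f g)
  case 0
  thus ?case by (auto intro: continuous_on_add)
next
  case (Suc k)
  hence "dd b (\<lambda>z. f z + g z) = (\<lambda>z. dd b f z + dd b g z)" for b
    by (auto simp: C_k_Suc_dd intro!: ext dd_add)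
  thus ?case using Suc by (simp add: C_k_Suc_dd differentiable_add)
qed

lemma C_k_mult: "C_k k f \<Longrightarrow> C_k k g \<Longrightarrow> C_k k (\<lambda>z. f z * g z)"
proof (induction k arbitrary: f g)
  case 0
  thus ?case by (auto intro: continuous_on_mult)
next
  case (Suc k)
  hence "dd b (\<lambda>z. f z * g z) = (\<lambda>z. f z * dd b g z + dd b f z * g z)" for b
    by (auto simp: C_k_Suc_dd intro!: ext dd_mult)
  moreover have "C_k k f" "C_k k g" using Suc.prems C_k_mono by blast+
  ultimately show ?case using Suc by (simp add: C_k_Suc_dd differentiable_mult C_k_add)
qed

lemma C_k_cnj: "C_k k f \<Longrightarrow> C_k k (\<lambda>z. cnj (f z))"
proof (induction k arbitrary: f)
  case 0
  thus ?case by (auto intro: continuous_on_cnj)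
next
  case (Suc k)
  hence "dd b (\<lambda>z. cnj (f z)) = (\<lambda>z. cnj (dd b f z))" for b
    by (auto simp: C_k_Suc_dd intro!: ext dd_cnj)
  thus ?case using Suc by (simp add: C_k_Suc_dd differentiable_cnj)
qed

lemma C_k_affine:
  assumes "bounded_linear L" shows "C_k k (\<lambda>z. L (a - z))"
proof (cases k)
  case 0
  interpret bounded_linear L by fact
  show ?thesis unfolding 0 by (auto intro!: continuous_intros continuous_on)
next
  case (Suc m)
  have D: "((\<lambda>z. L (a - z)) has_derivative (\<lambda>h. L (- h))) (at z)" for z
    by (rule bounded_linear.has_derivative[OF assms]) (auto intro!: derivative_eq_intros)
  hence "dd b (\<lambda>z. L (a - z)) = (\<lambda>_. L (- b))" for b
    by (intro ext dd_eqI) 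
  thus ?thesis unfolding Suc using D by (auto simp: C_k_Suc_dd C_k_const differentiable_def)
qed

abbreviation bump :: "nat \<Rightarrow> real \<Rightarrow> complex \<Rightarrow> complex \<Rightarrow> real" where
  "bump n u z \<zeta> \<equiv> flat_exp n (1 - u * (cmod (z - \<zeta>))^2)"

lemma bump_has_derivative:
  "((\<lambda>\<zeta>. complex_of_real (bump n u a \<zeta>)) has_derivative
    (\<lambda>h. of_real ((- real n * bump (n + 1) u a \<zeta>
       + bump (n + 2) u a \<zeta>) * (2 * u * ((a - \<zeta>) \<bullet> h))))) (at \<zeta>)"
proof -
  have "((\<lambda>\<zeta>. 1 - u * (cmod (a - \<zeta>))^2) has_derivative (\<lambda>h. 2 * u * ((a - \<zeta>) \<bullet> h))) (at \<zeta>)"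
    unfolding dot_square_norm[symmetric]
    by (auto intro!: derivative_eq_intros simp: inner_commute algebra_simps)
  from has_derivative_of_real[OF has_derivative_compose[OF this
        flat_exp_has_derivative[unfolded has_field_derivative_def]]]
  show ?thesis .
qed

lemma C_k_bump: "C_k k (\<lambda>\<zeta>. of_real (bump n u a \<zeta>))"
proof (induction k arbitrary: n)
  case 0
  show ?case by (rule C_k_0_I) (rule differentiableI[OF bump_has_derivative])
next
  case (Suc k)
  have dd: "dd b (\<lambda>\<zeta>. of_real (bump n u a \<zeta>)) =
    (\<lambda>\<zeta>. (of_real (- real n) * of_real (bump (n + 1) u a \<zeta>)
       + of_real (bump (n + 2) u a \<zeta>)) * of_real (2 * u * ((a - \<zeta>) \<bullet> b)))" for b
    by (rule ext) (simp add: dd_eqI[OF bump_has_derivative])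
  have "bounded_linear (\<lambda>w. complex_of_real (2 * u * (w \<bullet> b)))" for b
    by (intro bounded_linear_compose[OF bounded_linear_of_real]
        bounded_linear_compose[OF bounded_linear_mult_right] bounded_linear_inner_left)
  note L = C_k_affine[OF this]
  show ?case
    unfolding C_k_Suc_dd dd
    by (intro conjI allI C_k_mult C_k_add C_k_const L Suc.IH differentiableI[OF bump_has_derivative])
qed

lemma bump_support:
  assumes "0 < u" "cmod a \<le> r" "1 \<le> u * (r - cmod a)^2" "r < cmod \<zeta>"
  shows "bump n u a \<zeta> = 0"
proof (rule flat_exp_nonpos_eq_0)
  have "r - cmod a \<le> cmod (a - \<zeta>)"
    using norm_triangle_ineq2[of \<zeta> a] assms(4) by (simp add: norm_minus_commute)
  hence "(r - cmod a)^2 \<le> (cmod (a - \<zeta>))^2" using assms(2) by (intro power_mono) auto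
  hence "u * (r - cmod a)^2 \<le> u * (cmod (a - \<zeta>))^2" using assms(1) by simp
  with assms(3) show "1 - u * (cmod (a - \<zeta>))^2 \<le> 0" by simp
qed

lemma test_functionI:
  assumes "\<And>k. C_k k \<phi>" "\<And>z. r < cmod z \<Longrightarrow> \<phi> z = 0" "r < 1"
  shows "\<phi> \<in> test_functions"
proof -
  have "{z. \<phi> z \<noteq> 0} \<subseteq> cball 0 r"
    using assms(2) by (force simp: not_less[symmetric])
  hence "closure {z. \<phi> z \<noteq> 0} \<subseteq> cball 0 r" by (rule closure_minimal) simp
  thus ?thesis using assms by (auto simp: test_functions_def)
qed

text \<open>
  Two test functions in \<open>\<zeta>\<close>, supported in the disk about \<open>a\<close> of radius \<open>1 / sqrt u\<close>. Up to constants,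
  \<open>\<partial>bar\<close> of the first is the derivative of \<open>\<beta>\<close> with respect to \<open>a\<close> in the \<open>\<partial>bar\<close> direction, and
  \<open>\<partial>bar\<close> of the second is the derivative of \<open>u \<beta>\<close> with respect to \<open>u\<close>. The hypothesis
  \<open>1 \<le> u * (r - cmod a)^2\<close> says that the support lies in the disk of radius \<open>r\<close>.
\<close>

lemma bump_test_functions:
  assumes "0 < u" "cmod a \<le> r" "1 \<le> u * (r - cmod a)^2" "r < 1"
  defines "\<beta> \<equiv> \<lambda>\<zeta>. complex_of_real (bump 0 u a \<zeta>)"
    and "\<beta>' \<equiv> \<lambda>\<zeta>. complex_of_real (bump 2 u a \<zeta>)"
  shows "\<beta> \<in> test_functions"
    and "wirtinger_bar (pdx \<beta>) (pdy \<beta>) \<zeta> = of_real u * ((a - \<zeta>) * \<beta>' \<zeta>)"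
    and "(\<lambda>\<zeta>. cnj (a - \<zeta>) * \<beta> \<zeta>) \<in> test_functions"
    and "wirtinger_bar (pdx (\<lambda>\<zeta>. cnj (a - \<zeta>) * \<beta> \<zeta>)) (pdy (\<lambda>\<zeta>. cnj (a - \<zeta>) * \<beta> \<zeta>)) \<zeta>
      = of_real (u * (cmod (a - \<zeta>))^2) * \<beta>' \<zeta> - \<beta> \<zeta>"
proof -
  note support = bump_support[OF assms(1-3)]
  have D: "(\<beta> has_derivative (\<lambda>h. of_real (2 * u * ((a - \<zeta>) \<bullet> h)) * \<beta>' \<zeta>)) (at \<zeta>)" for \<zeta>
    using bump_has_derivative[of 0 u a \<zeta>] unfolding \<beta>_def \<beta>'_def by (simp add: mult_ac numeral_2_eq_2)
  have Dc: "((\<lambda>\<zeta>. cnj (a - \<zeta>)) has_derivative (\<lambda>h. - cnj h)) (at \<zeta>)" for \<zeta>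
    by (auto intro!: derivative_eq_intros)
  show "\<beta> \<in> test_functions"
    by (rule test_functionI[of _ r]) (auto simp: \<beta>_def support C_k_bump \<open>r < 1\<close>)
  show "(\<lambda>\<zeta>. cnj (a - \<zeta>) * \<beta> \<zeta>) \<in> test_functions"
  proof (rule test_functionI[of _ r])
    show "C_k k (\<lambda>\<zeta>. cnj (a - \<zeta>) * \<beta> \<zeta>)" for k
      unfolding \<beta>_def by (intro C_k_mult C_k_bump C_k_affine bounded_linear_cnj)
  qed (auto simp: \<beta>_def support \<open>r < 1\<close>)
  show "wirtinger_bar (pdx \<beta>) (pdy \<beta>) \<zeta> = of_real u * ((a - \<zeta>) * \<beta>' \<zeta>)"
    unfolding wirtinger_bar_def pdx_eq_dd pdy_eq_dd dd_eqI[OF D]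
    by (cases "a - \<zeta>") (simp add: complex_eq_iff field_simps)
  note Dm = dd_eqI[OF has_derivative_mult[OF Dc D]]
  define w where "w = a - \<zeta>"
  have "cnj w * (complex_of_real (2 * u * (w \<bullet> 1)) * \<beta>' \<zeta>) + - cnj 1 * \<beta> \<zeta> +
      \<i> * (cnj w * (complex_of_real (2 * u * (w \<bullet> \<i>)) * \<beta>' \<zeta>) + - cnj \<i> * \<beta> \<zeta>)
    = 2 * (of_real u * (cnj w * w) * \<beta>' \<zeta> - \<beta> \<zeta>)"
  proof -
    have "w = of_real (w \<bullet> 1) + \<i> * of_real (w \<bullet> \<i>)" "cnj w = of_real (w \<bullet> 1) - \<i> * of_real (w \<bullet> \<i>)"
      by (simp_all add: complex_eq_iff)
    moreover define x y where "x = complex_of_real (w \<bullet> 1)" and "y = complex_of_real (w \<bullet> \<i>)"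
    ultimately have w: "w = x + \<i> * y" "cnj w = x - \<i> * y" by simp_all
    show ?thesis unfolding of_real_mult x_def[symmetric] y_def[symmetric] unfolding w
      by (simp add: algebra_simps) 
  qed
  thus "wirtinger_bar (pdx (\<lambda>\<zeta>. cnj (a - \<zeta>) * \<beta> \<zeta>)) (pdy (\<lambda>\<zeta>. cnj (a - \<zeta>) * \<beta> \<zeta>)) \<zeta>
      = of_real (u * (cmod (a - \<zeta>))^2) * \<beta>' \<zeta> - \<beta> \<zeta>"
    unfolding wirtinger_bar_def pdx_eq_dd pdy_eq_dd Dm w_def[symmetric]
    by (simp add: complex_norm_square mult.commute[of w] del: of_real_power)
qed

section \<open>Weyl's lemma for the Cauchy-Riemann operator\<close>

text \<open>
  A bump around \<open>z\<close> of radius \<open>1 / sqrt u\<close> with integral independent of \<open>u\<close>.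
\<close>

definition mollifier :: "real \<Rightarrow> complex \<Rightarrow> complex \<Rightarrow> complex" where
  "mollifier u z \<zeta> = of_real (u * bump 0 u z \<zeta>)"

lemma mollifier_sym: "mollifier u z \<zeta> = mollifier u \<zeta> z"
  by (simp add: mollifier_def norm_minus_commute)

text \<open>
  Derivatives of integrals with respect to a parameter are obtained from a quadratic bound on the
  remainder, which survives integration.
\<close>

lemma has_derivative_quadratic_bound:
  fixes F :: "'a::real_normed_vector \<Rightarrow> 'b::real_normed_vector"
  assumes "bounded_linear D" "0 < \<delta>" "0 \<le> C"
    and bound: "\<And>v. norm v < \<delta> \<Longrightarrow> norm (F (p + v) - F p - D v) \<le> C * (norm v)^2"
  shows "(F has_derivative D) (at p)"
  unfolding has_derivative_at
proof (intro conjI assms(1))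
  show "((\<lambda>v. norm (F (p + v) - F p - D v) / norm v) \<longlongrightarrow> 0) (at 0)"
  proof (rule Lim_null_comparison)
    show "\<forall>\<^sub>F v in at 0. norm (norm (F (p + v) - F p - D v) / norm v) \<le> C * norm v"
      unfolding eventually_at
    proof (intro exI conjI ballI impI)
      fix v :: 'a assume "v \<noteq> 0 \<and> dist v 0 < \<delta>"
      thus "norm (norm (F (p + v) - F p - D v) / norm v) \<le> C * norm v"
        using bound[of v] by (simp add: divide_le_eq power2_eq_square mult.assoc)
    qed fact
    have "((\<lambda>v::'a. C * norm v) \<longlongrightarrow> C * norm (0::'a)) (at 0)" by (intro tendsto_intros)
    thus "((\<lambda>v::'a. C * norm v) \<longlongrightarrow> 0) (at 0)" by simp
  qed
qed

text \<open>
  If the support of a bump fits into the open disk, one closed disk of radius \<open>r < 1\<close> contains the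
  supports of all bumps with nearby scale and centre.
\<close>

lemma room_in_disk:
  assumes "0 < u" "cmod z < 1" "1 < u * (1 - cmod z)^2"
  obtains r \<delta> where "r < 1" "0 < \<delta>" "\<delta> \<le> 1" "\<And>u' z'. \<bar>u' - u\<bar> < \<delta> \<Longrightarrow> cmod (z' - z) < \<delta> \<Longrightarrow>
     0 < u' \<and> cmod z' \<le> r \<and> 1 \<le> u' * (r - cmod z')^2"
proof -
  have "sqrt (1 / u) < 1 - cmod z"
    using assms by (intro real_less_lsqrt) (auto simp: field_simps)
  then obtain a where a: "sqrt (1 / u) < a" "a < 1 - cmod z" using dense by blast
  have a0: "0 < a" using a(1) assms(1) by (smt (verit) real_sqrt_ge_0_iff zero_le_divide_1_iff)
  have "1 / u < a^2" using a(1) a0 by (metis less_imp_le real_sqrt_less_iff real_sqrt_unique)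
  hence a2: "1 / a^2 < u" using assms(1) a0 by (simp add: field_simps)
  \<comment> \<open>Half of the gap between \<open>a\<close> and \<open>1 - |z|\<close> is kept for moving \<open>z\<close>.\<close>
  define r where "r = cmod z + (a + (1 - cmod z)) / 2"
  define \<delta> where "\<delta> = min 1 (min (u - 1 / a^2) ((1 - cmod z - a) / 2))"
  show thesis
  proof (rule that[of r \<delta>])
    show "r < 1" using a(2) by (simp add: r_def field_simps)
    show "0 < \<delta>" using a a2 by (simp add: \<delta>_def)
    show "\<delta> \<le> 1" by (simp add: \<delta>_def)
    fix u' z' assume *: "\<bar>u' - u\<bar> < \<delta>" "cmod (z' - z) < \<delta>"
    have u': "1 / a^2 < u'" using *(1) by (simp add: \<delta>_def abs_less_iff)
    have "0 < 1 / a^2" using a0 by simp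
    with u' have "0 < u'" by linarith
    have "cmod z' \<le> cmod z + cmod (z' - z)" using norm_triangle_sub by blast
    also have "\<dots> < cmod z + (1 - cmod z - a) / 2" using *(2) by (simp add: \<delta>_def)
    also have "\<dots> = r - a" by (simp add: r_def field_simps)
    finally have z': "a < r - cmod z'" by simp
    have "1 \<le> u' * a^2" using u' a0 by (simp add: field_simps)
    also have "\<dots> \<le> u' * (r - cmod z')^2"
      using z' a0 \<open>0 < u'\<close> by (intro mult_left_mono power_mono) auto
    finally show "0 < u' \<and> cmod z' \<le> r \<and> 1 \<le> u' * (r - cmod z')^2"
      using \<open>0 < u'\<close> z' a0 by simp
  qed
qed

text \<open>
  Integrability is assumed on smaller disks only: for large \<open>\<gamma>\<close>, elements of \<open>L2 \<gamma>\<close> need not be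
  integrable up to the circle.
\<close>

locale weakly_holomorphic =
  fixes h :: "complex \<Rightarrow> complex"
  assumes locally_integrable: "\<And>r. r < 1 \<Longrightarrow> integrable lebesgue (\<lambda>z. indicator (cball 0 r) z * h z)"
    and weak: "\<And>\<phi>. \<phi> \<in> test_functions \<Longrightarrow> (\<integral>z. h z * wirtinger_bar (pdx \<phi>) (pdy \<phi>) z \<partial>lebesgue) = 0"
begin

lemma integrable_kernel:
  assumes r: "r < 1" and k: "k \<in> borel_measurable lebesgue"
    and bound: "\<And>\<zeta>. cmod \<zeta> \<le> r \<Longrightarrow> cmod (k \<zeta>) \<le> B" and supp: "\<And>\<zeta>. r < cmod \<zeta> \<Longrightarrow> k \<zeta> = 0"
  shows "integrable lebesgue (\<lambda>\<zeta>. h \<zeta> * k \<zeta>)"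
    and "0 \<le> B \<Longrightarrow> cmod (\<integral>\<zeta>. h \<zeta> * k \<zeta> \<partial>lebesgue) \<le> (\<integral>\<zeta>. cmod (indicator (cball 0 r) \<zeta> * h \<zeta>) \<partial>lebesgue) * B"
proof -
  note I = locally_integrable[OF r]
  have eq: "h \<zeta> * k \<zeta> = (indicator (cball 0 r) \<zeta> * h \<zeta>) * k \<zeta>" for \<zeta>
    using supp[of \<zeta>] by (auto simp: indicator_def)
  have le: "cmod (h \<zeta> * k \<zeta>) \<le> cmod (indicator (cball 0 r) \<zeta> * h \<zeta>) * \<bar>B\<bar>" for \<zeta>
  proof (cases "cmod \<zeta> \<le> r")
    case True
    thus ?thesis using bound[of \<zeta>] by (simp add: norm_mult mult_left_mono)
  qed (use supp[of \<zeta>] in simp)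
  show 1: "integrable lebesgue (\<lambda>\<zeta>. h \<zeta> * k \<zeta>)"
  proof (rule Bochner_Integration.integrable_bound)
    show "integrable lebesgue (\<lambda>\<zeta>. cmod (indicator (cball 0 r) \<zeta> * h \<zeta>) * \<bar>B\<bar>)"
      using I by (intro integrable_mult_left integrable_norm)
    show "(\<lambda>\<zeta>. h \<zeta> * k \<zeta>) \<in> borel_measurable lebesgue"
      unfolding eq by (rule borel_measurable_times[OF borel_measurable_integrable[OF I] k])
  qed (use le in auto)
  assume "0 \<le> B"
  have "cmod (\<integral>\<zeta>. h \<zeta> * k \<zeta> \<partial>lebesgue) \<le> (\<integral>\<zeta>. cmod (indicator (cball 0 r) \<zeta> * h \<zeta>) * \<bar>B\<bar> \<partial>lebesgue)"
  proof (rule order_trans[OF integral_norm_bound integral_mono])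
    show "integrable lebesgue (\<lambda>\<zeta>. cmod (h \<zeta> * k \<zeta>))" using 1 by (rule integrable_norm)
    show "integrable lebesgue (\<lambda>\<zeta>. cmod (indicator (cball 0 r) \<zeta> * h \<zeta>) * \<bar>B\<bar>)"
      using I by (intro integrable_mult_left integrable_norm)
  qed (rule le)
  thus "cmod (\<integral>\<zeta>. h \<zeta> * k \<zeta> \<partial>lebesgue) \<le> (\<integral>\<zeta>. cmod (indicator (cball 0 r) \<zeta> * h \<zeta>) \<partial>lebesgue) * B"
    using \<open>0 \<le> B\<close> by simp
qed

definition regularized :: "real \<Rightarrow> complex \<Rightarrow> complex" where
  "regularized u z = (\<integral>\<zeta>. h \<zeta> * mollifier u z \<zeta> \<partial>lebesgue)"

lemma flat_exp_measurable [measurable]: "flat_exp n \<in> borel_measurable borel"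
  unfolding flat_exp_def by measurable

lemma bump_measurable: "(\<lambda>\<zeta>. bump n u z \<zeta>) \<in> borel_measurable lebesgue"
proof -
  have "(\<lambda>\<zeta>. bump n u z \<zeta>) \<in> borel_measurable borel" by measurable
  thus ?thesis by (intro measurable_completion) simp
qed

lemma ident_measurable_lebesgue: "(\<lambda>\<zeta>::complex. \<zeta>) \<in> borel_measurable lebesgue"
  by (intro measurable_completion) simp

text \<open>
  The parts of the derivatives of the regularization, in \<open>z\<close> and in \<open>u\<close>, that vanish.
\<close>

lemma weak_bump:
  assumes "0 < u" "cmod z \<le> r" "1 \<le> u * (r - cmod z)^2" "r < 1"
  shows "(\<integral>\<zeta>. h \<zeta> * ((z - \<zeta>) * of_real (bump 2 u z \<zeta>)) \<partial>lebesgue) = 0"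
    and "(\<integral>\<zeta>. h \<zeta> * of_real (bump 0 u z \<zeta>
       - u * (cmod (z - \<zeta>))^2 * bump 2 u z \<zeta>) \<partial>lebesgue) = 0"
proof -
  note T = bump_test_functions[OF assms]
  have "(\<integral>\<zeta>. h \<zeta> * (of_real u * ((z - \<zeta>) * of_real (bump 2 u z \<zeta>))) \<partial>lebesgue) = 0"
    using weak[OF T(1)] by (simp only: T(2))
  thus "(\<integral>\<zeta>. h \<zeta> * ((z - \<zeta>) * of_real (bump 2 u z \<zeta>)) \<partial>lebesgue) = 0"
    using assms(1) by (simp add: mult.left_commute[of _ "of_real u"])
  have "(\<integral>\<zeta>. h \<zeta> * (of_real (u * (cmod (z - \<zeta>))^2) * of_real (bump 2 u z \<zeta>)
     - of_real (bump 0 u z \<zeta>)) \<partial>lebesgue) = 0"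
    using weak[OF T(3)] by (simp only: T(4))
  hence "(\<integral>\<zeta>. - (h \<zeta> * of_real (bump 0 u z \<zeta>
       - u * (cmod (z - \<zeta>))^2 * bump 2 u z \<zeta>)) \<partial>lebesgue) = 0"
    by (simp add: algebra_simps)
  thus "(\<integral>\<zeta>. h \<zeta> * of_real (bump 0 u z \<zeta>
       - u * (cmod (z - \<zeta>))^2 * bump 2 u z \<zeta>) \<partial>lebesgue) = 0"
    by simp
qed

lemma mollifier_integrable:
  assumes "0 < u" "cmod z \<le> r" "1 \<le> u * (r - cmod z)^2" "r < 1"
  shows "integrable lebesgue (\<lambda>\<zeta>. h \<zeta> * mollifier u z \<zeta>)"
proof (rule integrable_kernel(1)[OF \<open>r < 1\<close>])
  show "mollifier u z \<in> borel_measurable lebesgue"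
    unfolding mollifier_def using bump_measurable by measurable
  show "cmod (mollifier u z \<zeta>) \<le> u" for \<zeta>
    using flat_exp_bounded[of 0 "1 - u * (cmod (z - \<zeta>))^2"] assms(1) by (simp add: mollifier_def norm_mult mult_left_le)
qed (simp add: mollifier_def bump_support[OF assms(1-3)])

lemma norm_diff_le_2: "cmod z < 1 \<Longrightarrow> r < 1 \<Longrightarrow> cmod \<zeta> \<le> r \<Longrightarrow> cmod (z - \<zeta>) \<le> 2"
  using norm_triangle_ineq4[of z \<zeta>] by linarith

text \<open>
  Differentiating the bump in \<open>u\<close> gives \<open>\<partial>bar\<close> of a test function, which the weak equation
  annihilates.
\<close>

lemma regularized_u_derivative:
  assumes "0 < u" "cmod z < 1" "1 < u * (1 - cmod z)^2"
  shows "((\<lambda>u. regularized u z) has_derivative (\<lambda>_. 0)) (at u)"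
proof -
  obtain r \<delta> where r: "r < 1" "0 < \<delta>" and adm: "\<And>u' z'. \<bar>u' - u\<bar> < \<delta> \<Longrightarrow> cmod (z' - z) < \<delta> \<Longrightarrow>
     0 < u' \<and> cmod z' \<le> r \<and> 1 \<le> u' * (r - cmod z')^2"
    using room_in_disk[OF assms] by metis
  define J where "J = (\<integral>\<zeta>. cmod (indicator (cball 0 r) \<zeta> * h \<zeta>) \<partial>lebesgue)"
  have J: "0 \<le> J" unfolding J_def by (intro integral_nonneg_AE) auto
  define b where "b = (\<lambda>n u \<zeta>. bump n u z \<zeta>)"
  show ?thesis
  proof (rule has_derivative_quadratic_bound[OF bounded_linear_zero \<open>0 < \<delta>\<close>])
    show "0 \<le> J * (u * 576 + 8)" using J assms(1) by simp
    fix \<eta> :: real assume "norm \<eta> < \<delta>"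
    hence u': "0 < u + \<eta>" "cmod z \<le> r" "1 \<le> (u + \<eta>) * (r - cmod z)^2"
      using adm[of "u + \<eta>" z] r by auto
    have u: "0 < u" "cmod z \<le> r" "1 \<le> u * (r - cmod z)^2" using adm[of u z] r by auto
    define k where "k = (\<lambda>\<zeta>. mollifier (u + \<eta>) z \<zeta> - mollifier u z \<zeta>
      - of_real \<eta> * of_real (b 0 u \<zeta> - u * (cmod (z - \<zeta>))^2 * b 2 u \<zeta>))"
    have k_meas: "k \<in> borel_measurable lebesgue"
      unfolding k_def mollifier_def b_def
      using bump_measurable ident_measurable_lebesgue by measurable
    have k_bound: "cmod (k \<zeta>) \<le> (u * 576 + 8) * \<eta>^2" if "cmod \<zeta> \<le> r" for \<zeta>
    proof -
      define t where "t = (cmod (z - \<zeta>))^2"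
      have "(cmod (z - \<zeta>))^2 \<le> 2^2"
        using norm_diff_le_2[OF assms(2) r(1) that] by (intro power_mono) auto
      hence t: "0 \<le> t" "t \<le> 4" by (auto simp: t_def)
      define x where "x = 1 - u * t"
      have x': "1 - (u + \<eta>) * t = x + - (\<eta> * t)" by (simp add: x_def algebra_simps)
      have "k \<zeta> = of_real (u * (flat_exp 0 (x + - (\<eta> * t)) - flat_exp 0 x - flat_exp 2 x * - (\<eta> * t))
          + \<eta> * (flat_exp 0 (x + - (\<eta> * t)) - flat_exp 0 x))"
        unfolding k_def mollifier_def b_def t_def[symmetric] x' x_def[symmetric] by (simp add: algebra_simps)
      hence "cmod (k \<zeta>) = \<bar>u * (flat_exp 0 (x + - (\<eta> * t)) - flat_exp 0 x - flat_exp 2 x * - (\<eta> * t))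
          + \<eta> * (flat_exp 0 (x + - (\<eta> * t)) - flat_exp 0 x)\<bar>"
        by (simp only: norm_of_real)
      also have "\<dots> \<le> u * (36 * (- (\<eta> * t))^2) + \<bar>\<eta>\<bar> * (2 * \<bar>\<eta> * t\<bar>)"
      proof -
        have "\<bar>u * (flat_exp 0 (x + - (\<eta> * t)) - flat_exp 0 x - flat_exp 2 x * - (\<eta> * t))\<bar> \<le> u * (36 * (- (\<eta> * t))^2)"
          unfolding abs_mult[of u] using u(1) flat_exp_0_Taylor[of x "- (\<eta> * t)"] by (intro mult_mono) auto
        moreover have "\<bar>\<eta> * (flat_exp 0 (x + - (\<eta> * t)) - flat_exp 0 x)\<bar> \<le> \<bar>\<eta>\<bar> * (2 * \<bar>\<eta> * t\<bar>)"
          unfolding abs_mult[of \<eta> "_ - _"] using flat_exp_0_lipschitz[of "x + - (\<eta> * t)" x] by (intro mult_mono) auto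
        ultimately show ?thesis by (intro order_trans[OF abs_triangle_ineq add_mono])
      qed
      also have "\<dots> = (u * 36 * t^2 + 2 * t) * \<eta>^2"
        using t(1) by (simp add: abs_mult power2_eq_square algebra_simps)
      also have "\<dots> \<le> (u * 576 + 8) * \<eta>^2"
      proof (rule mult_right_mono)
        have "t^2 \<le> 4^2" using t by (intro power_mono)
        hence "u * (36 * t^2) \<le> u * 576" using u(1) by (intro mult_left_mono) auto
        thus "u * 36 * t^2 + 2 * t \<le> u * 576 + 8" using t(2) by simp
      qed simp
      finally show ?thesis .
    qed
    have k_supp: "k \<zeta> = 0" if "r < cmod \<zeta>" for \<zeta>
      unfolding k_def mollifier_def b_def using bump_support[OF u that] bump_support[OF u' that] by simp
    have "cmod (\<integral>\<zeta>. h \<zeta> * k \<zeta> \<partial>lebesgue) \<le> J * ((u * 576 + 8) * \<eta>^2)"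
      unfolding J_def using u(1)
      by (intro integrable_kernel(2)[OF r(1) k_meas k_bound k_supp]) auto
    also have "(\<integral>\<zeta>. h \<zeta> * k \<zeta> \<partial>lebesgue) = regularized (u + \<eta>) z - regularized u z"
    proof -
      have int_d: "integrable lebesgue (\<lambda>\<zeta>. h \<zeta> * of_real (b 0 u \<zeta> - u * (cmod (z - \<zeta>))^2 * b 2 u \<zeta>))"
      proof (rule integrable_kernel(1)[OF r(1)])
        show "(\<lambda>\<zeta>. complex_of_real (b 0 u \<zeta> - u * (cmod (z - \<zeta>))^2 * b 2 u \<zeta>)) \<in> borel_measurable lebesgue"
          unfolding b_def using bump_measurable ident_measurable_lebesgue by measurable
        fix \<zeta> assume "cmod \<zeta> \<le> r"
        have "cmod (of_real (b 0 u \<zeta> - u * (cmod (z - \<zeta>))^2 * b 2 u \<zeta>))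
          \<le> \<bar>b 0 u \<zeta>\<bar> + \<bar>u * (cmod (z - \<zeta>))^2 * b 2 u \<zeta>\<bar>"
          unfolding norm_of_real by (rule abs_triangle_ineq4)
        also have "\<dots> \<le> 1 + u * 2^2 * 2"
        proof (rule add_mono)
          show "\<bar>b 0 u \<zeta>\<bar> \<le> 1" using flat_exp_bounded[of 0] by (simp add: b_def)
          have "\<bar>u * (cmod (z - \<zeta>))^2 * b 2 u \<zeta>\<bar> = u * (cmod (z - \<zeta>))^2 * b 2 u \<zeta>"
            using u(1) by (simp add: b_def)
          also have "\<dots> \<le> u * 2^2 * 2"
            using u(1) norm_diff_le_2[OF assms(2) r(1) \<open>cmod \<zeta> \<le> r\<close>] flat_exp_bounded[of 2]
            by (intro mult_mono power_mono) (auto simp: b_def fact_numeral)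
          finally show "\<bar>u * (cmod (z - \<zeta>))^2 * b 2 u \<zeta>\<bar> \<le> u * 2^2 * 2" .
        qed
        finally show "cmod (of_real (b 0 u \<zeta> - u * (cmod (z - \<zeta>))^2 * b 2 u \<zeta>)) \<le> 1 + u * 2^2 * 2" .
      qed (simp add: b_def bump_support[OF u])
      have "(\<integral>\<zeta>. h \<zeta> * k \<zeta> \<partial>lebesgue) = (\<integral>\<zeta>. h \<zeta> * mollifier (u + \<eta>) z \<zeta> - h \<zeta> * mollifier u z \<zeta>
         - of_real \<eta> * (h \<zeta> * of_real (b 0 u \<zeta> - u * (cmod (z - \<zeta>))^2 * b 2 u \<zeta>)) \<partial>lebesgue)"
        by (intro Bochner_Integration.integral_cong) (auto simp: k_def algebra_simps)
      also have "\<dots> = regularized (u + \<eta>) z - regularized u z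
         - of_real \<eta> * (\<integral>\<zeta>. h \<zeta> * of_real (b 0 u \<zeta> - u * (cmod (z - \<zeta>))^2 * b 2 u \<zeta>) \<partial>lebesgue)"
        using mollifier_integrable[OF u r(1)] mollifier_integrable[OF u' r(1)] int_d
        by (simp only: Bochner_Integration.integral_diff Bochner_Integration.integrable_diff
            integrable_mult_right integral_mult_right_zero regularized_def)
      finally show ?thesis using weak_bump(2)[OF u r(1)] by (simp add: b_def)
    qed
    finally show "norm (regularized (u + \<eta>) z - regularized u z - 0) \<le> J * (u * 576 + 8) * (norm \<eta>)^2"
      by (simp add: mult.assoc)
  qed
qed

lemma regularized_indep:
  assumes "0 < u" "0 < u'" "cmod z < 1" "1 < u * (1 - cmod z)^2" "1 < u' * (1 - cmod z)^2"
  shows "regularized u z = regularized u' z"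
proof -
  define S where "S = {1 / (1 - cmod z)^2<..}"
  have p: "0 < (1 - cmod z)^2" using assms(3) by simp
  have S: "0 < v" "1 < v * (1 - cmod z)^2" if "v \<in> S" for v
  proof -
    show "1 < v * (1 - cmod z)^2" using that p by (simp add: S_def field_simps)
    thus "0 < v" using p by (metis less_trans zero_less_one zero_less_mult_pos2)
  qed
  have "\<exists>c. \<forall>v\<in>S. regularized v z = c"
  proof (rule has_derivative_zero_constant)
    show "convex S" by (simp add: S_def)
    show "((\<lambda>v. regularized v z) has_derivative (\<lambda>h. 0)) (at v within S)" if "v \<in> S" for v
      using regularized_u_derivative[OF S(1)[OF that] assms(3) S(2)[OF that]]
      by (rule has_derivative_at_withinI)
  qed
  moreover have "u \<in> S" "u' \<in> S" using assms p by (auto simp: S_def field_simps)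
  ultimately show ?thesis by auto
qed

text \<open>
  The real derivative of the regularization in direction \<open>v\<close> is a multiple of
  \<open>cnj v \<integral>h (z - \<zeta>) \<beta>' + v \<integral>h cnj (z - \<zeta>) \<beta>'\<close>, and the weak equation annihilates the first integral;
  what remains is complex linear in \<open>v\<close>.
\<close>

lemma regularized_field_differentiable:
  assumes "0 < u" "cmod z < 1" "1 < u * (1 - cmod z)^2"
  shows "regularized u field_differentiable (at z)"
proof -
  obtain r \<delta> where r: "r < 1" "0 < \<delta>" "\<delta> \<le> 1" and adm: "\<And>u' z'. \<bar>u' - u\<bar> < \<delta> \<Longrightarrow> cmod (z' - z) < \<delta> \<Longrightarrow>
     0 < u' \<and> cmod z' \<le> r \<and> 1 \<le> u' * (r - cmod z')^2"
    using room_in_disk[OF assms] by metis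
  define J where "J = (\<integral>\<zeta>. cmod (indicator (cball 0 r) \<zeta> * h \<zeta>) \<partial>lebesgue)"
  have J: "0 \<le> J" unfolding J_def by (intro integral_nonneg_AE) auto
  define b where "b = (\<lambda>\<zeta>. complex_of_real (bump 2 u z \<zeta>))"
  define d where "d = - of_real (u^2) * (\<integral>\<zeta>. h \<zeta> * (cnj (z - \<zeta>) * b \<zeta>) \<partial>lebesgue)"
  have u: "0 < u" "cmod z \<le> r" "1 \<le> u * (r - cmod z)^2" using adm[of u z] r by auto
  have b_meas: "b \<in> borel_measurable lebesgue"
    unfolding b_def using bump_measurable by measurable
  have w_meas: "(\<lambda>\<zeta>. z - \<zeta>) \<in> borel_measurable lebesgue"
    using ident_measurable_lebesgue by measurable
  have wb_bound: "cmod ((z - \<zeta>) * b \<zeta>) \<le> 2 * 2" if "cmod \<zeta> \<le> r" for \<zeta>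
    unfolding norm_mult using norm_diff_le_2[OF assms(2) r(1) that] flat_exp_bounded[of 2]
    by (intro mult_mono) (auto simp: b_def fact_numeral)
  have b_supp: "b \<zeta> = 0" if "r < cmod \<zeta>" for \<zeta>
    using bump_support[OF u that] by (simp add: b_def)
  have int1: "integrable lebesgue (\<lambda>\<zeta>. h \<zeta> * ((z - \<zeta>) * b \<zeta>))"
    using wb_bound b_supp b_meas w_meas
    by (intro integrable_kernel(1)[OF r(1), of _ "2 * 2"] borel_measurable_times) auto
  have int2: "integrable lebesgue (\<lambda>\<zeta>. h \<zeta> * (cnj (z - \<zeta>) * b \<zeta>))"
    using wb_bound b_supp b_meas borel_measurable_cnj[OF w_meas]
    by (intro integrable_kernel(1)[OF r(1), of _ "2 * 2"] borel_measurable_times)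
       (auto simp: norm_mult simp flip: complex_cnj_diff)
  have "(regularized u has_derivative (\<lambda>v. d * v)) (at z)"
  proof (rule has_derivative_quadratic_bound[OF bounded_linear_mult_right \<open>0 < \<delta>\<close>])
    show "0 \<le> J * (u * (900 * u^2 + 2 * u))" using J assms(1) by simp
    fix v :: complex assume v: "norm v < \<delta>"
    hence v1: "cmod v \<le> 1" using r by simp
    have u': "0 < u" "cmod (z + v) \<le> r" "1 \<le> u * (r - cmod (z + v))^2"
      using adm[of u "z + v"] v r by auto
    define k where "k = (\<lambda>\<zeta>. mollifier u (z + v) \<zeta> - mollifier u z \<zeta>
       - (- of_real (u^2)) * (cnj v * ((z - \<zeta>) * b \<zeta>) + v * (cnj (z - \<zeta>) * b \<zeta>)))"
    have k_meas: "k \<in> borel_measurable lebesgue"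
      unfolding k_def mollifier_def
      using bump_measurable[of 0 u z] bump_measurable[of 0 u "z + v"] b_meas
        ident_measurable_lebesgue
      by measurable
    have k_bound: "cmod (k \<zeta>) \<le> (u * (900 * u^2 + 2 * u)) * (cmod v)^2" if "cmod \<zeta> \<le> r" for \<zeta>
    proof -
      define w where "w = z - \<zeta>"
      have w: "cmod w \<le> 2" unfolding w_def by (rule norm_diff_le_2[OF assms(2) r(1) that])
      define x where "x = 1 - u * (cmod w)^2"
      define e where "e = - (u * (2 * (w \<bullet> v) + (cmod v)^2))"
      have x': "1 - u * (cmod (z + v - \<zeta>))^2 = x + e"
      proof -
        have "(cmod (w + v))^2 = (cmod w)^2 + 2 * (w \<bullet> v) + (cmod v)^2"
          by (simp add: dot_norm field_simps)
        moreover have "z + v - \<zeta> = w + v" by (simp add: w_def)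
        ultimately show ?thesis by (simp add: x_def e_def algebra_simps)
      qed
      have wv: "cnj v * w + v * cnj w = of_real (2 * (w \<bullet> v))"
        by (simp add: complex_eq_iff inner_complex_def)
      have "k \<zeta> = of_real u * of_real (flat_exp 0 (x + e)) - of_real u * of_real (flat_exp 0 x)
         + of_real (u^2) * (cnj v * w + v * cnj w) * of_real (flat_exp 2 x)"
        unfolding k_def mollifier_def b_def x' w_def[symmetric] x_def[symmetric] by (simp add: algebra_simps)
      also have "\<dots> = of_real (u * ((flat_exp 0 (x + e) - flat_exp 0 x - flat_exp 2 x * e) - u * (cmod v)^2 * flat_exp 2 x))"
        unfolding wv by (simp add: e_def power2_eq_square algebra_simps)
      finally have "cmod (k \<zeta>) = u * \<bar>(flat_exp 0 (x + e) - flat_exp 0 x - flat_exp 2 x * e) - u * (cmod v)^2 * flat_exp 2 x\<bar>"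
        using u(1) by (simp only: norm_of_real abs_mult abs_of_pos)
      also have "\<dots> \<le> u * (36 * e^2 + u * (cmod v)^2 * 2)"
      proof (rule mult_left_mono)
        have "\<bar>u * (cmod v)^2 * flat_exp 2 x\<bar> = u * (cmod v)^2 * flat_exp 2 x" using u(1) by simp
        also have "\<dots> \<le> u * (cmod v)^2 * 2"
          using u(1) flat_exp_bounded[of 2 x] by (intro mult_left_mono) (auto simp: fact_numeral)
        finally show "\<bar>(flat_exp 0 (x + e) - flat_exp 0 x - flat_exp 2 x * e) - u * (cmod v)^2 * flat_exp 2 x\<bar>
            \<le> 36 * e^2 + u * (cmod v)^2 * 2"
          using flat_exp_0_Taylor[of x e] by (intro order_trans[OF abs_triangle_ineq4 add_mono])
      qed (use u in simp)
      also have "\<dots> \<le> u * (36 * (5 * u * cmod v)^2 + u * (cmod v)^2 * 2)"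
      proof -
        have "\<bar>2 * (w \<bullet> v) + (cmod v)^2\<bar> \<le> 2 * (cmod w * cmod v) + cmod v * cmod v"
          using Cauchy_Schwarz_ineq2[of w v] abs_triangle_ineq[of "2 * (w \<bullet> v)" "(cmod v)^2"]
          by (simp add: power2_eq_square abs_mult)
        also have "\<dots> \<le> 2 * (2 * cmod v) + 1 * cmod v"
          using w v1 by (intro add_mono mult_left_mono mult_right_mono) auto
        finally have "u * \<bar>2 * (w \<bullet> v) + (cmod v)^2\<bar> \<le> u * (5 * cmod v)"
          using u(1) by (intro mult_left_mono) auto
        hence "\<bar>e\<bar> \<le> \<bar>5 * u * cmod v\<bar>" using u(1) by (simp add: e_def abs_mult mult_ac)
        hence "e^2 \<le> (5 * u * cmod v)^2" by (simp only: abs_le_square_iff)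
        thus ?thesis using u(1) by (intro mult_left_mono add_mono) auto
      qed
      also have "\<dots> = (u * (900 * u^2 + 2 * u)) * (cmod v)^2"
        by (simp add: power2_eq_square algebra_simps)
      finally show ?thesis .
    qed
    have k_supp: "k \<zeta> = 0" if "r < cmod \<zeta>" for \<zeta>
      unfolding k_def mollifier_def using bump_support[OF u that] bump_support[OF u' that] b_supp[OF that] by simp
    have "cmod (\<integral>\<zeta>. h \<zeta> * k \<zeta> \<partial>lebesgue) \<le> J * ((u * (900 * u^2 + 2 * u)) * (cmod v)^2)"
      unfolding J_def using u(1)
      by (intro integrable_kernel(2)[OF r(1) k_meas k_bound k_supp]) auto
    also have "(\<integral>\<zeta>. h \<zeta> * k \<zeta> \<partial>lebesgue) = regularized u (z + v) - regularized u z - d * v"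
    proof -
      have "(\<integral>\<zeta>. h \<zeta> * k \<zeta> \<partial>lebesgue) = (\<integral>\<zeta>. h \<zeta> * mollifier u (z + v) \<zeta> - h \<zeta> * mollifier u z \<zeta>
         - (- of_real (u^2)) * (cnj v * (h \<zeta> * ((z - \<zeta>) * b \<zeta>)) + v * (h \<zeta> * (cnj (z - \<zeta>) * b \<zeta>))) \<partial>lebesgue)"
        by (intro Bochner_Integration.integral_cong) (auto simp: k_def algebra_simps)
      also have "\<dots> = regularized u (z + v) - regularized u z
         - (- of_real (u^2)) * (cnj v * (\<integral>\<zeta>. h \<zeta> * ((z - \<zeta>) * b \<zeta>) \<partial>lebesgue)
            + v * (\<integral>\<zeta>. h \<zeta> * (cnj (z - \<zeta>) * b \<zeta>) \<partial>lebesgue))"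
        using mollifier_integrable[OF u r(1)] mollifier_integrable[OF u' r(1)] int1 int2
        by (simp only: Bochner_Integration.integral_diff Bochner_Integration.integrable_diff
            Bochner_Integration.integral_add Bochner_Integration.integrable_add
            integrable_mult_right integral_mult_right_zero regularized_def)
      finally show ?thesis using weak_bump(1)[OF u r(1)] by (simp add: b_def d_def)
    qed
    finally show "norm (regularized u (z + v) - regularized u z - d * v)
        \<le> J * (u * (900 * u^2 + 2 * u)) * (norm v)^2"
      by (simp add: mult.assoc)
  qed
  thus ?thesis
    unfolding field_differentiable_def has_field_derivative_def by blast
qed

end

lemma sigma_finite_lebesgue: "sigma_finite_measure (lebesgue :: complex measure)"
proof
  obtain A :: "complex set set" where A: "countable A" "A \<subseteq> sets lborel" "\<Union>A = space lborel"
    "\<forall>a\<in>A. emeasure lborel a \<noteq> \<infinity>"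
    using lborel.sigma_finite_countable by blast
  thus "\<exists>A. countable A \<and> A \<subseteq> sets (lebesgue :: complex measure) \<and> \<Union>A = space lebesgue \<and>
    (\<forall>a\<in>A. emeasure lebesgue a \<noteq> \<infinity>)"
    by (intro exI[of _ A]) (auto simp: subset_iff)
qed

interpretation lebesgue_pair: pair_sigma_finite "lebesgue :: complex measure" "lebesgue :: complex measure"
  using sigma_finite_lebesgue by (intro pair_sigma_finite.intro)

interpretation one: weakly_holomorphic "\<lambda>_. 1"
proof
  fix r :: real
  show "integrable lebesgue (\<lambda>z::complex. indicator (cball 0 r) z * 1 :: complex)"
  proof -
    have "integrable lebesgue (indicator (cball (0 :: complex) r) :: complex \<Rightarrow> real)"
      using emeasure_lborel_cball_finite[of "0 :: complex" r] by (intro integrable_real_indicator) auto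
    from integrable_of_real[OF this]
    have "integrable lebesgue (\<lambda>z::complex. complex_of_real (indicator (cball 0 r) z))" .
    moreover have "(\<lambda>z::complex. complex_of_real (indicator (cball 0 r) z)) = (\<lambda>z. indicator (cball 0 r) z * 1)"
      by (auto simp: indicator_def)
    ultimately show ?thesis by simp
  qed
next
  fix \<phi> assume "\<phi> \<in> test_functions"
  hence C1: "disk_C1 \<phi>" by (rule test_function_imp_C1)
  obtain r where r: "\<And>z. r < cmod z \<Longrightarrow> \<phi> z = 0" using C1 by (auto simp: disk_C1_def)
  have int: "integrable lebesgue (dd b \<phi>)" for b by (intro disk_C0_integrable disk_C1_dd_C0 C1)
  have zero: "(\<integral>z. dd b \<phi> z \<partial>lebesgue) = 0" for b
    using C1 disk_C1_continuous_dd[OF C1] by (intro integral_dd_eq_0[of _ _ r] r) (auto simp: disk_C1_def)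
  show "(\<integral>z. 1 * wirtinger_bar (pdx \<phi>) (pdy \<phi>) z \<partial>lebesgue) = 0"
    using int zero by (simp add: wirtinger_bar_def pdx_eq_dd pdy_eq_dd)
qed

definition mollifier_mass :: real where
  "mollifier_mass = (\<integral>\<zeta>. 2 * flat_exp 0 (1 - 2 * (cmod \<zeta>)^2) \<partial>lebesgue)"

text \<open>
  Constants are weakly holomorphic, so their regularization is independent of \<open>u\<close>: this replaces the
  scaling of planar Lebesgue measure.
\<close>

lemma mollifier_integral:
  assumes "1 < u"
  shows "integrable lebesgue (mollifier u z)" "(\<integral>\<zeta>. mollifier u z \<zeta> \<partial>lebesgue) = of_real mollifier_mass"
proof -
  have meas: "mollifier u z \<in> borel_measurable borel" for u z
    unfolding mollifier_def flat_exp_def by measurable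
  have int0: "integrable lebesgue (mollifier u 0)" if u: "1 < u" for u
  proof -
    obtain r :: real where r: "sqrt (1 / u) < r" "r < 1"
      using dense[of "sqrt (1 / u)" 1] u by auto
    have s: "0 \<le> sqrt (1 / u)" using u by simp
    hence "0 \<le> r" using r(1) by linarith
    have "(sqrt (1 / u))^2 \<le> r^2" using r(1) s by (intro power_mono) auto
    hence "1 \<le> u * r^2" using u by (simp add: field_simps)
    note r = r(2) this \<open>0 \<le> r\<close>
    show ?thesis
      using one.mollifier_integrable[of u 0 r] u r by simp
  qed
  have int0': "integrable lborel (mollifier u 0)" if u: "1 < u" for u
    using int0[OF u] meas by (subst (asm) integrable_completion) auto
  have shift: "mollifier u z = (\<lambda>\<zeta>. mollifier u 0 (- z + \<zeta>))"
    by (auto simp: mollifier_def fun_eq_iff norm_minus_commute)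
  have "integrable (distr lborel borel ((+) (- z))) (mollifier u 0)"
    using int0'[OF assms] by (simp add: lborel_distr_plus)
  hence "integrable lborel (mollifier u z)"
    unfolding shift by (subst (asm) integrable_distr_eq) (use meas in auto)
  thus "integrable lebesgue (mollifier u z)"
    using meas by (subst integrable_completion) auto
  have "(\<integral>\<zeta>. mollifier u z \<zeta> \<partial>lebesgue) = (\<integral>\<zeta>. mollifier u z \<zeta> \<partial>lborel)"
    using meas by (subst integral_completion) auto
  also have "\<dots> = (\<integral>\<zeta>. mollifier u 0 \<zeta> \<partial>lborel)"
    unfolding shift by (rule lebesgue_integral_translate[OF meas])
  also have "\<dots> = (\<integral>\<zeta>. mollifier u 0 \<zeta> \<partial>lebesgue)"
    using meas by (subst integral_completion) auto
  also have "\<dots> = one.regularized u 0" by (simp add: one.regularized_def)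
  also have "\<dots> = one.regularized 2 0" using assms by (intro one.regularized_indep) auto
  also have "\<dots> = of_real mollifier_mass"
    unfolding one.regularized_def mollifier_mass_def integral_complex_of_real[symmetric] by (simp add: mollifier_def)
  finally show "(\<integral>\<zeta>. mollifier u z \<zeta> \<partial>lebesgue) = of_real mollifier_mass" .
qed

lemma mollifier_mass_pos: "0 < mollifier_mass"
proof -
  let ?f = "\<lambda>\<zeta>. 2 * flat_exp 0 (1 - 2 * (cmod \<zeta>)^2)"
  have "integrable lebesgue (\<lambda>\<zeta>. Re (mollifier 2 0 \<zeta>))" using mollifier_integral(1)[of 2 0] by simp
  hence int: "integrable lebesgue ?f" by (simp add: mollifier_def)
  have "mollifier_mass \<noteq> 0"
  proof
    assume "mollifier_mass = 0"
    hence "AE \<zeta> in lebesgue. ?f \<zeta> = 0"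
      using integral_nonneg_eq_0_iff_AE[OF int] by (simp add: mollifier_mass_def)
    then obtain N where N: "N \<in> null_sets lebesgue" "{\<zeta>. ?f \<zeta> \<noteq> 0} \<subseteq> N"
      by (auto simp: eventually_ae_filter)
    have "ball 0 (1/2) \<subseteq> N"
    proof
      fix \<zeta> :: complex assume "\<zeta> \<in> ball 0 (1/2)"
      hence "(cmod \<zeta>)^2 < (1/2)^2" by (intro power_strict_mono) auto
      hence "0 < flat_exp 0 (1 - 2 * (cmod \<zeta>)^2)" by (intro flat_exp_pos) (simp add: power2_eq_square)
      with N show "\<zeta> \<in> N" by auto
    qed
    hence "negligible (ball (0 :: complex) (1/2))"
      using N(1) negligible_iff_null_sets negligible_subset by blast
    thus False using open_not_negligible[of "ball (0 :: complex) (1/2)"] by simp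
  qed
  moreover have "0 \<le> mollifier_mass" unfolding mollifier_mass_def by (intro integral_nonneg_AE) auto
  ultimately show ?thesis by simp
qed

context weakly_holomorphic
begin

text \<open>
  Any admissible scale gives the same value; the scale chosen here makes the bump around \<open>z\<close> reach
  half way to the circle.
\<close>

definition representative :: "complex \<Rightarrow> complex" where
  "representative z = regularized (4 / (1 - cmod z)^2) z / of_real mollifier_mass"

lemma regularized_eq:
  assumes "cmod z < 1" "0 < u" "1 < u * (1 - cmod z)^2"
  shows "regularized u z = of_real mollifier_mass * representative z"
proof -
  have "regularized u z = regularized (4 / (1 - cmod z)^2) z"
    using assms by (intro regularized_indep) auto
  thus ?thesis using mollifier_mass_pos by (simp add: representative_def)
qed

lemma representative_holomorphic: "representative holomorphic_on ball 0 1"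
proof (rule holomorphic_onI)
  fix z :: complex assume "z \<in> ball 0 1"
  hence z: "cmod z < 1" by simp
  define u where "u = 4 / (1 - cmod z)^2"
  have u: "0 < u" "1 < u * (1 - cmod z)^2" using z by (auto simp: u_def)
  define V where "V = {w. cmod w < 1} \<inter> {w. 1 < u * (1 - cmod w)^2}"
  have V: "open V" "z \<in> V"
    unfolding V_def using z u by (auto intro!: open_Int open_Collect_less continuous_intros)
  have "(\<lambda>w. regularized u w / of_real mollifier_mass) field_differentiable (at z)"
    using mollifier_mass_pos by (intro field_differentiable_divide regularized_field_differentiable u z) auto
  then obtain d where d: "((\<lambda>w. regularized u w / of_real mollifier_mass) has_field_derivative d) (at z)"
    by (auto simp: field_differentiable_def)
  have "(representative has_field_derivative d) (at z)"
  proof (rule has_field_derivative_transform_within_open[OF d V])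
    fix w assume "w \<in> V"
    thus "regularized u w / of_real mollifier_mass = representative w"
      using regularized_eq[of w u] u mollifier_mass_pos by (simp add: V_def)
  qed
  thus "representative field_differentiable (at z within ball 0 1)"
    using field_differentiable_at_within field_differentiable_def by blast
qed

text \<open>
  Convolution with the mollifier averages \<open>\<psi>\<close> over a disk of radius \<open>1 / sqrt u\<close>.
\<close>

lemma convolution_approximates:
  assumes "1 < u" and cont: "continuous_on UNIV \<psi>" and supp: "\<And>z. r < cmod z \<Longrightarrow> \<psi> z = 0"
    and close: "\<And>z. cmod (z - \<zeta>) \<le> 1 / sqrt u \<Longrightarrow> cmod (\<psi> z - \<psi> \<zeta>) \<le> \<omega>" and "0 \<le> \<omega>"
  shows "cmod ((\<integral>z. mollifier u z \<zeta> * \<psi> z \<partial>lebesgue) - of_real mollifier_mass * \<psi> \<zeta>) \<le> mollifier_mass * \<omega>"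
proof -
  note I = mollifier_integral[OF \<open>1 < u\<close>, of \<zeta>]
  have "continuous_on UNIV (\<lambda>z. mollifier u \<zeta> z)"
    unfolding mollifier_def by (intro continuous_intros continuous_on_compose2[OF DERIV_continuous_on[OF has_field_derivative_at_within[OF flat_exp_0_has_derivative]]]) auto
  hence int1: "integrable lebesgue (\<lambda>z. mollifier u \<zeta> z * \<psi> z)"
    using cont supp by (intro integrable_lebesgue_compact_support(1)[of _ r] continuous_intros) auto
  have int2: "integrable lebesgue (\<lambda>z. mollifier u \<zeta> z * \<psi> \<zeta>)" using I(1) by (rule integrable_mult_left)
  have mollifier_real: "mollifier u \<zeta> z = of_real (cmod (mollifier u \<zeta> z))" for z
    using \<open>1 < u\<close> by (simp add: mollifier_def norm_mult)
  have mass: "(\<integral>z. cmod (mollifier u \<zeta> z) \<partial>lebesgue) = mollifier_mass"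
  proof -
    have "(\<integral>z. mollifier u \<zeta> z \<partial>lebesgue) = (\<integral>z. complex_of_real (cmod (mollifier u \<zeta> z)) \<partial>lebesgue)"
      by (rule Bochner_Integration.integral_cong[OF refl]) (rule mollifier_real)
    thus ?thesis using I(2) by simp
  qed
  have "(\<integral>z. mollifier u z \<zeta> * \<psi> z \<partial>lebesgue) - of_real mollifier_mass * \<psi> \<zeta>
      = (\<integral>z. mollifier u \<zeta> z * \<psi> z \<partial>lebesgue) - (\<integral>z. mollifier u \<zeta> z * \<psi> \<zeta> \<partial>lebesgue)"
    using I by (simp add: mollifier_sym[of u _ \<zeta>])
  also have "\<dots> = (\<integral>z. mollifier u \<zeta> z * (\<psi> z - \<psi> \<zeta>) \<partial>lebesgue)"
    unfolding right_diff_distrib using int1 int2 by (rule Bochner_Integration.integral_diff[symmetric])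
  also have "cmod \<dots> \<le> (\<integral>z. cmod (mollifier u \<zeta> z) * \<omega> \<partial>lebesgue)"
  proof (rule order_trans[OF integral_norm_bound integral_mono])
    show "integrable lebesgue (\<lambda>z. cmod (mollifier u \<zeta> z * (\<psi> z - \<psi> \<zeta>)))"
      using Bochner_Integration.integrable_diff[OF int1 int2]
      by (intro integrable_norm) (simp add: right_diff_distrib)
    show "integrable lebesgue (\<lambda>z. cmod (mollifier u \<zeta> z) * \<omega>)"
      using I(1) by (intro integrable_mult_left integrable_norm)
    fix z
    show "cmod (mollifier u \<zeta> z * (\<psi> z - \<psi> \<zeta>)) \<le> cmod (mollifier u \<zeta> z) * \<omega>"
    proof (cases "cmod (z - \<zeta>) \<le> 1 / sqrt u")
      case True
      thus ?thesis using close by (simp add: norm_mult mult_left_mono)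
    next
      case False
      hence "(1 / sqrt u)^2 \<le> (cmod (z - \<zeta>))^2" using \<open>1 < u\<close> by (intro power_mono) auto
      hence "1 \<le> u * (cmod (\<zeta> - z))^2"
        using \<open>1 < u\<close> by (simp add: power_divide field_simps norm_minus_commute)
      hence "mollifier u \<zeta> z = 0" by (simp add: mollifier_def flat_exp_nonpos_eq_0)
      thus ?thesis by simp
    qed
  qed
  also have "\<dots> = mollifier_mass * \<omega>" using mass by simp
  finally show ?thesis .
qed

text \<open>
  The mollifier is symmetric, so by Fubini's theorem it can be moved from \<open>h\<close> to \<open>\<psi>\<close>.
\<close>

lemma regularized_pairing:
  assumes "1 < u" "r < r1" "r1 < 1" "1 \<le> u * (r1 - r)^2"
    and cont: "continuous_on UNIV \<psi>" and supp: "\<And>z. r < cmod z \<Longrightarrow> \<psi> z = 0"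
  defines "T \<equiv> \<lambda>\<zeta>. \<integral>z. mollifier u z \<zeta> * \<psi> z \<partial>lebesgue" and "h1 \<equiv> \<lambda>\<zeta>. indicator (cball 0 r1) \<zeta> * h \<zeta>"
  shows "integrable lebesgue (\<lambda>\<zeta>. h1 \<zeta> * T \<zeta>)"
    and "(\<integral>z. regularized u z * \<psi> z \<partial>lebesgue) = (\<integral>\<zeta>. h1 \<zeta> * T \<zeta> \<partial>lebesgue)"
proof -
  have h1: "integrable lebesgue h1" unfolding h1_def using \<open>r1 < 1\<close> by (rule locally_integrable)
  have \<psi>: "integrable lebesgue \<psi>" using cont supp by (rule integrable_lebesgue_compact_support)
  define F where "F = (\<lambda>\<zeta> z. h1 \<zeta> * (mollifier u z \<zeta> * \<psi> z))"
  have mollifier_le: "cmod (mollifier u z \<zeta>) \<le> u" for z \<zeta>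
    using flat_exp_bounded[of 0 "1 - u * (cmod (z - \<zeta>))^2"] \<open>1 < u\<close> by (simp add: mollifier_def norm_mult mult_left_le)
  have id [measurable]: "(\<lambda>\<zeta>::complex. \<zeta>) \<in> borel_measurable lebesgue"
    by (rule ident_measurable_lebesgue)
  have [measurable]: "h1 \<in> borel_measurable lebesgue" "\<psi> \<in> borel_measurable lebesgue"
    using h1 \<psi> by auto
  have [measurable]: "(\<lambda>p. fst p) \<in> borel_measurable ((lebesgue :: complex measure) \<Otimes>\<^sub>M (lebesgue :: complex measure))"
     "(\<lambda>p. snd p) \<in> borel_measurable ((lebesgue :: complex measure) \<Otimes>\<^sub>M (lebesgue :: complex measure))"
    using measurable_compose[OF measurable_fst id] measurable_compose[OF measurable_snd id] by simp_all
  have F_meas: "case_prod F \<in> borel_measurable (lebesgue \<Otimes>\<^sub>M lebesgue)"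
    unfolding F_def mollifier_def split_beta' by measurable
  have F_le: "cmod (F \<zeta> z) \<le> cmod (h1 \<zeta>) * (u * cmod (\<psi> z))" for \<zeta> z
    unfolding F_def norm_mult by (intro mult_left_mono mult_right_mono mollifier_le) auto
  have F_int2: "integrable lebesgue (F \<zeta>)" for \<zeta>
  proof (rule Bochner_Integration.integrable_bound)
    show "integrable lebesgue (\<lambda>z. cmod (h1 \<zeta>) * (u * cmod (\<psi> z)))"
      using \<psi> by (intro integrable_mult_right integrable_norm)
    show "F \<zeta> \<in> borel_measurable lebesgue"
      unfolding F_def mollifier_def by measurable
  qed (use F_le \<open>1 < u\<close> in \<open>auto simp: abs_mult\<close>)
  have F_int: "integrable (lebesgue \<Otimes>\<^sub>M lebesgue) (case_prod F)"
  proof (rule lebesgue_pair.Fubini_integrable[OF F_meas])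
    show "AE \<zeta> in lebesgue. integrable lebesgue (\<lambda>z. case_prod F (\<zeta>, z))" using F_int2 by simp
    show "integrable lebesgue (\<lambda>\<zeta>. \<integral>z. norm (case_prod F (\<zeta>, z)) \<partial>lebesgue)"
    proof (rule Bochner_Integration.integrable_bound)
      show "integrable lebesgue (\<lambda>\<zeta>. cmod (h1 \<zeta>) * (\<integral>z. u * cmod (\<psi> z) \<partial>lebesgue))"
        using h1 by (intro integrable_mult_left integrable_norm)
      show "(\<lambda>\<zeta>. \<integral>z. norm (case_prod F (\<zeta>, z)) \<partial>lebesgue) \<in> borel_measurable lebesgue"
        using F_meas by (intro sigma_finite_measure.borel_measurable_lebesgue_integral[OF sigma_finite_lebesgue]) (simp add: split_beta')
      have "(\<integral>z. norm (F \<zeta> z) \<partial>lebesgue) \<le> (\<integral>z. cmod (h1 \<zeta>) * (u * cmod (\<psi> z)) \<partial>lebesgue)" for \<zeta>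
        using F_int2[of \<zeta>] \<psi> F_le by (intro integral_mono integrable_norm integrable_mult_right) auto
      hence le: "(\<integral>z. norm (F \<zeta> z) \<partial>lebesgue) \<le> cmod (h1 \<zeta>) * (\<integral>z. u * cmod (\<psi> z) \<partial>lebesgue)" for \<zeta>
        by (simp only: integral_mult_right_zero)
      have "0 \<le> (\<integral>z. norm (F \<zeta> z) \<partial>lebesgue)" for \<zeta> by (intro integral_nonneg_AE) auto
      with le show "AE \<zeta> in lebesgue. norm (\<integral>z. norm (case_prod F (\<zeta>, z)) \<partial>lebesgue)
          \<le> norm (cmod (h1 \<zeta>) * (\<integral>z. u * cmod (\<psi> z) \<partial>lebesgue))"
        by (intro AE_I2) (simp add: abs_of_nonneg order_trans[OF _ abs_ge_self])
    qed
  qed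
  have T_eq: "(\<integral>z. F \<zeta> z \<partial>lebesgue) = h1 \<zeta> * T \<zeta>" for \<zeta>
    unfolding F_def T_def by (rule integral_mult_right_zero)
  show "integrable lebesgue (\<lambda>\<zeta>. h1 \<zeta> * T \<zeta>)"
    using lebesgue_pair.integrable_fst[OF F_int] by (simp only: T_eq)
  have "regularized u z * \<psi> z = (\<integral>\<zeta>. F \<zeta> z \<partial>lebesgue)" for z
  proof (cases "cmod z \<le> r")
    case True
    have z: "cmod z \<le> r1" "1 \<le> u * (r1 - cmod z)^2"
    proof -
      show "cmod z \<le> r1" using True \<open>r < r1\<close> by simp
      have "u * (r1 - r)^2 \<le> u * (r1 - cmod z)^2"
        using True assms(1,2) by (intro mult_left_mono power_mono) auto
      with assms(4) show "1 \<le> u * (r1 - cmod z)^2" by simp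
    qed
    have "h \<zeta> * mollifier u z \<zeta> = h1 \<zeta> * mollifier u z \<zeta>" for \<zeta>
      using bump_support[OF _ z, of \<zeta> 0] \<open>1 < u\<close> by (auto simp: h1_def mollifier_def indicator_def)
    hence "regularized u z = (\<integral>\<zeta>. h1 \<zeta> * mollifier u z \<zeta> \<partial>lebesgue)" by (simp only: regularized_def)
    thus ?thesis by (simp add: F_def mult.assoc[symmetric])
  qed (simp add: supp F_def)
  hence "(\<integral>z. regularized u z * \<psi> z \<partial>lebesgue) = (\<integral>z. \<integral>\<zeta>. F \<zeta> z \<partial>lebesgue \<partial>lebesgue)" by simp
  also have "\<dots> = (\<integral>\<zeta>. \<integral>z. F \<zeta> z \<partial>lebesgue \<partial>lebesgue)"
    by (rule lebesgue_pair.Fubini_integral[OF F_int])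
  finally show "(\<integral>z. regularized u z * \<psi> z \<partial>lebesgue) = (\<integral>\<zeta>. h1 \<zeta> * T \<zeta> \<partial>lebesgue)"
    by (simp only: T_eq)
qed

lemma representative_integrable:
  assumes "r < 1" "continuous_on UNIV \<psi>" "\<And>z. r < cmod z \<Longrightarrow> \<psi> z = 0"
  shows "integrable lebesgue (\<lambda>z. representative z * \<psi> z)"
  using assms holomorphic_on_imp_continuous_on[OF representative_holomorphic]
  by (intro integrable_disk_compact_support[of _ r] continuous_intros) (auto intro: continuous_on_subset)

lemma h_integrable:
  assumes "r < 1" "continuous_on UNIV \<psi>" "\<And>z. r < cmod z \<Longrightarrow> \<psi> z = 0"
  shows "integrable lebesgue (\<lambda>z. h z * \<psi> z)"
proof -
  have "compact (\<psi> ` cball 0 r)"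
    using assms(2) by (intro compact_continuous_image) (auto intro: continuous_on_subset)
  from compact_imp_bounded[OF this] obtain B where "\<forall>z\<in>cball 0 r. cmod (\<psi> z) \<le> B"
    by (auto simp: bounded_iff)
  hence B: "\<And>z. cmod z \<le> r \<Longrightarrow> cmod (\<psi> z) \<le> B" by simp
  show ?thesis
    using borel_measurable_continuous_onI[OF assms(2)]
    by (intro integrable_kernel(1)[OF assms(1) _ B assms(3)] measurable_completion) auto
qed

text \<open>
  Regularizing \<open>h\<close> or \<open>\<psi>\<close> gives the same pairing. The first is independent of the scale, and the
  second tends to the pairing of \<open>h\<close> with \<open>\<psi>\<close> because \<open>\<psi>\<close> is uniformly continuous.
\<close>

lemma pairing_eq:
  assumes "r < 1" and cont: "continuous_on UNIV \<psi>" and supp: "\<And>z. r < cmod z \<Longrightarrow> \<psi> z = 0"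
  shows "(\<integral>z. representative z * \<psi> z \<partial>lebesgue) = (\<integral>z. h z * \<psi> z \<partial>lebesgue)"
proof -
  define r1 where "r1 = (1 + r) / 2"
  have r1: "r < r1" "r1 < 1" using assms(1) by (auto simp: r1_def)
  define h1 where "h1 = (\<lambda>\<zeta>. indicator (cball 0 r1) \<zeta> * h \<zeta>)"
  define J where "J = (\<integral>\<zeta>. cmod (h1 \<zeta>) \<partial>lebesgue)"
  have J: "0 \<le> J" unfolding J_def by (intro integral_nonneg_AE) auto
  have h1: "integrable lebesgue h1" unfolding h1_def using r1(2) by (rule locally_integrable)
  let ?D = "(\<integral>z. representative z * \<psi> z \<partial>lebesgue) - (\<integral>z. h z * \<psi> z \<partial>lebesgue)"
  have bound: "mollifier_mass * cmod ?D \<le> J * (mollifier_mass * \<omega>)" if "0 < \<omega>" for \<omega>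
  proof -
    have "uniformly_continuous_on (cball 0 2) \<psi>"
      using cont by (intro compact_uniformly_continuous) (auto intro: continuous_on_subset)
    then obtain \<delta> where \<delta>: "0 < \<delta>"
      "\<And>z \<zeta>. z \<in> cball 0 2 \<Longrightarrow> \<zeta> \<in> cball 0 2 \<Longrightarrow> dist z \<zeta> < \<delta> \<Longrightarrow> dist (\<psi> z) (\<psi> \<zeta>) < \<omega>"
      unfolding uniformly_continuous_on_def using \<open>0 < \<omega>\<close> by metis
    \<comment> \<open>The bumps have radius \<open>m\<close>: small for the uniform continuity of \<open>\<psi>\<close>, and inside the disk of radius \<open>r1\<close>.\<close>
    define m where "m = min (\<delta> / 2) (min (1 / 2) (r1 - r))"
    define u where "u = 1 / m^2"
    have m: "0 < m" "m \<le> \<delta> / 2" "m \<le> 1 / 2" "m \<le> r1 - r"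
      using \<delta>(1) r1 unfolding m_def by (simp, intro min.coboundedI1 min.coboundedI2 order_refl,
        intro min.coboundedI2 min.coboundedI1 order_refl, intro min.coboundedI2 order_refl)
    have "m^2 \<le> (1 / 2)^2" using m by (intro power_mono) auto
    hence u: "1 < u" using m(1) by (simp add: u_def power2_eq_square field_simps)
    have sqrt_u: "1 / sqrt u = m" using m(1) by (simp add: u_def real_sqrt_divide)
    have ur: "1 \<le> u * (r1 - r)^2"
    proof -
      have "m^2 \<le> (r1 - r)^2" using m by (intro power_mono) auto
      thus ?thesis using m(1) by (simp add: u_def field_simps)
    qed
    define T where "T = (\<lambda>\<zeta>. \<integral>z. mollifier u z \<zeta> * \<psi> z \<partial>lebesgue)"
    have P: "integrable lebesgue (\<lambda>\<zeta>. h1 \<zeta> * T \<zeta>)"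
      "(\<integral>z. regularized u z * \<psi> z \<partial>lebesgue) = (\<integral>\<zeta>. h1 \<zeta> * T \<zeta> \<partial>lebesgue)"
      unfolding T_def h1_def by (rule regularized_pairing[OF u r1 ur cont supp]; assumption)+
    have reg: "regularized u z * \<psi> z = of_real mollifier_mass * (representative z * \<psi> z)" for z
    proof (cases "cmod z \<le> r")
      case True
      have "r1 - r < 1 - r" using r1 by simp
      hence "(r1 - r)^2 < (1 - cmod z)^2" using True r1 by (intro power_strict_mono) auto
      hence "u * (r1 - r)^2 < u * (1 - cmod z)^2" using u by simp
      with ur have "1 < u * (1 - cmod z)^2" by (rule order.strict_trans1)
      hence "regularized u z = of_real mollifier_mass * representative z"
        using True assms(1) u by (intro regularized_eq) auto
      thus ?thesis by simp
    qed (simp add: supp)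
    have "of_real mollifier_mass * (\<integral>z. representative z * \<psi> z \<partial>lebesgue) = (\<integral>\<zeta>. h1 \<zeta> * T \<zeta> \<partial>lebesgue)"
      using P(2) unfolding reg by simp
    moreover have h_eq: "h z * \<psi> z = h1 z * \<psi> z" for z
      using supp[of z] r1 by (auto simp: h1_def indicator_def)
    have "of_real mollifier_mass * (\<integral>z. h z * \<psi> z \<partial>lebesgue) = (\<integral>\<zeta>. of_real mollifier_mass * (h1 \<zeta> * \<psi> \<zeta>) \<partial>lebesgue)"
      by (simp only: h_eq integral_mult_right_zero)
    moreover have int\<psi>: "integrable lebesgue (\<lambda>\<zeta>. of_real mollifier_mass * (h1 \<zeta> * \<psi> \<zeta>))"
      using h_integrable[OF assms] by (intro integrable_mult_right) (simp only: h_eq)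
    ultimately have "of_real mollifier_mass * ?D = (\<integral>\<zeta>. h1 \<zeta> * T \<zeta> - of_real mollifier_mass * (h1 \<zeta> * \<psi> \<zeta>) \<partial>lebesgue)"
      using Bochner_Integration.integral_diff[OF P(1) int\<psi>] by (simp add: right_diff_distrib)
    hence "cmod (of_real mollifier_mass * ?D) \<le> (\<integral>\<zeta>. cmod (h1 \<zeta> * T \<zeta> - of_real mollifier_mass * (h1 \<zeta> * \<psi> \<zeta>)) \<partial>lebesgue)"
      by (simp only: integral_norm_bound)
    also have "\<dots> \<le> (\<integral>\<zeta>. cmod (h1 \<zeta>) * (mollifier_mass * \<omega>) \<partial>lebesgue)"
    proof (rule integral_mono)
      show "integrable lebesgue (\<lambda>\<zeta>. cmod (h1 \<zeta> * T \<zeta> - of_real mollifier_mass * (h1 \<zeta> * \<psi> \<zeta>)))"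
        by (intro integrable_norm Bochner_Integration.integrable_diff P(1) int\<psi>)
      show "integrable lebesgue (\<lambda>\<zeta>. cmod (h1 \<zeta>) * (mollifier_mass * \<omega>))"
        using h1 by (intro integrable_mult_left integrable_norm)
      fix \<zeta>
      show "cmod (h1 \<zeta> * T \<zeta> - of_real mollifier_mass * (h1 \<zeta> * \<psi> \<zeta>)) \<le> cmod (h1 \<zeta>) * (mollifier_mass * \<omega>)"
      proof (cases "cmod \<zeta> \<le> r1")
        case True
        have "cmod (T \<zeta> - of_real mollifier_mass * \<psi> \<zeta>) \<le> mollifier_mass * \<omega>"
          unfolding T_def
        proof (rule convolution_approximates[OF u cont supp])
          fix z assume z: "cmod (z - \<zeta>) \<le> 1 / sqrt u"
          have "cmod z \<le> cmod \<zeta> + cmod (z - \<zeta>)" using norm_triangle_sub by blast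
          hence "cmod z \<le> 2" using z True r1 m unfolding sqrt_u by linarith
          moreover have "dist z \<zeta> < \<delta>" using z m \<delta>(1) unfolding sqrt_u dist_norm by linarith
          moreover have "cmod \<zeta> \<le> 2" using True r1 by linarith
          ultimately show "cmod (\<psi> z - \<psi> \<zeta>) \<le> \<omega>"
            using \<delta>(2)[of z \<zeta>] by (simp add: dist_norm)
        qed (use \<open>0 < \<omega>\<close> in auto)
        hence "cmod (h1 \<zeta>) * cmod (T \<zeta> - of_real mollifier_mass * \<psi> \<zeta>) \<le> cmod (h1 \<zeta>) * (mollifier_mass * \<omega>)"
          by (intro mult_left_mono) auto
        moreover have "h1 \<zeta> * T \<zeta> - of_real mollifier_mass * (h1 \<zeta> * \<psi> \<zeta>) = h1 \<zeta> * (T \<zeta> - of_real mollifier_mass * \<psi> \<zeta>)"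
          by (simp add: algebra_simps)
        ultimately show ?thesis by (simp only: norm_mult)
      qed (simp add: h1_def)
    qed
    also have "\<dots> = J * (mollifier_mass * \<omega>)" by (simp add: J_def)
    finally show ?thesis using mollifier_mass_pos by (simp add: norm_mult)
  qed
  have "cmod ?D \<le> 0"
  proof (rule field_le_epsilon)
    fix e :: real assume "0 < e"
    define \<omega> where "\<omega> = e / (J + 1)"
    have "0 < \<omega>" using \<open>0 < e\<close> J by (simp add: \<omega>_def)
    have "mollifier_mass * cmod ?D \<le> mollifier_mass * (J * \<omega>)" using bound[OF \<open>0 < \<omega>\<close>] by (simp add: mult_ac)
    hence "cmod ?D \<le> J * \<omega>" using mollifier_mass_pos by simp
    also have "\<dots> \<le> (J + 1) * \<omega>" using \<open>0 < \<omega>\<close> by simp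
    also have "\<dots> = e" using J by (simp add: \<omega>_def)
    finally show "cmod ?D \<le> 0 + e" by simp
  qed
  thus ?thesis by simp
qed

lemma integrable_difference:
  assumes "r < 1"
  shows "integrable lebesgue (\<lambda>z. indicator (cball 0 r) z *\<^sub>R (representative z - h z))"
proof -
  have cont: "continuous_on (cball 0 r) representative"
    using holomorphic_on_imp_continuous_on[OF representative_holomorphic] assms
    by (auto intro: continuous_on_subset)
  have 1: "integrable lborel (\<lambda>z. indicator (cball 0 r) z *\<^sub>R representative z)"
    by (intro borel_integrable_compact cont) auto
  hence "integrable lebesgue (\<lambda>z. indicator (cball 0 r) z *\<^sub>R representative z)"
    by (subst integrable_completion) auto
  from Bochner_Integration.integrable_diff[OF this locally_integrable[OF assms]] show ?thesis
    by (rule Bochner_Integration.integrable_cong[THEN iffD1, rotated -1]) (auto simp: indicator_def)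
qed

text \<open>
  The indicator of a closed set is the decreasing limit of the continuous functions
  \<open>max 0 (1 - n dist(z, K))\<close>.
\<close>

lemma integral_closed_difference:
  assumes K: "closed K" "K \<subseteq> cball 0 r" and "r < 1"
  shows "(\<integral>z. indicator K z *\<^sub>R (representative z - h z) \<partial>lebesgue) = 0"
proof (cases "K = {}")
  case False
  define r1 where "r1 = (1 + r) / 2"
  have r1: "r < r1" "r1 < 1" using \<open>r < 1\<close> by (auto simp: r1_def)
  define g where "g = (\<lambda>z. indicator (cball 0 r1) z *\<^sub>R (representative z - h z))"
  have g: "integrable lebesgue g" unfolding g_def by (rule integrable_difference[OF r1(2)])
  obtain N :: nat where "1 / (r1 - r) \<le> real N" using real_arch_simple by blast
  hence N: "1 \<le> real N * (r1 - r)" using r1 by (simp add: field_simps)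
  define \<psi> where "\<psi> = (\<lambda>n z. complex_of_real (max 0 (1 - real (n + N) * infdist z K)))"
  have \<psi>_cont: "continuous_on UNIV (\<psi> n)" for n
    unfolding \<psi>_def by (intro continuous_intros)
  have \<psi>_supp: "\<psi> n z = 0" if z: "r1 < cmod z" for n z
  proof -
    obtain x where x: "x \<in> K" "infdist z K = dist z x"
      using infdist_attains_inf[OF K(1) False] by blast
    have "r1 - r \<le> cmod z - cmod x" using z x(1) K(2) by auto
    also have "\<dots> \<le> dist z x" unfolding dist_norm by (rule norm_triangle_ineq2)
    finally have "r1 - r \<le> infdist z K" using x by simp
    hence "real N * (r1 - r) \<le> real (n + N) * infdist z K"
      using r1 by (intro mult_mono) auto
    with N show ?thesis by (simp add: \<psi>_def)
  qed
  have \<psi>_le: "cmod (\<psi> n z) \<le> 1" for n z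
    using infdist_nonneg[of z K] by (simp add: \<psi>_def)
  have zero: "(\<integral>z. \<psi> n z * g z \<partial>lebesgue) = 0" for n
  proof -
    have "\<psi> n z * g z = representative z * \<psi> n z - h z * \<psi> n z" for z
      using \<psi>_supp[of z n] by (auto simp: g_def indicator_def algebra_simps)
    moreover have "(\<integral>z. representative z * \<psi> n z - h z * \<psi> n z \<partial>lebesgue) = 0"
      using representative_integrable[OF r1(2) \<psi>_cont \<psi>_supp] h_integrable[OF r1(2) \<psi>_cont \<psi>_supp]
        pairing_eq[OF r1(2) \<psi>_cont \<psi>_supp] by simp
    ultimately show ?thesis by simp
  qed
  have "(\<lambda>n. \<integral>z. \<psi> n z * g z \<partial>lebesgue) \<longlonglongrightarrow> (\<integral>z. indicator K z *\<^sub>R (representative z - h z) \<partial>lebesgue)"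
  proof (rule integral_dominated_convergence[where w = "\<lambda>z. cmod (g z)"])
    have KL: "K \<in> sets lebesgue" using K(1) by simp
    have "(\<lambda>z. indicator K z *\<^sub>R g z) \<in> borel_measurable lebesgue"
      using g KL by (intro borel_measurable_scaleR borel_measurable_indicator) auto
    moreover have "(\<lambda>z. indicator K z *\<^sub>R g z) = (\<lambda>z. indicator K z *\<^sub>R (representative z - h z))"
      using K(2) r1 by (auto simp: g_def indicator_def fun_eq_iff)
    ultimately show "(\<lambda>z. indicator K z *\<^sub>R (representative z - h z)) \<in> borel_measurable lebesgue" by simp
    show "(\<lambda>z. \<psi> n z * g z) \<in> borel_measurable lebesgue" for n
      using borel_measurable_continuous_onI[OF \<psi>_cont[of n]]
      by (intro borel_measurable_times borel_measurable_integrable[OF g] measurable_completion) simp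
    show "AE z in lebesgue. (\<lambda>n. \<psi> n z * g z) \<longlonglongrightarrow> indicator K z *\<^sub>R (representative z - h z)"
    proof (rule AE_I2)
      fix z
      have "(\<lambda>n. \<psi> n z) \<longlonglongrightarrow> indicator K z"
      proof (cases "z \<in> K")
        case True
        thus ?thesis by (simp add: \<psi>_def)
      next
        case z: False
        hence d: "0 < infdist z K"
          using in_closed_iff_infdist_zero[OF K(1) False] infdist_nonneg[of z K] by (auto simp: less_le)
        obtain M :: nat where "1 / infdist z K \<le> real M" using real_arch_simple by blast
        hence "\<forall>\<^sub>F n in sequentially. 1 / infdist z K \<le> real n"
          by (intro eventually_sequentiallyI[of M]) (erule order_trans, simp)
        hence "\<forall>\<^sub>F n in sequentially. \<psi> n z = 0"
        proof eventually_elim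
          case (elim n)
          hence "1 \<le> real n * infdist z K" using d by (simp add: field_simps)
          also have "\<dots> \<le> real (n + N) * infdist z K" using d by (intro mult_right_mono) auto
          finally show ?case by (simp add: \<psi>_def)
        qed
        thus ?thesis using z by (simp add: tendsto_eventually)
      qed
      hence "(\<lambda>n. \<psi> n z * g z) \<longlonglongrightarrow> indicator K z * g z" by (intro tendsto_intros)
      moreover have "indicator K z * g z = indicator K z *\<^sub>R (representative z - h z)"
        using K(2) r1 by (auto simp: g_def indicator_def)
      ultimately show "(\<lambda>n. \<psi> n z * g z) \<longlonglongrightarrow> indicator K z *\<^sub>R (representative z - h z)" by simp
    qed
    show "AE z in lebesgue. norm (\<psi> n z * g z) \<le> cmod (g z)" for n
      using \<psi>_le by (intro AE_I2) (simp add: norm_mult mult_left_le_one_le)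
  qed (use g in auto)
  thus ?thesis by (simp add: zero LIMSEQ_const_iff)
qed simp

text \<open>
  Every Lebesgue set is an increasing union of closed sets up to a null set, so the difference of \<open>h\<close>
  and its representative has integral \<open>0\<close> over every measurable subset.
\<close>

lemma AE_eq_representative_cball:
  assumes "r < 1"
  shows "AE z in lebesgue. z \<in> cball 0 r \<longrightarrow> h z = representative z"
proof -
  define g where "g = (\<lambda>z. indicator (cball 0 r) z *\<^sub>R (representative z - h z))"
  have g: "integrable lebesgue g" unfolding g_def by (rule integrable_difference[OF assms])
  have "AE z in lebesgue. g z = 0"
  proof (rule sigma_finite_measure.density_zero[OF sigma_finite_lebesgue g])
    fix A :: "complex set" assume A: "A \<in> sets lebesgue"
    have "A \<inter> cball 0 r \<in> sets lebesgue" using A by auto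
    then obtain C T where C: "fsigma C" "T \<in> null_sets lebesgue" "C \<union> T = A \<inter> cball 0 r"
      by (rule lebesgue_set_almost_fsigma)
    obtain F :: "nat \<Rightarrow> complex set" where F: "\<And>n. closed (F n)" "C = (\<Union>n. F n)"
      using C(1) by (elim fsigma.cases) blast
    define K where "K = (\<lambda>n. \<Union>i\<le>n. F i)"
    have K: "closed (K n)" "K n \<subseteq> cball 0 r" "K n \<in> sets lebesgue" for n
    proof -
      show "closed (K n)" unfolding K_def using F(1) by (intro closed_UN) auto
      thus "K n \<in> sets lebesgue" by simp
      show "K n \<subseteq> cball 0 r" using C(3) F(2) by (auto simp: K_def)
    qed
    have UK: "(\<Union>n. K n) = C" using F(2) by (auto simp: K_def)
    have CL: "C \<in> sets lebesgue" using K(3) unfolding UK[symmetric] by auto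
    have "(\<lambda>n. set_lebesgue_integral lebesgue (K n) g) \<longlonglongrightarrow> set_lebesgue_integral lebesgue (\<Union>n. K n) g"
    proof (rule set_integral_cont_up)
      show "incseq K" unfolding K_def by (intro incseq_SucI) (auto simp: atMost_Suc)
      show "set_integrable lebesgue (\<Union>n. K n) g"
        unfolding UK set_integrable_def using CL g by (rule integrable_mult_indicator)
    qed (rule K(3))
    moreover have "set_lebesgue_integral lebesgue (K n) g = 0" for n
    proof -
      have eq: "indicator (K n) z *\<^sub>R g z = indicator (K n) z *\<^sub>R (representative z - h z)" for z
        using K(2)[of n] by (auto simp: g_def indicator_def)
      show ?thesis
        unfolding set_lebesgue_integral_def eq by (rule integral_closed_difference[OF K(1,2) assms])
    qed
    ultimately have "set_lebesgue_integral lebesgue C g = 0" by (simp add: UK LIMSEQ_const_iff)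
    moreover have "set_lebesgue_integral lebesgue A g = set_lebesgue_integral lebesgue C g"
      unfolding set_lebesgue_integral_def
    proof (rule integral_cong_AE)
      show "AE z in lebesgue. indicator A z *\<^sub>R g z = indicator C z *\<^sub>R g z"
        using AE_not_in[OF C(2)]
      proof eventually_elim
        case (elim z)
        hence "z \<in> A \<inter> cball 0 r \<longleftrightarrow> z \<in> C" using C(3) by blast
        thus ?case by (auto simp: g_def indicator_def)
      qed
    qed (use g A CL in \<open>auto intro!: borel_measurable_scaleR borel_measurable_indicator\<close>)
    ultimately show "set_lebesgue_integral lebesgue A g = 0" by simp
  qed
  thus ?thesis by eventually_elim (auto simp: g_def indicator_def)
qed

text \<open>
  Weyl's lemma for \<open>\<partial>bar\<close>.
\<close>

theorem AE_eq_representative: "AE z in disk. h z = representative z"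
proof -
  have "AE z in lebesgue. \<forall>n. z \<in> cball 0 (1 - inverse (real (Suc n))) \<longrightarrow> h z = representative z"
    by (subst AE_all_countable) (intro allI AE_eq_representative_cball, simp)
  hence "AE z in lebesgue. z \<in> ball 0 1 \<longrightarrow> h z = representative z"
  proof eventually_elim
    case (elim z)
    show ?case
    proof
      assume "z \<in> ball 0 1"
      then obtain n where "inverse (real (Suc n)) < 1 - cmod z"
        using reals_Archimedean[of "1 - cmod z"] by auto
      hence "z \<in> cball 0 (1 - inverse (real (Suc n)))" by simp
      with elim show "h z = representative z" by blast
    qed
  qed
  hence "AE z in disk. z \<in> ball 0 1 \<longrightarrow> h z = representative z"
    by (subst AE_restrict_space_iff) (auto elim: eventually_mono)
  with AE_disk_interior show ?thesis by eventually_elim simp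
qed

end

section \<open>The weighted Sobolev space\<close>

lemma test_function_lincomb:
  assumes "\<phi> \<in> test_functions" "\<psi> \<in> test_functions"
  shows "(\<lambda>z. a * \<phi> z + b * \<psi> z) \<in> test_functions"
    and "pdx (\<lambda>z. a * \<phi> z + b * \<psi> z) = (\<lambda>z. a * pdx \<phi> z + b * pdx \<psi> z)"
    and "pdy (\<lambda>z. a * \<phi> z + b * \<psi> z) = (\<lambda>z. a * pdy \<phi> z + b * pdy \<psi> z)"
    and "del (\<lambda>z. a * \<phi> z + b * \<psi> z) = (\<lambda>z. a * del \<phi> z + b * del \<psi> z)"
proof -
  have C: "C_k k \<phi>" "C_k k \<psi>" for k using assms by (auto simp: test_functions_def)
  have "disk_C0 (\<lambda>z. a * \<phi> z + b * \<psi> z)" by (intro disk_C0_lincomb test_function_C0 assms)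
  then obtain r where "r < 1" "\<And>z. r < cmod z \<Longrightarrow> a * \<phi> z + b * \<psi> z = 0"
    by (auto simp: disk_C0_def)
  thus "(\<lambda>z. a * \<phi> z + b * \<psi> z) \<in> test_functions"
    by (intro test_functionI[of _ r] C_k_add C_k_mult C_k_const C)
  have diff: "\<phi> differentiable (at z)" "\<psi> differentiable (at z)" for z
    using test_function_imp_C1(1) assms disk_C1_differentiable by blast+
  have "dd c (\<lambda>z. a * \<phi> z + b * \<psi> z) = (\<lambda>z. a * dd c \<phi> z + b * dd c \<psi> z)" for c
  proof
    fix z
    have "dd c (\<lambda>z. a * \<phi> z + b * \<psi> z) z = dd c (\<lambda>z. a * \<phi> z) z + dd c (\<lambda>z. b * \<psi> z) z"
      by (intro dd_add differentiable_mult differentiable_const diff)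
    thus "dd c (\<lambda>z. a * \<phi> z + b * \<psi> z) z = a * dd c \<phi> z + b * dd c \<psi> z"
      by (simp add: dd_cmult diff)
  qed
  thus d: "pdx (\<lambda>z. a * \<phi> z + b * \<psi> z) = (\<lambda>z. a * pdx \<phi> z + b * pdx \<psi> z)"
    "pdy (\<lambda>z. a * \<phi> z + b * \<psi> z) = (\<lambda>z. a * pdy \<phi> z + b * pdy \<psi> z)"
    by (simp_all add: pdx_eq_dd pdy_eq_dd)
  show "del (\<lambda>z. a * \<phi> z + b * \<psi> z) = (\<lambda>z. a * del \<phi> z + b * del \<psi> z)"
    unfolding wirtinger_def d by (auto simp: fun_eq_iff field_simps)
qed

lemma test_function_diff:
  assumes "\<phi> \<in> test_functions" "\<psi> \<in> test_functions"
  shows "(\<lambda>z. \<phi> z - \<psi> z) \<in> test_functions"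
    and "pdx (\<lambda>z. \<phi> z - \<psi> z) = (\<lambda>z. pdx \<phi> z - pdx \<psi> z)"
    and "pdy (\<lambda>z. \<phi> z - \<psi> z) = (\<lambda>z. pdy \<phi> z - pdy \<psi> z)"
    and "del (\<lambda>z. \<phi> z - \<psi> z) = (\<lambda>z. del \<phi> z - del \<psi> z)"
  using test_function_lincomb[OF assms, of 1 "-1"] by simp_all

lemma test_function_cnj:
  assumes "\<phi> \<in> test_functions"
  shows "(\<lambda>z. cnj (\<phi> z)) \<in> test_functions"
    and "pdx (\<lambda>z. cnj (\<phi> z)) = (\<lambda>z. cnj (pdx \<phi> z))"
    and "pdy (\<lambda>z. cnj (\<phi> z)) = (\<lambda>z. cnj (pdy \<phi> z))"
    and "del (\<lambda>z. cnj (\<phi> z)) = (\<lambda>z. cnj (delbar \<phi> z))"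
proof -
  have "{z. cnj (\<phi> z) \<noteq> 0} = {z. \<phi> z \<noteq> 0}" by simp
  thus "(\<lambda>z. cnj (\<phi> z)) \<in> test_functions"
    using assms by (auto simp: test_functions_def C_k_cnj)
  have diff: "\<phi> differentiable (at z)" for z
    using test_function_imp_C1(1) assms disk_C1_differentiable by blast
  show d: "pdx (\<lambda>z. cnj (\<phi> z)) = (\<lambda>z. cnj (pdx \<phi> z))" "pdy (\<lambda>z. cnj (\<phi> z)) = (\<lambda>z. cnj (pdy \<phi> z))"
    by (auto simp: pdx_eq_dd pdy_eq_dd dd_cnj diff)
  show "del (\<lambda>z. cnj (\<phi> z)) = (\<lambda>z. cnj (delbar \<phi> z))"
    unfolding wirtinger_def wirtinger_bar_def d by auto
qed

lemma sqnorm_tendsto: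
  assumes "\<And>n. u n \<in> L2 s" "f \<in> L2 s" "L2_lim s u f"
  shows "(\<lambda>n. sqnorm s (u n)) \<longlonglongrightarrow> sqnorm s f"
proof -
  have ff: "Re (L2_inner s f f) = sqnorm s f"
  proof -
    have "L2_inner s f f = of_real (sqnorm s f)"
      unfolding L2_inner_def sqnorm_def integral_complex_of_real[symmetric] complex_norm_square by simp
    thus ?thesis by simp
  qed
  have "(\<lambda>n. sqnorm s (\<lambda>z. u n z - f z) + 2 * Re (L2_inner s (u n) f) - sqnorm s f)
      \<longlonglongrightarrow> 0 + 2 * Re (L2_inner s f f) - sqnorm s f"
    by (intro tendsto_intros assms(3) L2_inner_tendsto[OF assms(1,2,2,3)])
  thus ?thesis using sqnorm_diff[OF assms(1) assms(2)] by (simp add: ff)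
qed

lemma L2_limit_unique:
  assumes "\<And>n. u n \<in> L2 s" "f \<in> L2 s" "g \<in> L2 s"
    "L2_lim s u f" "L2_lim s u g"
  shows "AE z in disk. f z = g z"
proof -
  have "sqnorm s (\<lambda>z. f z - g z) \<le> 2 * sqnorm s (\<lambda>z. u n z - f z) + 2 * sqnorm s (\<lambda>z. u n z - g z)" for n
    using sqnorm_triangle_le[OF assms(2) assms(1)[of n] assms(3)] by (simp add: sqnorm_diff_commute[of s f])
  moreover have "(\<lambda>n. 2 * sqnorm s (\<lambda>z. u n z - f z) + 2 * sqnorm s (\<lambda>z. u n z - g z)) \<longlonglongrightarrow> 2 * 0 + 2 * 0"
    by (intro tendsto_intros assms)
  ultimately have "sqnorm s (\<lambda>z. f z - g z) \<le> 0"
    by (intro LIMSEQ_le_const[of _ 0]) auto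
  hence "sqnorm s (\<lambda>z. f z - g z) = 0" by (simp add: order_antisym)
  thus ?thesis using sqnorm_eq_0_iff[OF L2_diff[OF assms(2,3)]] by simp
qed

lemma L2_norm_tendsto_0_iff:
  "(\<lambda>n. L2_norm s (u n)) \<longlonglongrightarrow> 0 \<longleftrightarrow> (\<lambda>n. sqnorm s (u n)) \<longlonglongrightarrow> 0"
proof
  assume "(\<lambda>n. L2_norm s (u n)) \<longlonglongrightarrow> 0"
  hence "(\<lambda>n. (L2_norm s (u n))^2) \<longlonglongrightarrow> 0^2" by (intro tendsto_intros)
  thus "(\<lambda>n. sqnorm s (u n)) \<longlonglongrightarrow> 0" by simp
next
  assume "(\<lambda>n. sqnorm s (u n)) \<longlonglongrightarrow> 0"
  hence "(\<lambda>n. sqrt (sqnorm s (u n))) \<longlonglongrightarrow> sqrt 0" by (intro tendsto_intros)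
  thus "(\<lambda>n. L2_norm s (u n)) \<longlonglongrightarrow> 0" by (simp add: L2_norm_eq)
qed

lemma wirtinger_L2:
  assumes "vx \<in> L2 s" "vy \<in> L2 s"
  shows "wirtinger vx vy \<in> L2 s"
    and "ux \<in> L2 s \<Longrightarrow> uy \<in> L2 s \<Longrightarrow>
      sqnorm s (\<lambda>z. wirtinger ux uy z - wirtinger vx vy z)
        \<le> sqnorm s (\<lambda>z. ux z - vx z) + sqnorm s (\<lambda>z. uy z - vy z)"
proof -
  have eq: "wirtinger ux uy = (\<lambda>z. (1 / 2) * ux z + (- \<i> / 2) * uy z)" for ux uy
    by (auto simp: wirtinger_def fun_eq_iff field_simps)
  show "wirtinger vx vy \<in> L2 s"
    unfolding eq using assms by (intro L2_add L2_cmult)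
  assume u: "ux \<in> L2 s" "uy \<in> L2 s"
  have "(\<lambda>z. wirtinger ux uy z - wirtinger vx vy z)
      = (\<lambda>z. (1 / 2) * (ux z - vx z) + (- \<i> / 2) * (uy z - vy z))"
    by (simp add: eq fun_eq_iff algebra_simps diff_divide_distrib add_divide_distrib)
  hence "sqnorm s (\<lambda>z. wirtinger ux uy z - wirtinger vx vy z)
      \<le> 2 * sqnorm s (\<lambda>z. (1 / 2) * (ux z - vx z)) + 2 * sqnorm s (\<lambda>z. (- \<i> / 2) * (uy z - vy z))"
    using sqnorm_add_le[OF L2_cmult[OF L2_diff[OF u(1) assms(1)]] L2_cmult[OF L2_diff[OF u(2) assms(2)]],
        of "1 / 2" "- \<i> / 2"] by simp
  also have "\<dots> = (sqnorm s (\<lambda>z. ux z - vx z) + sqnorm s (\<lambda>z. uy z - vy z)) / 2"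
    unfolding sqnorm_cmult by (simp add: norm_divide power2_eq_square)
  also have "\<dots> \<le> sqnorm s (\<lambda>z. ux z - vx z) + sqnorm s (\<lambda>z. uy z - vy z)"
    by simp
  finally show "sqnorm s (\<lambda>z. wirtinger ux uy z - wirtinger vx vy z)
        \<le> sqnorm s (\<lambda>z. ux z - vx z) + sqnorm s (\<lambda>z. uy z - vy z)" .
qed

lemma sqnorm_tendsto_0_le:
  assumes "\<And>n. sqnorm s (u n) \<le> b n" "b \<longlonglongrightarrow> 0"
  shows "(\<lambda>n. sqnorm s (u n)) \<longlonglongrightarrow> 0"
proof (rule tendsto_sandwich[OF _ _ tendsto_const assms(2)])
  show "\<forall>\<^sub>F n in sequentially. 0 \<le> sqnorm s (u n)" by simp
  show "\<forall>\<^sub>F n in sequentially. sqnorm s (u n) \<le> b n" using assms(1) by simp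
qed

text \<open>
  Convergence of test functions in the completion, together with the consequence for \<open>\<partial>\<close>.
\<close>

definition H10_lim ::
    "real \<Rightarrow> (nat \<Rightarrow> complex \<Rightarrow> complex) \<Rightarrow> (complex \<Rightarrow> complex) \<Rightarrow> (complex \<Rightarrow> complex) \<Rightarrow> (complex \<Rightarrow> complex) \<Rightarrow> bool"
  where "H10_lim s \<phi> v vx vy \<longleftrightarrow> L2_lim s \<phi> v \<and> L2_lim s (\<lambda>n. pdx (\<phi> n)) vx \<and> L2_lim s (\<lambda>n. pdy (\<phi> n)) vy
    \<and> L2_lim s (\<lambda>n. del (\<phi> n)) (wirtinger vx vy)"

lemma H10_limD:
  assumes "H10_lim s \<phi> v vx vy"
  shows "L2_lim s \<phi> v" "L2_lim s (\<lambda>n. pdx (\<phi> n)) vx" "L2_lim s (\<lambda>n. pdy (\<phi> n)) vy"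
    "L2_lim s (\<lambda>n. del (\<phi> n)) (wirtinger vx vy)"
  using assms by (simp_all add: H10_lim_def)

lemma H10_approx:
  assumes "H10 s v vx vy"
  shows "\<exists>\<phi>. (\<forall>n. \<phi> n \<in> test_functions) \<and> H10_lim s \<phi> v vx vy"
proof -
  obtain \<phi> where \<phi>: "\<And>n. \<phi> n \<in> test_functions"
    and lim: "L2_lim s \<phi> v"
    "L2_lim s (\<lambda>n. pdx (\<phi> n)) vx"
    "L2_lim s (\<lambda>n. pdy (\<phi> n)) vy"
    using assms unfolding H10_def L2_norm_tendsto_0_iff by blast
  have L: "vx \<in> L2 s" "vy \<in> L2 s" using assms by (auto simp: H10_def)
  have "(\<lambda>n. sqnorm s (\<lambda>z. pdx (\<phi> n) z - vx z) + sqnorm s (\<lambda>z. pdy (\<phi> n) z - vy z)) \<longlonglongrightarrow> 0 + 0"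
    by (intro tendsto_intros lim)
  hence "(\<lambda>n. sqnorm s (\<lambda>z. pdx (\<phi> n) z - vx z) + sqnorm s (\<lambda>z. pdy (\<phi> n) z - vy z)) \<longlonglongrightarrow> 0" by simp
  hence "L2_lim s (\<lambda>n. del (\<phi> n)) (wirtinger vx vy)"
    by (rule sqnorm_tendsto_0_le[OF wirtinger_L2(2)[OF L test_function_L2(2,3)[OF \<phi>]]])
  with \<phi> lim show ?thesis unfolding H10_lim_def by blast
qed

lemma H10_diff:
  assumes "H10 s v vx vy" "H10 s w wx wy"
  shows "H10 s (\<lambda>z. v z - w z) (\<lambda>z. vx z - wx z) (\<lambda>z. vy z - wy z)"
proof -
  have L: "v \<in> L2 s" "vx \<in> L2 s" "vy \<in> L2 s" "w \<in> L2 s" "wx \<in> L2 s" "wy \<in> L2 s"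
    using assms by (auto simp: H10_def)
  obtain \<phi> where \<phi>: "\<And>n. \<phi> n \<in> test_functions" and \<phi>_lim: "H10_lim s \<phi> v vx vy"
    using H10_approx[OF assms(1)] by blast
  note \<phi> = \<phi> H10_limD[OF \<phi>_lim]
  obtain \<psi> where \<psi>: "\<And>n. \<psi> n \<in> test_functions" and \<psi>_lim: "H10_lim s \<psi> w wx wy"
    using H10_approx[OF assms(2)] by blast
  note \<psi> = \<psi> H10_limD[OF \<psi>_lim]
  have lim: "(\<lambda>n. sqnorm s (\<lambda>z. a n z - b n z - (f z - g z))) \<longlonglongrightarrow> 0"
    if "\<And>n. a n \<in> L2 s" "\<And>n. b n \<in> L2 s" "f \<in> L2 s" "g \<in> L2 s"
      "L2_lim s a f" "L2_lim s b g"
    for a b :: "nat \<Rightarrow> complex \<Rightarrow> complex" and f g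
  proof (rule sqnorm_tendsto_0_le)
    have "(\<lambda>n. 2 * sqnorm s (\<lambda>z. a n z - f z) + 2 * sqnorm s (\<lambda>z. b n z - g z)) \<longlonglongrightarrow> 2 * 0 + 2 * 0"
      by (intro tendsto_intros that)
    thus "(\<lambda>n. 2 * sqnorm s (\<lambda>z. a n z - f z) + 2 * sqnorm s (\<lambda>z. b n z - g z)) \<longlonglongrightarrow> 0" by simp
    show "sqnorm s (\<lambda>z. a n z - b n z - (f z - g z)) \<le>
       2 * sqnorm s (\<lambda>z. a n z - f z) + 2 * sqnorm s (\<lambda>z. b n z - g z)" for n
    proof -
      have "(\<lambda>z. a n z - b n z - (f z - g z)) = (\<lambda>z. (a n z - f z) + (g z - b n z))" by auto
      thus ?thesis
        using sqnorm_add_le[OF L2_diff[OF that(1,3)] L2_diff[OF that(4,2)], of n n]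
        by (simp add: sqnorm_diff_commute[of s g])
    qed
  qed
  show ?thesis
    unfolding H10_def L2_norm_tendsto_0_iff
  proof (intro conjI L2_diff L exI[of _ "\<lambda>n z. \<phi> n z - \<psi> n z"] allI)
    show "(\<lambda>z. \<phi> n z - \<psi> n z) \<in> test_functions" for n by (intro test_function_diff \<phi> \<psi>)
  qed (unfold test_function_diff[OF \<phi>(1) \<psi>(1)], (intro lim test_function_L2 \<phi> \<psi> L)+)
qed

text \<open>
  The a priori estimate passes to the completion by continuity of the norms.
\<close>

lemma H10_estimate:
  assumes "s < 1"
  shows "\<exists>C\<ge>0. \<forall>v vx vy. H10 s v vx vy \<longrightarrow> (H10_norm s v vx vy)^2 \<le> C * sqnorm s (wirtinger vx vy)"
proof -
  obtain C where C: "0 \<le> C"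
    "\<And>\<phi>. \<phi> \<in> test_functions \<Longrightarrow> (H10_norm s \<phi> (pdx \<phi>) (pdy \<phi>))^2 \<le> C * sqnorm s (del \<phi>)"
    using test_function_estimate[OF assms] by blast
  have "(H10_norm s v vx vy)^2 \<le> C * sqnorm s (wirtinger vx vy)" if H: "H10 s v vx vy" for v vx vy
  proof -
    have L: "v \<in> L2 s" "vx \<in> L2 s" "vy \<in> L2 s" using H by (auto simp: H10_def)
    obtain \<phi> where \<phi>: "\<And>n. \<phi> n \<in> test_functions" and lim: "H10_lim s \<phi> v vx vy"
      using H10_approx[OF H] by blast
    note lim = H10_limD[OF lim] and T = test_function_L2[OF \<phi>]
    show ?thesis
    proof (rule LIMSEQ_le)
      show "(\<lambda>n. (H10_norm s (\<phi> n) (pdx (\<phi> n)) (pdy (\<phi> n)))^2) \<longlonglongrightarrow> (H10_norm s v vx vy)^2"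
        unfolding H10_norm_power2 by (intro tendsto_add sqnorm_tendsto T L lim)
      show "(\<lambda>n. C * sqnorm s (del (\<phi> n))) \<longlonglongrightarrow> C * sqnorm s (wirtinger vx vy)"
        by (intro tendsto_intros sqnorm_tendsto T wirtinger_L2 L lim)
    qed (use C(2)[OF \<phi>] in auto)
  qed
  with C(1) show ?thesis by blast
qed

section \<open>The orthogonal decomposition\<close>

text \<open>
  On a smaller disk the weight is bounded below, and \<open>|f| \<le> 1 + |f|^2\<close>.
\<close>

lemma L2_locally_integrable:
  assumes "f \<in> L2 s" "r < 1"
  shows "integrable lebesgue (\<lambda>z. indicator (cball 0 r) z * f z)"
proof (cases "0 \<le> r")
  case True
  define m where "m = min 1 ((1 - r^2) powr s)"
  have r2: "r^2 < 1" using True assms(2) by (simp add: abs_square_less_1)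
  have m: "0 < m" using r2 by (simp add: m_def)
  have f [measurable]: "f \<in> borel_measurable disk" using L2_D(1)[OF assms(1)] .
  have f2: "(\<lambda>z. (cmod (f z))^2) \<in> borel_measurable disk" by measurable
  have m_le: "m \<le> disk_defect z powr s" if "cmod z \<le> r" for z
  proof -
    have "(cmod z)^2 \<le> r^2" using that by (intro power_mono) auto
    hence d: "1 - r^2 \<le> disk_defect z" "disk_defect z \<le> 1" "0 < disk_defect z"
      using r2 by (auto simp: disk_defect_def)
    show ?thesis
    proof (cases "0 \<le> s")
      case True
      have "m \<le> (1 - r^2) powr s" by (simp add: m_def)
      also have "\<dots> \<le> disk_defect z powr s" using d r2 True by (intro powr_mono2) auto
      finally show ?thesis .
    next
      case False
      have "m \<le> 1 powr s" by (simp add: m_def)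
      also have "\<dots> \<le> disk_defect z powr s" using d False by (intro powr_mono2') auto
      finally show ?thesis .
    qed
  qed
  have "integrable disk (\<lambda>z. indicator (cball 0 r) z * f z)"
  proof (rule Bochner_Integration.integrable_bound)
    have "integrable disk (\<lambda>z. disk_defect z powr s *\<^sub>R (cmod (f z))^2)"
      using L2_D(2)[OF assms(1)] integrable_disk_measure[OF f2] by simp
    hence "integrable disk (\<lambda>z. disk_defect z powr s * (cmod (f z))^2 / m)" by simp
    moreover have "integrable disk (\<lambda>_. 1 :: real)"
      by (intro finite_measure.integrable_const finite_measure_lebesgue_on) simp
    ultimately show "integrable disk (\<lambda>z. 1 + disk_defect z powr s * (cmod (f z))^2 / m)"
      by (intro Bochner_Integration.integrable_add)
    have "cball (0 :: complex) r \<subseteq> cball 0 1" using assms(2) by auto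
    hence "cball (0 :: complex) r \<in> sets disk"
      by (auto simp: sets_restrict_space_iff)
    thus "(\<lambda>z. indicator (cball 0 r) z * f z) \<in> borel_measurable disk" by measurable
    have "cmod (indicator (cball 0 r) z * f z) \<le> 1 + disk_defect z powr s * (cmod (f z))^2 / m" for z
    proof (cases "cmod z \<le> r")
      case True
      have "m * (cmod (f z))^2 \<le> disk_defect z powr s * (cmod (f z))^2"
        by (intro mult_right_mono m_le True) simp
      hence "(cmod (f z))^2 \<le> disk_defect z powr s * (cmod (f z))^2 / m"
        using m by (simp add: field_simps)
      moreover have "2 * cmod (f z) \<le> (cmod (f z))^2 + 1"
        using sum_squares_bound[of "cmod (f z)" 1] by simp
      hence "cmod (f z) \<le> 1 + (cmod (f z))^2"
        using norm_ge_zero[of "f z"] by linarith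
      ultimately show ?thesis using True by simp
    qed (use m in \<open>simp add: add_nonneg_nonneg\<close>)
    thus "AE z in disk. norm (indicator (cball 0 r) z * f z) \<le> norm (1 + disk_defect z powr s * (cmod (f z))^2 / m)"
      by (intro AE_I2) (metis abs_ge_self order_trans real_norm_def)
  qed
  hence "integrable lebesgue (\<lambda>z. indicator (cball 0 1) z *\<^sub>R (indicator (cball 0 r) z * f z))"
    by (subst (asm) integrable_restrict_space) auto
  moreover have "indicator (cball 0 1) z *\<^sub>R (indicator (cball 0 r) z * f z) = indicator (cball 0 r) z * f z" for z
    using assms(2) by (auto simp: indicator_def)
  ultimately show ?thesis by simp
qed simp

text \<open>
  Both squared norms have the integrand \<open>d powr (- \<gamma>) |u|^2\<close>; at \<open>d = 0\<close> all powers are \<open>0\<close> by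
  convention.
\<close>

lemma weighted_isometry:
  assumes "u \<in> L2 (- \<gamma>)"
  shows "weighted (- \<gamma>) u \<in> L2 \<gamma>" "sqnorm \<gamma> (weighted (- \<gamma>) u) = sqnorm (- \<gamma>) u"
proof -
  have u [measurable]: "u \<in> borel_measurable disk" using L2_D(1)[OF assms] .
  have wu [measurable]: "weighted (- \<gamma>) u \<in> borel_measurable disk" unfolding weighted_def by measurable
  have m1: "(\<lambda>z. (cmod (u z))^2) \<in> borel_measurable disk"
    and m2: "(\<lambda>z. (cmod (weighted (- \<gamma>) u z))^2) \<in> borel_measurable disk" by measurable
  have eq: "disk_defect z powr \<gamma> *\<^sub>R (cmod (weighted (- \<gamma>) u z))^2 = disk_defect z powr (- \<gamma>) *\<^sub>R (cmod (u z))^2" for z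
  proof (cases "disk_defect z = 0")
    case False
    hence "disk_defect z powr \<gamma> * (disk_defect z powr (- \<gamma>))^2 = disk_defect z powr (- \<gamma>)"
      by (simp add: power2_eq_square powr_add[symmetric])
    thus ?thesis by (simp add: weighted_def norm_mult power_mult_distrib mult.assoc[symmetric])
  qed (simp add: weighted_def)
  have "integrable (disk_measure \<gamma>) (\<lambda>z. (cmod (weighted (- \<gamma>) u z))^2)"
    unfolding integrable_disk_measure[OF m2] eq
    using L2_D(2)[OF assms] unfolding integrable_disk_measure[OF m1] .
  with wu show "weighted (- \<gamma>) u \<in> L2 \<gamma>" by (intro L2_I)
  show "sqnorm \<gamma> (weighted (- \<gamma>) u) = sqnorm (- \<gamma>) u"
    unfolding sqnorm_def integral_disk_measure[OF m1] integral_disk_measure[OF m2] eq ..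
qed

lemma weighted_diff: "(\<lambda>z. weighted s u z - weighted s v z) = weighted s (\<lambda>z. u z - v z)"
  by (auto simp: weighted_def algebra_simps)

lemma wirtinger_diff:
  "(\<lambda>z. wirtinger vx vy z - wirtinger wx wy z) = wirtinger (\<lambda>z. vx z - wx z) (\<lambda>z. vy z - wy z)"
  by (auto simp: wirtinger_def fun_eq_iff algebra_simps diff_divide_distrib)

text \<open>
  The weight of the measure cancels against the one in the first argument.
\<close>

lemma L2_inner_weighted:
  assumes "u \<in> L2 (- \<gamma>)" "g \<in> L2 \<gamma>"
  shows "L2_inner \<gamma> (weighted (- \<gamma>) u) g = (\<integral>z. u z * cnj (g z) \<partial>disk)"
proof -
  have [measurable]: "u \<in> borel_measurable disk" "g \<in> borel_measurable disk"
    using L2_D(1)[OF assms(1)] L2_D(1)[OF assms(2)] .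
  have m: "(\<lambda>z. weighted (- \<gamma>) u z * cnj (g z)) \<in> borel_measurable disk"
    unfolding weighted_def by measurable
  have m2: "(\<lambda>z. disk_defect z powr \<gamma> *\<^sub>R (weighted (- \<gamma>) u z * cnj (g z))) \<in> borel_measurable disk"
    using m by measurable
  have m3: "(\<lambda>z. u z * cnj (g z)) \<in> borel_measurable disk" by measurable
  show ?thesis
    unfolding L2_inner_def integral_disk_measure[OF m]
  proof (rule integral_cong_AE[OF m2 m3], use AE_disk_interior in eventually_elim)
    case (elim z)
    hence "0 < disk_defect z" by (rule disk_defect_pos)
    hence "complex_of_real (disk_defect z powr \<gamma>) * complex_of_real (disk_defect z powr (- \<gamma>)) = 1"
      by (simp add: of_real_mult[symmetric] powr_add[symmetric] del: of_real_mult)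
    thus ?case by (simp add: weighted_def scaleR_conv_of_real mult.assoc[symmetric])
  qed
qed

lemma integral_disk_eq_lebesgue:
  fixes f :: "complex \<Rightarrow> complex"
  assumes "\<And>z. 1 < cmod z \<Longrightarrow> f z = 0"
  shows "integral\<^sup>L disk f = integral\<^sup>L lebesgue f"
proof -
  have "indicator (cball 0 1) z *\<^sub>R f z = f z" for z
    using assms[of z] by (auto simp: indicator_def)
  thus ?thesis by (subst integral_restrict_space) auto
qed

lemma disk_C0_zero_outside: "disk_C0 \<psi> \<Longrightarrow> 1 < cmod z \<Longrightarrow> \<psi> z = 0"
  by (auto simp: disk_C0_def)

text \<open>
  Integration by parts moves \<open>\<partial>\<close> to \<open>cnj g\<close>, and \<open>\<partial> (cnj g) = cnj (\<partial>bar g) = 0\<close>.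
\<close>

lemma del_orthogonal_holomorphic:
  assumes \<phi>: "\<phi> \<in> test_functions" and g: "g holomorphic_on ball 0 1"
  shows "(\<integral>z. del \<phi> z * cnj (g z) \<partial>lebesgue) = 0"
proof -
  note C1 = test_function_imp_C1(1)[OF \<phi>]
  define A where "A = (\<lambda>z. cnj (g z))"
  have D: "(A has_derivative (\<lambda>h. cnj (deriv g z * h))) (at z)" if "z \<in> ball 0 1" for z
    using holomorphic_derivI[OF g open_ball that]
    unfolding A_def has_field_derivative_def by (rule has_derivative_cnj)
  note ddA = dd_eqI[OF D]
  have diff: "A differentiable (at z)" if "z \<in> ball 0 1" for z
    using D[OF that] by (rule differentiableI)
  have dg: "continuous_on (ball 0 1) (deriv g)"
    using holomorphic_deriv[OF g open_ball] by (rule holomorphic_on_imp_continuous_on)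
  have cont: "continuous_on (ball 0 1) (dd b A)" for b
  proof -
    have "continuous_on (ball 0 1) (\<lambda>z. cnj (deriv g z * b))"
      by (intro continuous_intros dg)
    thus ?thesis by (rule continuous_on_eq) (simp add: ddA)
  qed
  have A_cont: "continuous_on (ball 0 1) A"
    unfolding A_def by (intro continuous_intros holomorphic_on_imp_continuous_on g)
  note parts = integral_by_parts_disk[OF C1 diff cont]
  have int: "integrable lebesgue (\<lambda>z. A z * dd b \<phi> z + dd b A z * \<phi> z)" for b
    by (intro Bochner_Integration.integrable_add disk_C0_integrable disk_C0_mult disk_C1_dd_C0 C1
        disk_C1_imp_C0 A_cont cont)
  have "(\<integral>z. (A z * dd 1 \<phi> z + dd 1 A z * \<phi> z) / 2
      - \<i> / 2 * (A z * dd \<i> \<phi> z + dd \<i> A z * \<phi> z) \<partial>lebesgue) = 0"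
    using int parts by (subst Bochner_Integration.integral_diff) auto
  moreover have "(A z * dd 1 \<phi> z + dd 1 A z * \<phi> z) / 2 - \<i> / 2 * (A z * dd \<i> \<phi> z + dd \<i> A z * \<phi> z)
      = del \<phi> z * cnj (g z)" for z
  proof (cases "z \<in> ball 0 1")
    case True
    hence dA: "dd 1 A z = cnj (deriv g z)" "dd \<i> A z = - \<i> * cnj (deriv g z)"
      using ddA[OF True] by simp_all
    show ?thesis
      unfolding dA by (simp add: wirtinger_def pdx_eq_dd pdy_eq_dd A_def field_simps)
  next
    case False
    obtain r where r: "r < 1" "\<And>z. r < cmod z \<Longrightarrow> \<phi> z = 0" using C1 by (auto simp: disk_C1_def)
    have "r < cmod z" using False r by auto
    hence "\<phi> z = 0" "dd b \<phi> z = 0" for b using r(2) dd_zero_outside[of r \<phi> z b, OF r(2)] by auto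
    thus ?thesis by (simp add: wirtinger_def pdx_eq_dd pdy_eq_dd)
  qed
  ultimately show ?thesis by simp
qed

lemma H10_L2: "H10 s v vx vy \<Longrightarrow> wirtinger vx vy \<in> L2 s"
  by (auto simp: H10_def intro: wirtinger_L2)

lemma H10_orthogonal_analytic:
  assumes H: "H10 (- \<gamma>) v vx vy" and g: "g \<in> analytic_L2 \<gamma>"
  shows "L2_inner \<gamma> (weighted (- \<gamma>) (wirtinger vx vy)) g = 0"
proof -
  have gL: "g \<in> L2 \<gamma>" and hol: "g holomorphic_on ball 0 1" using g by (auto simp: analytic_L2_def)
  obtain \<phi> where \<phi>: "\<And>n. \<phi> n \<in> test_functions" and \<phi>_lim: "H10_lim (- \<gamma>) \<phi> v vx vy"
    using H10_approx[OF H] by blast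
  note \<phi> = \<phi> H10_limD[OF \<phi>_lim]
  note T = test_function_L2(4)[OF \<phi>(1)]
  have "(\<lambda>n. L2_inner \<gamma> (weighted (- \<gamma>) (del (\<phi> n))) g) \<longlonglongrightarrow> L2_inner \<gamma> (weighted (- \<gamma>) (wirtinger vx vy)) g"
  proof (rule L2_inner_tendsto)
    show "(\<lambda>n. sqnorm \<gamma> (\<lambda>z. weighted (- \<gamma>) (del (\<phi> n)) z - weighted (- \<gamma>) (wirtinger vx vy) z)) \<longlonglongrightarrow> 0"
      using \<phi>(5) unfolding weighted_diff weighted_isometry(2)[OF L2_diff[OF T H10_L2[OF H]]] .
  qed (intro weighted_isometry(1) T H10_L2[OF H] gL)+
  moreover have "L2_inner \<gamma> (weighted (- \<gamma>) (del (\<phi> n))) g = 0" for n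
  proof -
    have "L2_inner \<gamma> (weighted (- \<gamma>) (del (\<phi> n))) g = (\<integral>z. del (\<phi> n) z * cnj (g z) \<partial>disk)"
      by (rule L2_inner_weighted[OF T gL])
    also have "\<dots> = (\<integral>z. del (\<phi> n) z * cnj (g z) \<partial>lebesgue)"
      by (rule integral_disk_eq_lebesgue) (simp add: disk_C0_zero_outside[OF test_function_C0(4)[OF \<phi>(1)]])
    also have "\<dots> = 0" by (rule del_orthogonal_holomorphic[OF \<phi>(1) hol])
    finally show ?thesis .
  qed
  ultimately show ?thesis by (simp add: LIMSEQ_const_iff)
qed

text \<open>
  Testing with \<open>cnj \<phi>\<close> turns orthogonality into the weak Cauchy-Riemann equation. The analytic
  representative is set to \<open>0\<close> outside the open disk so that it is measurable on the closed disk.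
\<close>

lemma orthogonal_complement_analytic:
  assumes h: "h \<in> L2 \<gamma>"
    and orth: "\<And>\<phi>. \<phi> \<in> test_functions \<Longrightarrow> L2_inner \<gamma> h (weighted (- \<gamma>) (del \<phi>)) = 0"
  obtains g where "g \<in> analytic_L2 \<gamma>" "AE z in disk. h z = g z"
proof -
  interpret weakly_holomorphic h
  proof
    show "integrable lebesgue (\<lambda>z. indicator (cball 0 r) z * h z)" if "r < 1" for r
      by (rule L2_locally_integrable[OF h that])
    fix \<phi> assume \<phi>: "\<phi> \<in> test_functions"
    note c = test_function_cnj[OF \<phi>]
    have "L2_inner \<gamma> (weighted (- \<gamma>) (del (\<lambda>z. cnj (\<phi> z)))) h = cnj (L2_inner \<gamma> h (weighted (- \<gamma>) (del (\<lambda>z. cnj (\<phi> z)))))"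
      by (simp add: L2_inner_def mult.commute flip: Bochner_Integration.integral_cnj)
    hence "L2_inner \<gamma> (weighted (- \<gamma>) (del (\<lambda>z. cnj (\<phi> z)))) h = 0" using orth[OF c(1)] by simp
    hence "(\<integral>z. del (\<lambda>z. cnj (\<phi> z)) z * cnj (h z) \<partial>disk) = 0"
      using L2_inner_weighted[OF test_function_L2(4)[OF c(1)] h] by simp
    hence "(\<integral>z. cnj (h z * delbar \<phi> z) \<partial>disk) = 0" by (simp add: c(4) mult.commute)
    hence "(\<integral>z. h z * delbar \<phi> z \<partial>disk) = 0" by (simp only: Bochner_Integration.integral_cnj complex_cnj_zero_iff)
    thus "(\<integral>z. h z * delbar \<phi> z \<partial>lebesgue) = 0"
      by (subst (asm) integral_disk_eq_lebesgue) (simp_all add: disk_C0_zero_outside[OF test_function_C0(5)[OF \<phi>]])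
  qed
  define g where "g = (\<lambda>z. if z \<in> ball 0 1 then representative z else 0)"
  have hol: "g holomorphic_on ball 0 1"
    by (rule holomorphic_transform[OF representative_holomorphic]) (simp add: g_def)
  have "(\<lambda>z. if z \<in> ball 0 1 then representative z else 0) \<in> borel_measurable borel"
    by (intro borel_measurable_continuous_on_if) 
       (auto intro: holomorphic_on_imp_continuous_on[OF representative_holomorphic])
  hence meas: "g \<in> borel_measurable disk"
    unfolding g_def by (intro measurable_restrict_space1 measurable_completion) simp
  have ae: "AE z in disk. h z = g z"
    using AE_eq_representative AE_disk_interior by eventually_elim (simp add: g_def)
  have "integrable (disk_measure \<gamma>) (\<lambda>z. (cmod (g z))^2)"
  proof (rule integrable_cong_AE_imp[OF L2_D(2)[OF h]])
    show "(\<lambda>z. (cmod (g z))^2) \<in> borel_measurable (disk_measure \<gamma>)" using meas by measurable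
    show "AE z in disk_measure \<gamma>. (cmod (h z))^2 = (cmod (g z))^2"
      unfolding AE_disk_measure_iff using ae by eventually_elim simp
  qed
  with meas hol have "g \<in> analytic_L2 \<gamma>" by (auto simp: analytic_L2_def intro: L2_I)
  thus thesis using ae by (rule that)
qed

text \<open>
  The projection of \<open>f\<close> is a limit of \<open>w \<partial>\<phi>_n\<close>. By the a priori estimate the \<open>\<phi>_n\<close> form a Cauchy
  sequence in the completion, and its limit \<open>v\<close> represents the projection as \<open>w \<partial>v\<close>.
\<close>

lemma decomposition_exists:
  assumes "\<gamma> > -1" "f \<in> L2 \<gamma>"
  shows "\<exists>v vx vy g. decomposition \<gamma> f v vx vy g"
proof -
  have s: "- \<gamma> < 1" using assms(1) by simp
  define S where "S = (\<lambda>\<phi>. weighted (- \<gamma>) (del \<phi>)) ` test_functions"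
  have "(\<lambda>_. 0) \<in> test_functions"
    by (rule test_functionI[of _ 0]) (auto simp: C_k_const)
  hence S_ne: "S \<noteq> {}" by (auto simp: S_def)
  have S_L2: "S \<subseteq> L2 \<gamma>"
    unfolding S_def using weighted_isometry(1) test_function_L2(4) by blast
  have lincomb: "(\<lambda>z. a * weighted (- \<gamma>) (del \<phi>) z + b * weighted (- \<gamma>) (del \<psi>) z) \<in> S"
    if "\<phi> \<in> test_functions" "\<psi> \<in> test_functions" for a b \<phi> \<psi>
  proof -
    have "(\<lambda>z. a * weighted (- \<gamma>) (del \<phi>) z + b * weighted (- \<gamma>) (del \<psi>) z)
        = weighted (- \<gamma>) (del (\<lambda>z. a * \<phi> z + b * \<psi> z))"
      unfolding test_function_lincomb(4)[OF that] by (auto simp: weighted_def algebra_simps)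
    thus ?thesis unfolding S_def using test_function_lincomb(1)[OF that, of a b] by blast
  qed
  have S_add: "(\<lambda>z. u z + v z) \<in> S" if "u \<in> S" "v \<in> S" for u v
    using that lincomb[of _ _ 1 1] by (auto simp: S_def)
  have S_cmult: "(\<lambda>z. c * u z) \<in> S" if "u \<in> S" for c u
    using that lincomb[of _ _ c 0] by (auto simp: S_def)
  obtain u m where u: "\<And>n. u n \<in> S" and m: "m \<in> L2 \<gamma>" "L2_lim \<gamma> u m"
    and orth: "\<And>v. v \<in> S \<Longrightarrow> L2_inner \<gamma> (\<lambda>z. f z - m z) v = 0"
    by (rule L2_projection[OF S_L2 S_ne _ _ assms(2)]) (rule S_add S_cmult that; assumption)+
  have "\<exists>\<phi>. \<phi> \<in> test_functions \<and> u n = weighted (- \<gamma>) (del \<phi>)" for n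
    using u[of n] by (auto simp: S_def)
  then obtain \<phi> where \<phi>: "\<And>n. \<phi> n \<in> test_functions" and u_eq: "\<And>n. u n = weighted (- \<gamma>) (del (\<phi> n))" by metis
  have u_L2: "u n \<in> L2 \<gamma>" for n using u S_L2 by blast
  have cauchy_u: "L2_Cauchy \<gamma> u" by (rule L2_convergent_imp_Cauchy[OF u_L2 m])
  note T = test_function_L2[OF \<phi>]
  have diff: "sqnorm (- \<gamma>) (del (\<lambda>z. \<phi> i z - \<phi> j z)) = sqnorm \<gamma> (\<lambda>z. u i z - u j z)" for i j
    unfolding u_eq weighted_diff test_function_diff(4)[OF \<phi> \<phi>]
    by (rule weighted_isometry(2)[OF L2_diff[OF T(4) T(4)], symmetric])
  obtain C where C: "0 \<le> C"
    "\<And>\<phi>. \<phi> \<in> test_functions \<Longrightarrow> (H10_norm (- \<gamma>) \<phi> (pdx \<phi>) (pdy \<phi>))^2 \<le> C * sqnorm (- \<gamma>) (del \<phi>)"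
    using test_function_estimate[OF s] by blast
  note TD = test_function_diff[OF \<phi> \<phi>]
  have "sqnorm (- \<gamma>) (\<lambda>z. \<phi> i z - \<phi> j z) + (sqnorm (- \<gamma>) (\<lambda>z. pdx (\<phi> i) z - pdx (\<phi> j) z)
     + sqnorm (- \<gamma>) (\<lambda>z. pdy (\<phi> i) z - pdy (\<phi> j) z)) \<le> C * sqnorm \<gamma> (\<lambda>z. u i z - u j z)" for i j
    using C(2)[OF TD(1)] unfolding H10_norm_power2 diff unfolding TD(2,3) .
  hence "sqnorm (- \<gamma>) (\<lambda>z. \<phi> i z - \<phi> j z) \<le> C * sqnorm \<gamma> (\<lambda>z. u i z - u j z)"
    "sqnorm (- \<gamma>) (\<lambda>z. pdx (\<phi> i) z - pdx (\<phi> j) z) \<le> C * sqnorm \<gamma> (\<lambda>z. u i z - u j z)"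
    "sqnorm (- \<gamma>) (\<lambda>z. pdy (\<phi> i) z - pdy (\<phi> j) z) \<le> C * sqnorm \<gamma> (\<lambda>z. u i z - u j z)" for i j
    by (rule order_trans[rotated], simp add: add_nonneg_nonneg)+
  note cauchy = this[THEN L2_Cauchy_mono[OF cauchy_u C(1)]]
  obtain v where v: "v \<in> L2 (- \<gamma>)" "L2_lim (- \<gamma>) \<phi> v"
    by (rule L2_complete[OF T(1) cauchy(1)])
  obtain vx where vx: "vx \<in> L2 (- \<gamma>)" "L2_lim (- \<gamma>) (\<lambda>n. pdx (\<phi> n)) vx"
    by (rule L2_complete[OF T(2) cauchy(2)])
  obtain vy where vy: "vy \<in> L2 (- \<gamma>)" "L2_lim (- \<gamma>) (\<lambda>n. pdy (\<phi> n)) vy"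
    by (rule L2_complete[OF T(3) cauchy(3)])
  have H: "H10 (- \<gamma>) v vx vy"
    unfolding H10_def L2_norm_tendsto_0_iff using v vx vy \<phi> by blast
  note W = wirtinger_L2(1)[OF vx(1) vy(1)]
  have "(\<lambda>n. sqnorm (- \<gamma>) (\<lambda>z. pdx (\<phi> n) z - vx z) + sqnorm (- \<gamma>) (\<lambda>z. pdy (\<phi> n) z - vy z)) \<longlonglongrightarrow> 0"
    using tendsto_add[OF vx(2) vy(2)] by simp
  hence "L2_lim (- \<gamma>) (\<lambda>n. del (\<phi> n)) (wirtinger vx vy)"
    by (rule sqnorm_tendsto_0_le[OF wirtinger_L2(2)[OF vx(1) vy(1) T(2,3)]])
  hence lim: "L2_lim \<gamma> u (weighted (- \<gamma>) (wirtinger vx vy))"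
    unfolding u_eq weighted_diff weighted_isometry(2)[OF L2_diff[OF T(4) W]] .
  have m_eq: "AE z in disk. m z = weighted (- \<gamma>) (wirtinger vx vy) z"
    by (rule L2_limit_unique[OF u_L2 m(1) weighted_isometry(1)[OF W] m(2) lim])
  have fm: "(\<lambda>z. f z - m z) \<in> L2 \<gamma>" by (rule L2_diff[OF assms(2) m(1)])
  obtain g where g: "g \<in> analytic_L2 \<gamma>" "AE z in disk. f z - m z = g z"
    by (rule orthogonal_complement_analytic[OF fm]) (use orth in \<open>auto simp: S_def intro: that\<close>)
  have "ae_eq f (\<lambda>z. weighted (- \<gamma>) (wirtinger vx vy) z + g z)"
    unfolding ae_eq_def using m_eq g(2) by eventually_elim (simp add: algebra_simps)
  with H g(1) show ?thesis unfolding decomposition_def by blast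
qed

lemma decomposition_D:
  assumes "decomposition \<gamma> f v vx vy g"
  shows "H10 (- \<gamma>) v vx vy" "g \<in> analytic_L2 \<gamma>" "g \<in> L2 \<gamma>" "weighted (- \<gamma>) (wirtinger vx vy) \<in> L2 \<gamma>"
    "AE z in disk. f z = weighted (- \<gamma>) (wirtinger vx vy) z + g z"
    "sqnorm \<gamma> (weighted (- \<gamma>) (wirtinger vx vy)) = sqnorm (- \<gamma>) (wirtinger vx vy)"
  using assms weighted_isometry[OF H10_L2, of \<gamma> v vx vy]
  by (auto simp: decomposition_def analytic_L2_def ae_eq_def)

lemma sqnorm_cong_AE:
  assumes "f \<in> L2 s" "g \<in> L2 s" "AE z in disk. f z = g z"
  shows "sqnorm s f = sqnorm s g"
  unfolding sqnorm_def
proof (rule integral_cong_AE)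
  show "AE z in disk_measure s. (cmod (f z))^2 = (cmod (g z))^2"
    unfolding AE_disk_measure_iff using assms(3) by eventually_elim simp
qed (use L2_D(2)[OF assms(1)] L2_D(2)[OF assms(2)] in auto)

text \<open>
  The difference of two decompositions of \<open>f\<close> decomposes \<open>0\<close>. Its two parts are orthogonal, so both
  vanish, and the estimate in the completion recovers \<open>v\<close>, \<open>vx\<close> and \<open>vy\<close> from \<open>\<partial>v\<close>.
\<close>

lemma decomposition_unique:
  assumes "\<gamma> > -1" and D1: "decomposition \<gamma> f v vx vy g" and D2: "decomposition \<gamma> f w wx wy h"
  shows "ae_eq w v" "ae_eq wx vx" "ae_eq wy vy" "ae_eq h g"
proof -
  note d1 = decomposition_D[OF D1] and d2 = decomposition_D[OF D2]
  define p where "p = weighted (- \<gamma>) (wirtinger (\<lambda>z. wx z - vx z) (\<lambda>z. wy z - vy z))"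
  define q where "q = (\<lambda>z. h z - g z)"
  have H: "H10 (- \<gamma>) (\<lambda>z. w z - v z) (\<lambda>z. wx z - vx z) (\<lambda>z. wy z - vy z)"
    by (rule H10_diff[OF d2(1) d1(1)])
  have p: "p \<in> L2 \<gamma>" "sqnorm \<gamma> p = sqnorm (- \<gamma>) (wirtinger (\<lambda>z. wx z - vx z) (\<lambda>z. wy z - vy z))"
    unfolding p_def by (rule weighted_isometry[OF H10_L2[OF H]])+
  have q: "q \<in> analytic_L2 \<gamma>"
    using d1(2) d2(2) unfolding q_def analytic_L2_def by (auto intro: holomorphic_on_diff)
  hence qL: "q \<in> L2 \<gamma>" by (simp add: analytic_L2_def)
  have p_eq: "p = (\<lambda>z. weighted (- \<gamma>) (wirtinger wx wy) z - weighted (- \<gamma>) (wirtinger vx vy) z)"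
    unfolding p_def weighted_diff wirtinger_diff ..
  have "AE z in disk. p z + q z = 0"
    using d1(5) d2(5)
  proof eventually_elim
    case (elim z)
    have "p z + q z = (weighted (- \<gamma>) (wirtinger wx wy) z + h z) - (weighted (- \<gamma>) (wirtinger vx vy) z + g z)"
      by (simp add: p_eq q_def)
    thus ?case unfolding elim[symmetric] by simp
  qed
  hence "sqnorm \<gamma> (\<lambda>z. p z + q z) = 0"
    using sqnorm_eq_0_iff[OF L2_add[OF p(1) qL]] by simp
  moreover have "L2_inner \<gamma> p q = 0" unfolding p_def by (rule H10_orthogonal_analytic[OF H q])
  ultimately have "sqnorm \<gamma> p + sqnorm \<gamma> q = 0"
    using sqnorm_add[OF p(1) qL] by simp
  hence zero: "sqnorm \<gamma> p = 0" "sqnorm \<gamma> q = 0"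
    by (simp_all add: add_nonneg_eq_0_iff)
  have s: "- \<gamma> < 1" using assms(1) by simp
  obtain C where "(H10_norm (- \<gamma>) (\<lambda>z. w z - v z) (\<lambda>z. wx z - vx z) (\<lambda>z. wy z - vy z))^2
      \<le> C * sqnorm (- \<gamma>) (wirtinger (\<lambda>z. wx z - vx z) (\<lambda>z. wy z - vy z))"
    using H10_estimate[OF s] H by blast
  hence "sqnorm (- \<gamma>) (\<lambda>z. w z - v z) + (sqnorm (- \<gamma>) (\<lambda>z. wx z - vx z) + sqnorm (- \<gamma>) (\<lambda>z. wy z - vy z)) \<le> 0"
    using zero(1) p(2) by (simp add: H10_norm_power2)
  moreover have "x = 0 \<and> y = 0 \<and> t = 0" if "x + (y + t) \<le> 0" "0 \<le> x" "0 \<le> y" "0 \<le> t" for x y t :: real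
    using that by auto
  ultimately have "sqnorm (- \<gamma>) (\<lambda>z. w z - v z) = 0" "sqnorm (- \<gamma>) (\<lambda>z. wx z - vx z) = 0" "sqnorm (- \<gamma>) (\<lambda>z. wy z - vy z) = 0"
    using sqnorm_nonneg by metis+
  moreover have "(\<lambda>z. w z - v z) \<in> L2 (- \<gamma>)" "(\<lambda>z. wx z - vx z) \<in> L2 (- \<gamma>)" "(\<lambda>z. wy z - vy z) \<in> L2 (- \<gamma>)"
    using H by (auto simp: H10_def)
  ultimately show "ae_eq w v" "ae_eq wx vx" "ae_eq wy vy"
    by (simp_all add: sqnorm_eq_0_iff ae_eq_def)
  show "ae_eq h g" using zero(2) sqnorm_eq_0_iff[OF qL] by (simp add: ae_eq_def q_def)
qed

text \<open>
  By Pythagoras' theorem each part has norm at most that of \<open>f\<close>.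
\<close>

lemma decomposition_stable:
  assumes "\<gamma> > -1"
  shows "\<exists>C. \<forall>f \<in> L2 \<gamma>. \<forall>v vx vy g. decomposition \<gamma> f v vx vy g \<longrightarrow>
        H10_norm (- \<gamma>) v vx vy + L2_norm \<gamma> g \<le> C * L2_norm \<gamma> f"
proof -
  have s: "- \<gamma> < 1" using assms(1) by simp
  obtain C where C: "0 \<le> C"
    "\<And>v vx vy. H10 (- \<gamma>) v vx vy \<Longrightarrow> (H10_norm (- \<gamma>) v vx vy)^2 \<le> C * sqnorm (- \<gamma>) (wirtinger vx vy)"
    using H10_estimate[OF s] by blast
  show ?thesis
  proof (intro exI[of _ "sqrt C + 1"] ballI allI impI)
    fix f v vx vy g assume f: "f \<in> L2 \<gamma>" and D: "decomposition \<gamma> f v vx vy g"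
    note d = decomposition_D[OF D]
    have pythagoras: "sqnorm \<gamma> f = sqnorm (- \<gamma>) (wirtinger vx vy) + sqnorm \<gamma> g"
      using sqnorm_cong_AE[OF f L2_add[OF d(4,3)] d(5)] sqnorm_add[OF d(4,3)]
        H10_orthogonal_analytic[OF d(1,2)] d(6) by simp
    have "L2_norm \<gamma> g \<le> L2_norm \<gamma> f"
      unfolding L2_norm_eq pythagoras by (intro real_sqrt_le_mono) simp
    moreover have "H10_norm (- \<gamma>) v vx vy \<le> sqrt C * L2_norm \<gamma> f"
    proof -
      have "(H10_norm (- \<gamma>) v vx vy)^2 \<le> C * sqnorm (- \<gamma>) (wirtinger vx vy)" by (rule C(2)[OF d(1)])
      also have "\<dots> \<le> C * sqnorm \<gamma> f"
        using C(1) by (intro mult_left_mono) (auto simp: pythagoras)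
      finally show ?thesis
        unfolding L2_norm_eq real_sqrt_mult[symmetric] by (rule real_le_rsqrt)
    qed
    ultimately show "H10_norm (- \<gamma>) v vx vy + L2_norm \<gamma> g \<le> (sqrt C + 1) * L2_norm \<gamma> f"
      by (simp add: distrib_right)
  qed
qed

section \<open>Complex conjugation and the antianalytic decomposition\<close>

definition conj_fun :: "(complex \<Rightarrow> complex) \<Rightarrow> complex \<Rightarrow> complex" where
  "conj_fun f z = cnj (f z)"

lemma cnj_eq_conj_fun: "(\<lambda>z. cnj (f z)) = conj_fun f"
  by (auto simp: conj_fun_def)

lemma conj_fun_conj_fun [simp]: "conj_fun (conj_fun f) = f"
  by (auto simp: conj_fun_def)

lemma L2_conj [simp]: "conj_fun f \<in> L2 s \<longleftrightarrow> f \<in> L2 s"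
proof -
  have *: "conj_fun f \<in> L2 s" if "f \<in> L2 s" for f
    using L2_D[OF that] unfolding conj_fun_def[abs_def] by (intro L2_I borel_measurable_cnj) auto
  show ?thesis using *[of f] *[of "conj_fun f"] by auto
qed

lemma L2_norm_conj [simp]: "L2_norm s (conj_fun f) = L2_norm s f"
  by (simp add: L2_norm_def conj_fun_def)

lemma ae_eq_conj [simp]: "ae_eq (conj_fun f) (conj_fun g) \<longleftrightarrow> ae_eq f g"
  by (simp add: ae_eq_def conj_fun_def)

lemma antianalytic_L2_iff: "g \<in> antianalytic_L2 s \<longleftrightarrow> conj_fun g \<in> analytic_L2 s"
  unfolding antianalytic_L2_def analytic_L2_def mem_Collect_eq unfolding cnj_eq_conj_fun[of g] by simp

lemma H10_conj [simp]: "H10 s (conj_fun v) (conj_fun vx) (conj_fun vy) \<longleftrightarrow> H10 s v vx vy"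
proof -
  have *: "H10 s (conj_fun v) (conj_fun vx) (conj_fun vy)" if H: "H10 s v vx vy" for v vx vy
  proof -
    obtain \<phi> where \<phi>: "\<And>n. \<phi> n \<in> test_functions"
      "(\<lambda>n. L2_norm s (\<lambda>z. \<phi> n z - v z)) \<longlonglongrightarrow> 0"
      "(\<lambda>n. L2_norm s (\<lambda>z. pdx (\<phi> n) z - vx z)) \<longlonglongrightarrow> 0"
      "(\<lambda>n. L2_norm s (\<lambda>z. pdy (\<phi> n) z - vy z)) \<longlonglongrightarrow> 0"
      using H unfolding H10_def by blast
    have n: "L2_norm s (\<lambda>z. conj_fun a z - conj_fun b z) = L2_norm s (\<lambda>z. a z - b z)" for a b
    proof -
      have "(\<lambda>z. conj_fun a z - conj_fun b z) = conj_fun (\<lambda>z. a z - b z)" by (auto simp: conj_fun_def)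
      thus ?thesis by simp
    qed
    have c: "conj_fun (\<phi> n) \<in> test_functions" "pdx (conj_fun (\<phi> n)) = conj_fun (pdx (\<phi> n))"
      "pdy (conj_fun (\<phi> n)) = conj_fun (pdy (\<phi> n))" for n
      unfolding conj_fun_def[abs_def] by (rule test_function_cnj[OF \<phi>(1)])+
    show ?thesis
      unfolding H10_def using H \<phi> by (intro conjI exI[of _ "\<lambda>n. conj_fun (\<phi> n)"] allI c) (simp_all add: c n H10_def)
  qed
  show ?thesis using *[of v vx vy] *[of "conj_fun v" "conj_fun vx" "conj_fun vy"] by auto
qed

lemma weighted_wirtinger_conj:
  "weighted s (wirtinger (conj_fun vx) (conj_fun vy)) = conj_fun (weighted s (wirtinger_bar vx vy))"
  by (auto simp: weighted_def wirtinger_def wirtinger_bar_def conj_fun_def)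

lemma L2_inner_conj: "L2_inner s (conj_fun f) (conj_fun g) = cnj (L2_inner s f g)"
  by (simp add: L2_inner_def conj_fun_def flip: Bochner_Integration.integral_cnj)

text \<open>
  Conjugation maps test functions to test functions and exchanges \<open>\<partial>\<close> and \<open>\<partial>bar\<close>.
\<close>

lemma decomposition_bar_iff:
  "decomposition_bar \<gamma> f v vx vy g \<longleftrightarrow>
    decomposition \<gamma> (conj_fun f) (conj_fun v) (conj_fun vx) (conj_fun vy) (conj_fun g)"
proof -
  have "(\<lambda>z. weighted (- \<gamma>) (wirtinger (conj_fun vx) (conj_fun vy)) z + conj_fun g z)
     = conj_fun (\<lambda>z. weighted (- \<gamma>) (wirtinger_bar vx vy) z + g z)"
    unfolding weighted_wirtinger_conj by (auto simp: conj_fun_def)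
  thus ?thesis
    by (simp add: decomposition_bar_def decomposition_def antianalytic_L2_iff)
qed

theorem proposition12:
  fixes \<gamma> :: real
  assumes "\<gamma> > -1"
  shows
    "(\<forall>f \<in> L2 \<gamma>. \<exists>v vx vy g.
        decomposition \<gamma> f v vx vy g \<and>
        L2_inner \<gamma> (weighted (- \<gamma>) (wirtinger vx vy)) g = 0 \<and>
        (\<forall>w wx wy h. decomposition \<gamma> f w wx wy h \<longrightarrow>
           ae_eq w v \<and> ae_eq wx vx \<and> ae_eq wy vy \<and> ae_eq h g)) \<and>
     (\<exists>C. \<forall>f \<in> L2 \<gamma>. \<forall>v vx vy g. decomposition \<gamma> f v vx vy g \<longrightarrow>
        H10_norm (- \<gamma>) v vx vy + L2_norm \<gamma> g \<le> C * L2_norm \<gamma> f) \<and>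
     (\<forall>f \<in> L2 \<gamma>. \<exists>v vx vy g.
        decomposition_bar \<gamma> f v vx vy g \<and>
        L2_inner \<gamma> (weighted (- \<gamma>) (wirtinger_bar vx vy)) g = 0 \<and>
        (\<forall>w wx wy h. decomposition_bar \<gamma> f w wx wy h \<longrightarrow>
           ae_eq w v \<and> ae_eq wx vx \<and> ae_eq wy vy \<and> ae_eq h g)) \<and>
     (\<exists>C. \<forall>f \<in> L2 \<gamma>. \<forall>v vx vy g. decomposition_bar \<gamma> f v vx vy g \<longrightarrow>
        H10_norm (- \<gamma>) v vx vy + L2_norm \<gamma> g \<le> C * L2_norm \<gamma> f)"
proof (intro conjI ballI)
  fix f assume "f \<in> L2 \<gamma>"
  then obtain v vx vy g where D: "decomposition \<gamma> f v vx vy g"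
    using decomposition_exists[OF assms] by blast
  have "L2_inner \<gamma> (weighted (- \<gamma>) (wirtinger vx vy)) g = 0"
    by (rule H10_orthogonal_analytic[OF decomposition_D(1,2)[OF D]])
  with D decomposition_unique[OF assms D]
  show "\<exists>v vx vy g.
        decomposition \<gamma> f v vx vy g \<and>
        L2_inner \<gamma> (weighted (- \<gamma>) (wirtinger vx vy)) g = 0 \<and>
        (\<forall>w wx wy h. decomposition \<gamma> f w wx wy h \<longrightarrow>
           ae_eq w v \<and> ae_eq wx vx \<and> ae_eq wy vy \<and> ae_eq h g)"
    by blast
next
  show "\<exists>C. \<forall>f \<in> L2 \<gamma>. \<forall>v vx vy g. decomposition \<gamma> f v vx vy g \<longrightarrow>
        H10_norm (- \<gamma>) v vx vy + L2_norm \<gamma> g \<le> C * L2_norm \<gamma> f"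
    by (rule decomposition_stable[OF assms])
next
  fix f assume "f \<in> L2 \<gamma>"
  hence "conj_fun f \<in> L2 \<gamma>" by simp
  then obtain v vx vy g where D: "decomposition \<gamma> (conj_fun f) v vx vy g"
    using decomposition_exists[OF assms] by blast
  show "\<exists>v vx vy g.
        decomposition_bar \<gamma> f v vx vy g \<and>
        L2_inner \<gamma> (weighted (- \<gamma>) (wirtinger_bar vx vy)) g = 0 \<and>
        (\<forall>w wx wy h. decomposition_bar \<gamma> f w wx wy h \<longrightarrow>
           ae_eq w v \<and> ae_eq wx vx \<and> ae_eq wy vy \<and> ae_eq h g)"
  proof (intro exI conjI allI impI)
    show "decomposition_bar \<gamma> f (conj_fun v) (conj_fun vx) (conj_fun vy) (conj_fun g)"
      using D by (simp add: decomposition_bar_iff)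
    have "L2_inner \<gamma> (weighted (- \<gamma>) (wirtinger vx vy)) g = 0"
      by (rule H10_orthogonal_analytic[OF decomposition_D(1,2)[OF D]])
    moreover have "weighted (- \<gamma>) (wirtinger_bar (conj_fun vx) (conj_fun vy)) = conj_fun (weighted (- \<gamma>) (wirtinger vx vy))"
      using weighted_wirtinger_conj[of "- \<gamma>" "conj_fun vx" "conj_fun vy"] by simp
    ultimately show "L2_inner \<gamma> (weighted (- \<gamma>) (wirtinger_bar (conj_fun vx) (conj_fun vy))) (conj_fun g) = 0"
      by (simp add: L2_inner_conj)
    fix w wx wy h assume "decomposition_bar \<gamma> f w wx wy h"
    hence "decomposition \<gamma> (conj_fun f) (conj_fun w) (conj_fun wx) (conj_fun wy) (conj_fun h)"
      by (simp add: decomposition_bar_iff)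
    note U = decomposition_unique[OF assms D this]
    have ae: "ae_eq a (conj_fun b)" if "ae_eq (conj_fun a) b" for a b
      using that ae_eq_conj[of a "conj_fun b"] by simp
    show "ae_eq w (conj_fun v)" by (rule ae[OF U(1)])
    show "ae_eq wx (conj_fun vx)" by (rule ae[OF U(2)])
    show "ae_eq wy (conj_fun vy)" by (rule ae[OF U(3)])
    show "ae_eq h (conj_fun g)" by (rule ae[OF U(4)])
  qed
next
  obtain C where C: "\<And>f v vx vy g. f \<in> L2 \<gamma> \<Longrightarrow> decomposition \<gamma> f v vx vy g \<Longrightarrow>
        H10_norm (- \<gamma>) v vx vy + L2_norm \<gamma> g \<le> C * L2_norm \<gamma> f"
    using decomposition_stable[OF assms] by blast
  show "\<exists>C. \<forall>f \<in> L2 \<gamma>. \<forall>v vx vy g. decomposition_bar \<gamma> f v vx vy g \<longrightarrow>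
        H10_norm (- \<gamma>) v vx vy + L2_norm \<gamma> g \<le> C * L2_norm \<gamma> f"
  proof (intro exI[of _ C] ballI allI impI)
    fix f v vx vy g assume "f \<in> L2 \<gamma>" "decomposition_bar \<gamma> f v vx vy g"
    with C[of "conj_fun f" "conj_fun v" "conj_fun vx" "conj_fun vy" "conj_fun g"]
    show "H10_norm (- \<gamma>) v vx vy + L2_norm \<gamma> g \<le> C * L2_norm \<gamma> f"
      by (simp add: decomposition_bar_iff H10_norm_def)
  qed
qed

end
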